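(* Consider the generalized AMP orbit $(u^{[k]}(X))_{k\ge0}$ with initialization $u^{[0]}(X)=u^0$, and assume that for every $k\ge0$, $F_k\in C^\infty(\mathbb{R}^{k+1})$ and its partial derivatives of all nonzero orders are uniformly bounded. For any $k\ge0$, $p\ge1$, and $m\ge0$, there exist constants $\Gamma_{k,p,m}$ and $\Gamma'_{k,p,m}$ (independent of $n$) such that for any $n\ge2$, $$\sup_{\mathcal{B}_n(k,p,m)}\bigl(\mathbb{E}\bigl|\partial_Pu^{[k]}(A)_i\bigr|^p\bigr)^{1/p}\le\frac{\Gamma_{k,p,m}}{n^{m/2}}$$ and $$\sup_{\mathcal{B}_n(k,p,m)}\bigl(\mathbb{E}\bigl|\partial_P\bigl(\hat A_nu^{[k]}(A)\bigr)_i\bigr|^p\bigr)^{1/p}\le\frac{\Gamma'_{k,p,m}}{n^{m/2}}.$$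
   Context: Notation. $M_n(\mathbb{R})$ is the set of real symmetric $n\times n$ matrices, $[n]=\{1,\dots,n\}$, $\|\cdot\|_2$ is the Euclidean norm. Functions are applied to vectors coordinatewise. For $X,Z\in M_n(\mathbb{R})$ put $\hat X_n=\frac{X}{\sqrt n}+\frac{Z}{n}$. The generalized AMP orbit associated with functions $F_k:\mathbb{R}^{k+1}\to\mathbb{R}$ (not depending on $n$) is $$u^{[k+1]}(X)=F_k\bigl(\hat X_nu^{[k]}(X),u^{[k-1]}(X),\ldots,u^{[0]}(X)\bigr),\quad k\ge0.$$ Randomness. Fix $\sigma>0$. For every $n$, $u^0$ is an $n$-dimensional random vector and $Z=(z_{ii'})$ is a random symmetric $n\times n$ matrix (possibly dependent on $u^0$) such that, for some constant $C(\sigma)$, each of $\mathbb{E}\exp(\|u^0\|_2^2/(\sigma n))$, $\max_{i\in[n]}\mathbb{E}\exp(|u^0_i|/\sigma)$, $\max_{i,i'\in[n]}\mathbb{E}\exp(|z_{ii'}|/\sigma)$ is at most $C(\sigma)$ for all $n\ge1$. $\mathcal{G}_n(\sigma)$ is the collection of $n\times n$ symmetric random matrices $A=(a_{ii'})$, independent of $(u^0,Z)$, whose (upper triangular) entries are independent, centered, and each $\sigma'$-subgaussian for some $0\le\sigma'\le\sigma$ (i.e. $\mathbb{E}e^{\lambda a_{ii'}}\le e^{\lambda^2\sigma'^2/2}$ for all $\lambda\in\mathbb{R}$). Derivatives. $\mathcal{T}_n$ is the set of all sequences $(i_r,i_r')_{r\ge1}\subset[n]^2$ with $i_r<i_r'$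 for all $r$. For a finite $P\subset\mathbb{N}$ and $(i_r,i_r')_{r\ge1}\in\mathcal{T}_n$, $\partial_Ph(X)$ is the partial derivative of $h:M_n(\mathbb{R})\to\mathbb{R}$ with respect to the variables $x_{i_ri_r'}$, $r\in P$, counting multiplicities, where $X$ is parametrized by its upper triangular entries (so $x_{ii'}$ and $x_{i'i}$ are the same variable). For $H=(h_1,\ldots,h_n)$, $\partial_PH(X)_i=\partial_Ph_i(X)$; in particular $\partial_P(\hat A_nu^{[k]}(A))_i$ is the derivative of $X\mapsto(\hat X_nu^{[k]}(X))_i$ evaluated at $X=A$. $\mathcal{B}_n(k,p,m)$ is the collection of all $(P,(i_r,i_r')_{r\ge1},A,i)$ with $P\subset\mathbb{N}$, $|P|=m$, $(i_r,i_r')_{r\ge1}\in\mathcal{T}_n$, $A\in\mathcal{G}_n(\sigma)$, $i\in[n]$. *)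

theory Defs
  imports "HOL-Probability.Probability"
begin

text \<open>
  The dimension \<open>n\<close> varies inside the statement, so vectors and matrices are functions on \<open>nat\<close>
  of which only the values at indices in \<open>{1..n}\<close> are used.
\<close>

text \<open>
  A function on \<open>d\<close>-dimensional space is rendered as a function on \<open>nat \<Rightarrow> real\<close> that depends only
  on the coordinates with index below \<open>d\<close>.  For such functions continuity in the product topology
  of \<open>nat \<Rightarrow> real\<close> is ordinary continuity on Euclidean space.
\<close>

definition depends_on_first :: "nat \<Rightarrow> ((nat \<Rightarrow> real) \<Rightarrow> real) \<Rightarrow> bool" where
  "depends_on_first d f \<longleftrightarrow> (\<forall>x y. (\<forall>j<d. x j = y j) \<longrightarrow> f x = f y)"

definition partial :: "nat \<Rightarrow> ((nat \<Rightarrow> real) \<Rightarrow> real) \<Rightarrow> (nat \<Rightarrow> real) \<Rightarrow> real" where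
  "partial j f x = deriv (\<lambda>t. f (x(j := t))) (x j)"

fun partials :: "nat list \<Rightarrow> ((nat \<Rightarrow> real) \<Rightarrow> real) \<Rightarrow> (nat \<Rightarrow> real) \<Rightarrow> real" where
  "partials [] f = f"
| "partials (j # js) f = partial j (partials js f)"

definition C_infinity :: "nat \<Rightarrow> ((nat \<Rightarrow> real) \<Rightarrow> real) \<Rightarrow> bool" where
  "C_infinity d f \<longleftrightarrow> depends_on_first d f \<and>
     (\<forall>js. set js \<subseteq> {..<d} \<longrightarrow>
        continuous_on UNIV (partials js f) \<and>
        (\<forall>j<d. \<forall>x. (\<lambda>t. partials js f (x(j := t))) differentiable (at (x j))))"

definition bounded_partials :: "nat \<Rightarrow> ((nat \<Rightarrow> real) \<Rightarrow> real) \<Rightarrow> bool" where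
  "bounded_partials d f \<longleftrightarrow>
     (\<forall>js. js \<noteq> [] \<and> set js \<subseteq> {..<d} \<longrightarrow> (\<exists>B. \<forall>x. \<bar>partials js f x\<bar> \<le> B))"

definition hat_mat :: "nat \<Rightarrow> (nat \<Rightarrow> nat \<Rightarrow> real) \<Rightarrow> (nat \<Rightarrow> nat \<Rightarrow> real) \<Rightarrow> nat \<Rightarrow> nat \<Rightarrow> real" where
  "hat_mat n Z X i j = X i j / sqrt (real n) + Z i j / real n"

definition mat_vec :: "nat \<Rightarrow> (nat \<Rightarrow> nat \<Rightarrow> real) \<Rightarrow> (nat \<Rightarrow> real) \<Rightarrow> nat \<Rightarrow> real" where
  "mat_vec n X v i = (\<Sum>j=1..n. X i j * v j)"

text \<open>
  Argument \<open>0\<close> of \<open>F k\<close> is the matrix-vector product, argument \<open>j\<close> with \<open>1 \<le> j \<le> k\<close> is the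
  iterate of index \<open>k - j\<close>; the zeros beyond are irrelevant if \<open>F k\<close> depends only on its first
  \<open>k + 1\<close> arguments.
\<close>

fun amp :: "(nat \<Rightarrow> (nat \<Rightarrow> real) \<Rightarrow> real) \<Rightarrow> nat \<Rightarrow> (nat \<Rightarrow> real) \<Rightarrow> (nat \<Rightarrow> nat \<Rightarrow> real)
    \<Rightarrow> nat \<Rightarrow> (nat \<Rightarrow> nat \<Rightarrow> real) \<Rightarrow> nat \<Rightarrow> real" where
  "amp F n v Z 0 X = v"
| "amp F n v Z (Suc k) X =
     (\<lambda>i. F k (\<lambda>j. if j = 0 then mat_vec n (hat_mat n Z X) (amp F n v Z k X) i
                   else if j \<le> k then amp F n v Z (k - j) X i
                   else 0))"

definition set_entry ::
    "nat \<times> nat \<Rightarrow> real \<Rightarrow> (nat \<Rightarrow> nat \<Rightarrow> real) \<Rightarrow> nat \<Rightarrow> nat \<Rightarrow> real" where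
  "set_entry e t X = (\<lambda>a b. if (a, b) = e \<or> (b, a) = e then t else X a b)"

definition entry_deriv ::
    "nat \<times> nat \<Rightarrow> ((nat \<Rightarrow> nat \<Rightarrow> real) \<Rightarrow> real) \<Rightarrow> (nat \<Rightarrow> nat \<Rightarrow> real) \<Rightarrow> real" where
  "entry_deriv e h X = deriv (\<lambda>t. h (set_entry e t X)) (X (fst e) (snd e))"

text \<open>
  The order in which the derivatives are taken is immaterial for smooth functions; it is fixed to
  be the increasing order of \<open>P\<close>.
\<close>

definition multi_deriv ::
    "(nat \<Rightarrow> nat \<times> nat) \<Rightarrow> nat set \<Rightarrow> ((nat \<Rightarrow> nat \<Rightarrow> real) \<Rightarrow> real)
      \<Rightarrow> (nat \<Rightarrow> nat \<Rightarrow> real) \<Rightarrow> real" where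
  "multi_deriv e P h = fold (\<lambda>r. entry_deriv (e r)) (sorted_list_of_set P) h"

text \<open>
  Expectations of nonnegative variables are taken as nonnegative integrals, so that bounds on them
  include finiteness.
\<close>

definition subgaussian :: "'a measure \<Rightarrow> real \<Rightarrow> ('a \<Rightarrow> real) \<Rightarrow> bool" where
  "subgaussian M s f \<longleftrightarrow>
     (\<forall>l. (\<integral>\<^sup>+w. ennreal (exp (l * f w)) \<partial>M) \<le> ennreal (exp (l\<^sup>2 * s\<^sup>2 / 2)))"

definition sym_on :: "nat \<Rightarrow> (nat \<Rightarrow> nat \<Rightarrow> real) \<Rightarrow> bool" where
  "sym_on n X \<longleftrightarrow> (\<forall>i\<in>{1..n}. \<forall>j\<in>{1..n}. X i j = X j i)"

definition admissible_data ::
    "real \<Rightarrow> real \<Rightarrow> nat \<Rightarrow> 'a measure \<Rightarrow> ('a \<Rightarrow> nat \<Rightarrow> real) \<Rightarrow> ('a \<Rightarrow> nat \<Rightarrow> nat \<Rightarrow> real) \<Rightarrow> bool" where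
  "admissible_data \<sigma> C n M u Z \<longleftrightarrow>
     (\<forall>i\<in>{1..n}. (\<lambda>w. u w i) \<in> borel_measurable M) \<and>
     (\<forall>i\<in>{1..n}. \<forall>j\<in>{1..n}. (\<lambda>w. Z w i j) \<in> borel_measurable M) \<and>
     (\<forall>w\<in>space M. sym_on n (Z w)) \<and>
     (\<integral>\<^sup>+w. ennreal (exp ((L2_set (u w) {1..n})\<^sup>2 / (\<sigma> * real n))) \<partial>M) \<le> ennreal C \<and>
     (\<forall>i\<in>{1..n}. (\<integral>\<^sup>+w. ennreal (exp (\<bar>u w i\<bar> / \<sigma>)) \<partial>M) \<le> ennreal C) \<and>
     (\<forall>i\<in>{1..n}. \<forall>j\<in>{1..n}. (\<integral>\<^sup>+w. ennreal (exp (\<bar>Z w i j\<bar> / \<sigma>)) \<partial>M) \<le> ennreal C)"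

definition upper_idx :: "nat \<Rightarrow> (nat \<times> nat) set" where
  "upper_idx n = {(i, j). 1 \<le> i \<and> i \<le> j \<and> j \<le> n}"

definition gen_sigma :: "'a measure \<Rightarrow> ('a \<Rightarrow> 'b) \<Rightarrow> 'b measure \<Rightarrow> 'a set set" where
  "gen_sigma M f N = sigma_sets (space M) {f -` S \<inter> space M | S. S \<in> sets N}"

text \<open>
  Independence of \<open>A\<close> and \<open>(u, Z)\<close> is stated through the generated sigma-algebras, since
  \<open>indep_var\<close> requires both random variables to have the same value type.
\<close>

definition indep_of_data ::
    "nat \<Rightarrow> 'a measure \<Rightarrow> ('a \<Rightarrow> nat \<Rightarrow> real) \<Rightarrow> ('a \<Rightarrow> nat \<Rightarrow> nat \<Rightarrow> real)
      \<Rightarrow> ('a \<Rightarrow> nat \<Rightarrow> nat \<Rightarrow> real) \<Rightarrow> bool" where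
  "indep_of_data n M u Z A \<longleftrightarrow>
     prob_space.indep_set M
       (gen_sigma M (\<lambda>w. \<lambda>(i, j)\<in>{1..n} \<times> {1..n}. A w i j)
          (PiM ({1..n} \<times> {1..n}) (\<lambda>_. borel)))
       (gen_sigma M (\<lambda>w. (\<lambda>i\<in>{1..n}. u w i, \<lambda>(i, j)\<in>{1..n} \<times> {1..n}. Z w i j))
          (PiM {1..n} (\<lambda>_. borel) \<Otimes>\<^sub>M PiM ({1..n} \<times> {1..n}) (\<lambda>_. borel)))"

definition rand_mats ::
    "real \<Rightarrow> nat \<Rightarrow> 'a measure \<Rightarrow> ('a \<Rightarrow> nat \<Rightarrow> real) \<Rightarrow> ('a \<Rightarrow> nat \<Rightarrow> nat \<Rightarrow> real)
      \<Rightarrow> ('a \<Rightarrow> nat \<Rightarrow> nat \<Rightarrow> real) set" where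
  "rand_mats \<sigma> n M u Z =
     {A. (\<forall>w\<in>space M. sym_on n (A w)) \<and>
         indep_of_data n M u Z A \<and>
         prob_space.indep_vars M (\<lambda>_. borel) (\<lambda>(i, j) w. A w i j) (upper_idx n) \<and>
         (\<forall>(i, j)\<in>upper_idx n.
            integrable M (\<lambda>w. A w i j) \<and> (\<integral>w. A w i j \<partial>M) = 0 \<and>
            (\<exists>s. 0 \<le> s \<and> s \<le> \<sigma> \<and> subgaussian M s (\<lambda>w. A w i j)))}"

definition entry_seqs :: "nat \<Rightarrow> (nat \<Rightarrow> nat \<times> nat) set" where
  "entry_seqs n = {e. \<forall>r\<ge>1. fst (e r) \<in> {1..n} \<and> snd (e r) \<in> {1..n} \<and> fst (e r) < snd (e r)}"

definition index_coll ::
    "real \<Rightarrow> nat \<Rightarrow> 'a measure \<Rightarrow> ('a \<Rightarrow> nat \<Rightarrow> real) \<Rightarrow> ('a \<Rightarrow> nat \<Rightarrow> nat \<Rightarrow> real) \<Rightarrow> nat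
      \<Rightarrow> (nat set \<times> (nat \<Rightarrow> nat \<times> nat) \<times> ('a \<Rightarrow> nat \<Rightarrow> nat \<Rightarrow> real) \<times> nat) set" where
  "index_coll \<sigma> n M u Z m =
     {P. P \<subseteq> {1..} \<and> finite P \<and> card P = m} \<times> entry_seqs n \<times> rand_mats \<sigma> n M u Z \<times> {1..n}"

definition Lp_norm :: "'a measure \<Rightarrow> real \<Rightarrow> ('a \<Rightarrow> real) \<Rightarrow> ennreal" where
  "Lp_norm M p f =
     (let I = (\<integral>\<^sup>+w. ennreal (\<bar>f w\<bar> powr p) \<partial>M)
      in if I = \<infinity> then \<infinity> else ennreal (enn2real I powr (1 / p)))"

end

(*
  Write D for sqrt n times the derivative in one matrix entry.  The claim says that for every m
  the functions D^m u^[k]_i and D^m (A^ u^[k])_i have moments bounded uniformly in n, in the indices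
  and in the law of A.  Families of functions with this property for all m are closed under
  products, bounded linear combinations and composition with smooth functions whose derivatives
  are bounded, so by induction on k everything reduces to sums Y = n^(-1/2) sum_j x_{ij} g_j with g_j
  from such a family; D Y is again such a sum plus a single g_j.

  For the moments of Y, expand Y^(2q) into terms indexed by lists of 2q indices.  If an index j occurs
  exactly once in a list, then, since x_{ij} is centred and independent of the rest, the product of
  the g's may be replaced by its difference under x_{ij} := 0, which is n^(-1/2) times an average of
  x_{ij} D(...).  So a term with s such indices is O(n^(-s/2)).  A list with d distinct indices has
  s >= 2d - 2q, and the sum of n^(-d) over all lists is at most (2q)!, hence E Y^(2q) = O(1).
*)
theory Submission
  imports Defs
begin

text \<open>The obstacle is that the g_j depend on the entries x_{ij} they are multiplied with. The
  expansion trades this dependence for derivatives: a moment of order 2q consumes up to 2q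
  derivatives of the product of the g's. Hence no fixed order of differentiation is stable under the
  induction on k, and bounds for all orders have to be carried along together. Setting an entry to 0
  and interpolating change the law of the matrix, so bounds for one fixed A would not close up. They
  are proved uniformly over a class of random points described only by moment bounds and a centring
  identity; both survive multiplying one entry by t in [0,1]. The initial vector and Z enter as
  further coordinates that are never differentiated. Z may depend on u^0, since its part Z/n of the
  matrix acts as an average and requires no cancellation. Even integer moments are used because they
  are polynomial; a general exponent p is reached at the end through |x|^p <= 1 + x^(2N) for 2N >=
  p.\<close>

definition coord_deriv :: "'i \<Rightarrow> (('i \<Rightarrow> real) \<Rightarrow> real) \<Rightarrow> ('i \<Rightarrow> real) \<Rightarrow> real" where
  "coord_deriv e h x = deriv (\<lambda>t. h (x(e := t))) (x e)"

lemma continuous_on_fun_upd: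
  fixes f :: "'b::topological_space \<Rightarrow> 'i \<Rightarrow> 'c::topological_space"
  assumes "continuous_on S f" "continuous_on S g"
  shows "continuous_on S (\<lambda>z. (f z)(e := g z))"
proof (rule continuous_on_coordinatewise_then_product)
  fix i
  show "continuous_on S (\<lambda>z. ((f z)(e := g z)) i)"
    using assms by (cases "i = e") (auto intro: continuous_on_product_then_coordinatewise)
qed

section \<open>Even powers of products and of weighted sums\<close>

text \<open>AM-GM with the factor 1/2 dropped. It takes the place of Cauchy-Schwarz for even
  moments: a product costs a doubling of the order.\<close>

lemma even_power_mult_le:
  fixes x y :: real
  shows "(x * y) ^ (2 * N) \<le> x ^ (2 * (2 * N)) + y ^ (2 * (2 * N))"
proof -
  have "0 \<le> (x ^ (2 * N) - y ^ (2 * N))\<^sup>2" by simp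
  then have "2 * (x ^ (2 * N) * y ^ (2 * N)) \<le> x ^ (2 * (2 * N)) + y ^ (2 * (2 * N))"
    by (simp add: power2_diff power_mult[symmetric] ac_simps)
  moreover have "0 \<le> x ^ (2 * (2 * N)) + y ^ (2 * (2 * N))"
    by (intro add_nonneg_nonneg) (auto simp: power_mult)
  ultimately show ?thesis by (simp add: power_mult_distrib)
qed

text \<open>Jensen for t^(2N) with weights |c j| / s, where s is the sum of the |c j|; the signs of
  the c j move into the arguments, where the even power removes them, and s is then enlarged to K.
  The summand 1 on the right pays for N = 0, where the left side is 1 even if J is empty.\<close>

lemma sum_power_even_le:
  fixes c y :: "'b \<Rightarrow> real"
  assumes J: "finite J" and K: "(\<Sum>j\<in>J. \<bar>c j\<bar>) \<le> K" "K > 0"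
  shows "(\<Sum>j\<in>J. c j * y j) ^ (2 * N) \<le> K ^ (2 * N) * (1 + (\<Sum>j\<in>J. \<bar>c j\<bar> / K * y j ^ (2 * N)))"
proof -
  define s where "s = (\<Sum>j\<in>J. \<bar>c j\<bar>)"
  have s0: "s \<ge> 0" by (simp add: s_def sum_nonneg)
  have nn: "(\<Sum>j\<in>J. \<bar>c j\<bar> / K * y j ^ (2 * N)) \<ge> 0"
    using K by (intro sum_nonneg mult_nonneg_nonneg) (auto simp: power_mult)
  show ?thesis
  proof (cases "s = 0 \<or> N = 0")
    case True
    then show ?thesis
    proof
      assume "s = 0"
      then have "c j = 0" if "j \<in> J" for j
        using J that by (simp add: s_def sum_nonneg_eq_0_iff)
      then have "(\<Sum>j\<in>J. c j * y j) = 0" by simp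
      then show ?thesis using nn K(2) by (cases "N = 0") (auto simp: zero_power)
    next
      assume "N = 0" then show ?thesis using nn by simp
    qed
  next
    case False
    then have s: "s > 0" and N: "N > 0" using s0 by auto
    have ne: "J \<noteq> {}" using s by (auto simp: s_def)
    have cj: "\<bar>c j\<bar> * sgn (c j) = c j" for j by (simp add: abs_mult_sgn)
    have "(\<Sum>j\<in>J. c j * y j) = (\<Sum>j\<in>J. (\<bar>c j\<bar> / s) *\<^sub>R (s * (sgn (c j) * y j)))"
      by (rule sum.cong) (use s cj in \<open>auto simp: mult.assoc[symmetric]\<close>)
    then have "(\<Sum>j\<in>J. c j * y j) ^ (2 * N)
        \<le> (\<Sum>j\<in>J. \<bar>c j\<bar> / s * (s * (sgn (c j) * y j)) ^ (2 * N))"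
      using convex_on_sum[OF J ne convex_power_even[of "2*N"], of "\<lambda>j. \<bar>c j\<bar> / s" "\<lambda>j. s * (sgn (c j) * y j)"]
      using s by (simp add: sum_divide_distrib[symmetric] s_def[symmetric])
    also have "\<dots> = (\<Sum>j\<in>J. s ^ (2*N - 1) * (\<bar>c j\<bar> * y j ^ (2 * N)))"
    proof (rule sum.cong, rule refl)
      fix j
      have "s ^ (2*N) = s * s ^ (2*N - 1)" using N by (metis power_eq_if mult_is_0 numeral_eq_one_iff neq0_conv semiring_norm(85) zero_neq_numeral)
      moreover have "\<bar>c j\<bar> * (sgn (c j)) ^ (2 * N) = \<bar>c j\<bar>"
        by (auto simp: sgn_if power_mult)
      then have "\<bar>c j\<bar> / s * (s * (sgn (c j) * y j)) ^ (2 * N) = \<bar>c j\<bar> / s * (s ^ (2 * N) * y j ^ (2 * N))"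
        by (simp only: power_mult_distrib) (metis mult.commute mult.left_commute times_divide_eq_left)
      ultimately show "\<bar>c j\<bar> / s * (s * (sgn (c j) * y j)) ^ (2 * N) = s ^ (2*N - 1) * (\<bar>c j\<bar> * y j ^ (2 * N))"
        using s by simp
    qed
    also have "\<dots> \<le> (\<Sum>j\<in>J. K ^ (2*N - 1) * (\<bar>c j\<bar> * y j ^ (2 * N)))"
      by (intro sum_mono mult_right_mono power_mono) (use K s in \<open>auto simp: s_def power_mult\<close>)
    also have "\<dots> = K ^ (2 * N) * (\<Sum>j\<in>J. \<bar>c j\<bar> / K * y j ^ (2 * N))"
    proof -
      have "K ^ (2*N) = K * K ^ (2*N - 1)" using N by (metis power_eq_if mult_is_0 numeral_eq_one_iff neq0_conv semiring_norm(85) zero_neq_numeral)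
      then show ?thesis using K(2) by (simp add: sum_distrib_left field_simps)
    qed
    also have "\<dots> \<le> K ^ (2 * N) * (1 + (\<Sum>j\<in>J. \<bar>c j\<bar> / K * y j ^ (2 * N)))"
      using K(2) by (intro mult_left_mono) auto
    finally show ?thesis .
  qed
qed

section \<open>Families of functions with bounds uniform in the dimension\<close>

type_synonym 'i fam = "nat \<Rightarrow> (('i \<Rightarrow> real) \<Rightarrow> real) set"

definition prod_fam :: "'i fam \<Rightarrow> 'i fam \<Rightarrow> 'i fam" where
  "prod_fam G H n = {\<lambda>x. g x * h x | g h. g \<in> G n \<and> h \<in> H n}"

text \<open>The number of summands is free; only the l^1 norm of the coefficients is limited. So
  averages of n members belong to \<open>lin_comb 1\<close>, and convexity bounds their moments
  uniformly in n.\<close>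

definition lin_comb :: "real \<Rightarrow> 'i fam \<Rightarrow> 'i fam" where
  "lin_comb K H n = {\<lambda>x. \<Sum>j\<in>J. c j * h j x | (J :: nat set) c h.
     finite J \<and> (\<Sum>j\<in>J. \<bar>c j\<bar>) \<le> K \<and> (\<forall>j\<in>J. h j \<in> H n)}"

lemma prod_famI: "g \<in> G n \<Longrightarrow> h \<in> H n \<Longrightarrow> (\<lambda>x. g x * h x) \<in> prod_fam G H n"
  unfolding prod_fam_def by blast

lemma lin_comb_add:
  assumes "g \<in> H n" "h \<in> H n"
  shows "(\<lambda>x. g x + h x) \<in> lin_comb 2 H n"
  unfolding lin_comb_def
  by (rule CollectI, rule exI[of _ "{0,1}"], rule exI[of _ "\<lambda>_. 1"],
      rule exI[of _ "\<lambda>j. if j = 0 then g else h"]) (use assms in auto)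

lemma lin_comb_sum:
  assumes "\<And>j. j < d \<Longrightarrow> h j \<in> H n" "real d \<le> K"
  shows "(\<lambda>x. \<Sum>j<d. h j x) \<in> lin_comb K H n"
  unfolding lin_comb_def
  by (rule CollectI, rule exI[of _ "{..<d}"], rule exI[of _ "\<lambda>_. 1"], rule exI[of _ h]) (use assms in auto)

text \<open>
  The randomness enters only through a class of random points that is closed under shrinking one
  coordinate towards \<open>0\<close>; the set \<open>Ed\<close> holds the coordinates of the random matrix.  The last
  axiom is the only form in which independence and centring of the entries are used: \<open>\<phi>\<close> does
  not depend on the coordinate \<open>e\<close>.
\<close>

locale moment_class =
  fixes M :: "nat \<Rightarrow> 'a measure" and Ed :: "'i::countable set"
    and cls :: "nat \<Rightarrow> ('a \<Rightarrow> 'i \<Rightarrow> real) set"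
  assumes prob: "n \<ge> 1 \<Longrightarrow> prob_space (M n)"
    and meas: "n \<ge> 1 \<Longrightarrow> a \<in> cls n \<Longrightarrow> a \<in> borel_measurable (M n)"
    and coord_moments:
      "\<exists>c. \<forall>n\<ge>1. \<forall>a\<in>cls n. \<forall>e. (\<integral>\<^sup>+w. ennreal ((a w e) ^ (2 * N)) \<partial>M n) \<le> ennreal c"
    and scale: "n \<ge> 1 \<Longrightarrow> a \<in> cls n \<Longrightarrow> 0 \<le> t \<Longrightarrow> t \<le> 1 \<Longrightarrow>
      (\<lambda>w. (a w)(e := t * a w e)) \<in> cls n"
    and centred: "n \<ge> 1 \<Longrightarrow> a \<in> cls n \<Longrightarrow> e \<in> Ed \<Longrightarrow> continuous_on UNIV \<phi> \<Longrightarrow>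
      (\<And>x t. \<phi> (x(e := t)) = \<phi> x) \<Longrightarrow> integrable (M n) (\<lambda>w. \<phi> (a w)) \<Longrightarrow>
      integrable (M n) (\<lambda>w. a w e * \<phi> (a w)) \<Longrightarrow> (\<integral>w. a w e * \<phi> (a w) \<partial>M n) = 0"
begin

text \<open>Continuity is included because it makes \<open>h (a w)\<close> measurable for every
  random point \<open>a\<close> of the class.\<close>

definition moment_bounded :: "'i fam \<Rightarrow> bool" where
  "moment_bounded H \<longleftrightarrow> (\<forall>n\<ge>1. \<forall>h\<in>H n. continuous_on UNIV h) \<and>
     (\<forall>N. \<exists>\<Gamma>. \<forall>n\<ge>1. \<forall>h\<in>H n. \<forall>a\<in>cls n. (\<integral>\<^sup>+w. ennreal (h (a w) ^ (2 * N)) \<partial>M n) \<le> ennreal \<Gamma>)"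

definition coord_diff :: "'i fam \<Rightarrow> bool" where
  "coord_diff H \<longleftrightarrow> (\<forall>n\<ge>1. \<forall>h\<in>H n. \<forall>e\<in>Ed. \<forall>x. (\<lambda>t. h (x(e := t))) differentiable (at (x e)))"

text \<open>The normalised derivative D of the overview: bounded moments after m applications mean
  derivatives of order m of size n^(-m/2).\<close>

definition deriv_fam :: "'i fam \<Rightarrow> 'i fam" where
  "deriv_fam H n = {\<lambda>x. sqrt (real n) * coord_deriv e h x | e h. e \<in> Ed \<and> h \<in> H n}"

text \<open>Differentiability is demanded before \<open>deriv_fam\<close> is formed, so that
  \<open>deriv\<close> denotes a genuine derivative in every family whose moments are
  bounded.\<close>

primrec tame :: "nat \<Rightarrow> 'i fam \<Rightarrow> bool" where
  "tame 0 H = moment_bounded H"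
| "tame (Suc m) H = (moment_bounded H \<and> coord_diff H \<and> tame m (deriv_fam H))"

lemma deriv_famI: "e \<in> Ed \<Longrightarrow> h \<in> H n \<Longrightarrow> (\<lambda>x. sqrt (real n) * coord_deriv e h x) \<in> deriv_fam H n"
  unfolding deriv_fam_def by blast

lemma measurable_compose_cls:
  assumes "n \<ge> 1" "a \<in> cls n" "continuous_on UNIV h"
  shows "(\<lambda>w. h (a w) :: real) \<in> borel_measurable (M n)"
  using measurable_compose[OF meas[OF assms(1,2)] borel_measurable_continuous_onI[OF assms(3)]] .

lemma moment_boundedE:
  assumes "moment_bounded H"
  obtains \<Gamma> where "\<Gamma> \<ge> 0" "\<And>n h a. n \<ge> 1 \<Longrightarrow> h \<in> H n \<Longrightarrow> a \<in> cls n \<Longrightarrow>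
    (\<integral>\<^sup>+w. ennreal (h (a w) ^ (2 * N)) \<partial>M n) \<le> ennreal \<Gamma>"
proof -
  obtain \<Gamma> where \<Gamma>: "\<forall>n\<ge>1. \<forall>h\<in>H n. \<forall>a\<in>cls n. (\<integral>\<^sup>+w. ennreal (h (a w) ^ (2 * N)) \<partial>M n) \<le> ennreal \<Gamma>"
    using assms unfolding moment_bounded_def by blast
  show ?thesis
  proof (rule that[of "max 0 \<Gamma>"])
    fix n h a assume "n \<ge> 1" "h \<in> H n" "a \<in> cls n"
    then have "(\<integral>\<^sup>+w. ennreal (h (a w) ^ (2 * N)) \<partial>M n) \<le> ennreal \<Gamma>" using \<Gamma> by blast
    also have "\<dots> \<le> ennreal (max 0 \<Gamma>)" by (intro ennreal_leI) simp
    finally show "(\<integral>\<^sup>+w. ennreal (h (a w) ^ (2 * N)) \<partial>M n) \<le> ennreal (max 0 \<Gamma>)" .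
  qed simp
qed

lemma moment_bounded_cont: "moment_bounded H \<Longrightarrow> n \<ge> 1 \<Longrightarrow> h \<in> H n \<Longrightarrow> continuous_on UNIV h"
  by (simp add: moment_bounded_def)

lemma moment_bounded_mono:
  assumes "moment_bounded H" "\<And>n. n \<ge> 1 \<Longrightarrow> G n \<subseteq> H n"
  shows "moment_bounded G"
proof -
  have "\<exists>\<Gamma>. \<forall>n\<ge>1. \<forall>h\<in>G n. \<forall>a\<in>cls n. (\<integral>\<^sup>+w. ennreal (h (a w) ^ (2 * N)) \<partial>M n) \<le> ennreal \<Gamma>" for N
  proof -
    obtain \<Gamma> where "\<Gamma> \<ge> 0" "\<And>n h a. n \<ge> 1 \<Longrightarrow> h \<in> H n \<Longrightarrow> a \<in> cls n \<Longrightarrow>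
      (\<integral>\<^sup>+w. ennreal (h (a w) ^ (2 * N)) \<partial>M n) \<le> ennreal \<Gamma>"
      using moment_boundedE[OF assms(1)] by metis
    then show ?thesis using assms(2) by blast
  qed
  then show ?thesis using assms unfolding moment_bounded_def by blast
qed

lemma tame_mono:
  "tame m H \<Longrightarrow> (\<And>n. n \<ge> 1 \<Longrightarrow> G n \<subseteq> H n) \<Longrightarrow> tame m G"
proof (induction m arbitrary: G H)
  case 0 then show ?case using moment_bounded_mono by auto
next
  case (Suc m)
  have "coord_diff G" using Suc.prems unfolding coord_diff_def by (metis subsetD tame.simps(2) coord_diff_def)
  moreover have "tame m (deriv_fam G)"
  proof (rule Suc.IH)
    show "tame m (deriv_fam H)" using Suc.prems by simp
    show "deriv_fam G n \<subseteq> deriv_fam H n" if "n \<ge> 1" for n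
      using Suc.prems(2)[OF that] unfolding deriv_fam_def by blast
  qed
  ultimately show ?case using Suc.prems moment_bounded_mono by auto
qed

lemma tame_imp_moment_bounded: "tame m H \<Longrightarrow> moment_bounded H"
  by (cases m) auto

lemma tame_Suc_imp: "tame (Suc m) H \<Longrightarrow> tame m H"
  by (induction m arbitrary: H) auto

lemma coord_diffD:
  assumes "coord_diff H" "n \<ge> 1" "h \<in> H n" "e \<in> Ed"
  shows "((\<lambda>t. h (x(e := t))) has_real_derivative coord_deriv e h (x(e := s))) (at s)"
proof -
  have "(\<lambda>t. h ((x(e := s))(e := t))) differentiable (at ((x(e := s)) e))"
    using assms unfolding coord_diff_def by blast
  then have "(\<lambda>t. h (x(e := t))) differentiable (at s)" by simp
  then show ?thesis
    unfolding coord_deriv_def by (simp add: DERIV_deriv_iff_real_differentiable)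
qed

lemma coord_diffI:
  assumes "\<And>n h e x. n \<ge> 1 \<Longrightarrow> h \<in> H n \<Longrightarrow> e \<in> Ed \<Longrightarrow>
    \<exists>D. ((\<lambda>t. h (x(e := t))) has_real_derivative D) (at (x e))"
  shows "coord_diff H"
  using assms unfolding coord_diff_def by (metis real_differentiable_def)

lemma coord_deriv_eqI:
  "((\<lambda>t. h (x(e := t))) has_real_derivative D) (at (x e)) \<Longrightarrow> coord_deriv e h x = D"
  unfolding coord_deriv_def by (rule DERIV_imp_deriv)

lemma moment_bounded_Un:
  assumes "moment_bounded G" "moment_bounded H"
  shows "moment_bounded (\<lambda>n. G n \<union> H n)"
proof -
  have "\<exists>\<Gamma>. \<forall>n\<ge>1. \<forall>h\<in>G n \<union> H n. \<forall>a\<in>cls n. (\<integral>\<^sup>+w. ennreal (h (a w) ^ (2 * N)) \<partial>M n) \<le> ennreal \<Gamma>" for N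
  proof -
    obtain g where g: "g \<ge> 0" "\<And>n h a. n \<ge> 1 \<Longrightarrow> h \<in> G n \<Longrightarrow> a \<in> cls n \<Longrightarrow>
      (\<integral>\<^sup>+w. ennreal (h (a w) ^ (2 * N)) \<partial>M n) \<le> ennreal g"
      using moment_boundedE[OF assms(1)] by metis
    obtain k where k: "k \<ge> 0" "\<And>n h a. n \<ge> 1 \<Longrightarrow> h \<in> H n \<Longrightarrow> a \<in> cls n \<Longrightarrow>
      (\<integral>\<^sup>+w. ennreal (h (a w) ^ (2 * N)) \<partial>M n) \<le> ennreal k"
      using moment_boundedE[OF assms(2)] by metis
    have "ennreal g \<le> ennreal (max g k)" "ennreal k \<le> ennreal (max g k)"
      by (auto intro!: ennreal_leI)
    then show ?thesis using g(2) k(2) by (intro exI[of _ "max g k"]) (blast intro: order_trans)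
  qed
  then show ?thesis using assms unfolding moment_bounded_def by blast
qed

lemma tame_Un: "tame m G \<Longrightarrow> tame m H \<Longrightarrow> tame m (\<lambda>n. G n \<union> H n)"
proof (induction m arbitrary: G H)
  case 0 then show ?case using moment_bounded_Un by auto
next
  case (Suc m)
  have "tame m (\<lambda>n. deriv_fam G n \<union> deriv_fam H n)" using Suc by auto
  moreover have "deriv_fam (\<lambda>n. G n \<union> H n) = (\<lambda>n. deriv_fam G n \<union> deriv_fam H n)"
    by (auto simp: deriv_fam_def fun_eq_iff)
  moreover have "coord_diff (\<lambda>n. G n \<union> H n)"
    using Suc.prems by (auto simp: coord_diff_def)
  ultimately show ?case using Suc.prems moment_bounded_Un by auto
qed

lemma tame_const: "tame m (\<lambda>n. {\<lambda>x. c})"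
proof -
  have "moment_bounded (\<lambda>n. {\<lambda>x. c})" for c
  proof -
    have "(\<integral>\<^sup>+w. ennreal (c ^ (2 * N)) \<partial>M n) \<le> ennreal (c ^ (2 * N))" if "n \<ge> 1" for n N
      using prob_space.emeasure_space_1[OF prob[OF that]] by simp
    then show ?thesis unfolding moment_bounded_def by auto
  qed
  moreover have "coord_diff (\<lambda>n. {\<lambda>x. c})" for c
    by (auto simp: coord_diff_def)
  moreover have "deriv_fam (\<lambda>n. {\<lambda>x. c}) n \<subseteq> {\<lambda>x. 0}" for c n
    by (auto simp: deriv_fam_def coord_deriv_def)
  ultimately show ?thesis
  proof (induction m arbitrary: c)
    case (Suc m)
    have "tame m (deriv_fam (\<lambda>n. {\<lambda>x. c}))"
      by (rule tame_mono[OF Suc.IH[of 0]]) (use Suc.prems in auto)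
    then show ?case using Suc.prems by auto
  qed auto
qed

lemma tame_UN_lt:
  "(\<And>j. j < d \<Longrightarrow> tame m (H j)) \<Longrightarrow> tame m (\<lambda>n. \<Union>j<(d::nat). H j n)"
proof (induction d)
  case 0 then show ?case by (auto intro!: tame_mono[OF tame_const[of m 0]])
next
  case (Suc d)
  have "tame m (\<lambda>n. H d n \<union> (\<Union>j<d. H j n))" using Suc by (intro tame_Un) auto
  then show ?case by (rule tame_mono) (auto simp: less_Suc_eq)
qed

lemma moment_bounded_coords: "moment_bounded (\<lambda>n. {\<lambda>x. x e | e. True})"
  using coord_moments unfolding moment_bounded_def
  by (fastforce intro: continuous_on_product_coordinates)

text \<open>Coordinates outside \<open>Ed\<close> are random, with moments from
  \<open>coord_moments\<close>, but constant for every derivative in question, so all their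
  derivative families reduce to 0.\<close>

lemma tame_fixed_coords: "tame m (\<lambda>n. {\<lambda>x. x e | e. e \<notin> Ed})"
proof (cases m)
  case 0
  show ?thesis unfolding 0 by (auto intro: moment_bounded_mono[OF moment_bounded_coords])
next
  case (Suc k)
  have up: "(x(e' := t)) e = x e" if "e \<notin> Ed" "e' \<in> Ed" for x :: "'i \<Rightarrow> real" and e e' t
    using that by auto
  have "tame k (deriv_fam (\<lambda>n. {\<lambda>x. x e | e. e \<notin> Ed}))"
    by (rule tame_mono[OF tame_const[of k 0]]) (auto simp: deriv_fam_def coord_deriv_def up simp del: fun_upd_apply)
  moreover have "coord_diff (\<lambda>n. {\<lambda>x. x e | e. e \<notin> Ed})"
    by (auto simp: coord_diff_def up simp del: fun_upd_apply)
  ultimately show ?thesis unfolding Suc by (auto intro: moment_bounded_mono[OF moment_bounded_coords])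
qed

section \<open>Closure under products and linear combinations\<close>

lemma nn_integral_add_le:
  assumes "n \<ge> 1" "f \<in> borel_measurable (M n)" "g \<in> borel_measurable (M n)"
    "\<And>w. 0 \<le> f w" "\<And>w. 0 \<le> g w"
    "\<And>w. h w \<le> f w + g w"
  shows "(\<integral>\<^sup>+w. ennreal (h w) \<partial>M n) \<le> (\<integral>\<^sup>+w. ennreal (f w) \<partial>M n) + (\<integral>\<^sup>+w. ennreal (g w) \<partial>M n)"
proof -
  have "(\<integral>\<^sup>+w. ennreal (h w) \<partial>M n) \<le> (\<integral>\<^sup>+w. ennreal (f w) + ennreal (g w) \<partial>M n)"
    using assms(4-6) by (intro nn_integral_mono) (simp flip: ennreal_plus add: ennreal_leI)
  also have "\<dots> = (\<integral>\<^sup>+w. ennreal (f w) \<partial>M n) + (\<integral>\<^sup>+w. ennreal (g w) \<partial>M n)"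
    using assms by (intro nn_integral_add) auto
  finally show ?thesis .
qed

lemma moment_bounded_prod:
  assumes G: "moment_bounded G" and H: "moment_bounded H"
  shows "moment_bounded (prod_fam G H)"
  unfolding moment_bounded_def
proof (intro conjI allI impI ballI)
  fix n :: nat and f assume "n \<ge> 1" "f \<in> prod_fam G H n"
  then show "continuous_on UNIV f"
    using moment_bounded_cont[OF G] moment_bounded_cont[OF H]
    by (auto simp: prod_fam_def intro!: continuous_intros)
next
  fix N
  obtain g where g: "g \<ge> 0" "\<And>n h a. n \<ge> 1 \<Longrightarrow> h \<in> G n \<Longrightarrow> a \<in> cls n \<Longrightarrow>
      (\<integral>\<^sup>+w. ennreal (h (a w) ^ (2 * (2 * N))) \<partial>M n) \<le> ennreal g"
    using moment_boundedE[OF G] by metis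
  obtain k where k: "k \<ge> 0" "\<And>n h a. n \<ge> 1 \<Longrightarrow> h \<in> H n \<Longrightarrow> a \<in> cls n \<Longrightarrow>
      (\<integral>\<^sup>+w. ennreal (h (a w) ^ (2 * (2 * N))) \<partial>M n) \<le> ennreal k"
    using moment_boundedE[OF H] by metis
  show "\<exists>\<Gamma>. \<forall>n\<ge>1. \<forall>h\<in>prod_fam G H n. \<forall>a\<in>cls n. (\<integral>\<^sup>+w. ennreal (h (a w) ^ (2 * N)) \<partial>M n) \<le> ennreal \<Gamma>"
  proof (intro exI[of _ "g + k"] allI impI ballI)
    fix n :: nat and f a assume n: "n \<ge> 1" and "f \<in> prod_fam G H n" and a: "a \<in> cls n"
    then obtain p q where f: "f = (\<lambda>x. p x * q x)" and p: "p \<in> G n" and q: "q \<in> H n"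
      by (auto simp: prod_fam_def)
    have "(\<integral>\<^sup>+w. ennreal (f (a w) ^ (2 * N)) \<partial>M n) \<le>
       (\<integral>\<^sup>+w. ennreal (p (a w) ^ (2 * (2 * N))) \<partial>M n) + (\<integral>\<^sup>+w. ennreal (q (a w) ^ (2 * (2 * N))) \<partial>M n)"
      unfolding f by (rule nn_integral_add_le[OF n])
         (use even_power_mult_le measurable_compose_cls[OF n a] moment_bounded_cont[OF G n p] moment_bounded_cont[OF H n q] in
          \<open>auto simp: power_mult\<close>)
    also have "\<dots> \<le> ennreal g + ennreal k" using g(2)[OF n p a] k(2)[OF n q a] by (rule add_mono)
    finally show "(\<integral>\<^sup>+w. ennreal (f (a w) ^ (2 * N)) \<partial>M n) \<le> ennreal (g + k)" using g k by simp
  qed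
qed

text \<open>Stated for any \<open>f\<close> below the power of the combination, so that it serves
  both for linear combinations and for functions of linear growth.\<close>

lemma nn_integral_lin_comb_le:
  fixes J :: "nat set"
  assumes n: "n \<ge> 1" and J: "finite J" and K: "(\<Sum>j\<in>J. \<bar>c j\<bar>) \<le> K" "K > 0"
    and me: "\<And>j. j \<in> J \<Longrightarrow> h j \<in> borel_measurable (M n)" and \<Gamma>: "\<Gamma> \<ge> 0"
    and b: "\<And>j. j \<in> J \<Longrightarrow> (\<integral>\<^sup>+w. ennreal (h j w ^ (2 * N)) \<partial>M n) \<le> ennreal \<Gamma>"
    and le: "\<And>w. f w \<le> (\<Sum>j\<in>J. c j * h j w) ^ (2 * N)"
  shows "(\<integral>\<^sup>+w. ennreal (f w) \<partial>M n) \<le> ennreal (K ^ (2 * N) * (1 + \<Gamma>))"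
proof -
  interpret P: prob_space "M n" using prob[OF n] .
  have nn: "0 \<le> \<bar>c j\<bar> / K * h j w ^ (2 * N)" for j w using K(2) by (auto simp: power_mult)
  have "(\<integral>\<^sup>+w. ennreal (f w) \<partial>M n) \<le> (\<integral>\<^sup>+w. ennreal (K ^ (2 * N)) * (1 + (\<Sum>j\<in>J. ennreal (\<bar>c j\<bar> / K) * ennreal (h j w ^ (2 * N)))) \<partial>M n)"
  proof (rule nn_integral_mono)
    fix w
    have "ennreal (f w) \<le> ennreal (K ^ (2 * N) * (1 + (\<Sum>j\<in>J. \<bar>c j\<bar> / K * h j w ^ (2 * N))))"
      using order_trans[OF le sum_power_even_le[OF J K]] by (rule ennreal_leI)
    also have "\<dots> = ennreal (K ^ (2 * N)) * (1 + (\<Sum>j\<in>J. ennreal (\<bar>c j\<bar> / K * h j w ^ (2 * N))))"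
      using K(2) nn by (subst sum_ennreal) (auto simp: ennreal_mult sum_nonneg simp flip: ennreal_plus ennreal_1)
    also have "\<dots> = ennreal (K ^ (2 * N)) * (1 + (\<Sum>j\<in>J. ennreal (\<bar>c j\<bar> / K) * ennreal (h j w ^ (2 * N))))"
    proof -
      have "ennreal (\<bar>c j\<bar> / K * h j w ^ (2 * N)) = ennreal (\<bar>c j\<bar> / K) * ennreal (h j w ^ (2 * N))" for j
        using K(2) by (intro ennreal_mult) (auto simp: power_mult)
      then show ?thesis by presburger
    qed
    finally show "ennreal (f w) \<le> \<dots>" .
  qed
  also have "\<dots> = ennreal (K ^ (2 * N)) * (1 + (\<Sum>j\<in>J. ennreal (\<bar>c j\<bar> / K) * (\<integral>\<^sup>+w. ennreal (h j w ^ (2 * N)) \<partial>M n)))"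
    using me by (simp add: nn_integral_cmult nn_integral_add nn_integral_sum P.emeasure_space_1)
  also have "\<dots> \<le> ennreal (K ^ (2 * N)) * (1 + (\<Sum>j\<in>J. ennreal (\<bar>c j\<bar> / K) * ennreal \<Gamma>))"
    using b by (intro mult_left_mono add_mono sum_mono) auto
  also have "\<dots> = ennreal (K ^ (2 * N) * (1 + (\<Sum>j\<in>J. \<bar>c j\<bar> / K * \<Gamma>)))"
  proof -
    have "(\<Sum>j\<in>J. ennreal (\<bar>c j\<bar> / K) * ennreal \<Gamma>) = (\<Sum>j\<in>J. ennreal (\<bar>c j\<bar> / K * \<Gamma>))"
      using K(2) \<Gamma> by (intro sum.cong refl ennreal_mult[symmetric]) auto
    also have "\<dots> = ennreal (\<Sum>j\<in>J. \<bar>c j\<bar> / K * \<Gamma>)" using K(2) \<Gamma> by (intro sum_ennreal) auto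
    finally show ?thesis using K(2) \<Gamma> by (simp add: ennreal_mult sum_nonneg flip: ennreal_plus ennreal_1)
  qed
  also have "\<dots> \<le> ennreal (K ^ (2 * N) * (1 + \<Gamma>))"
  proof (intro ennreal_leI mult_left_mono add_left_mono)
    have "(\<Sum>j\<in>J. \<bar>c j\<bar> / K * \<Gamma>) = (\<Sum>j\<in>J. \<bar>c j\<bar>) / K * \<Gamma>"
      by (simp add: sum_divide_distrib sum_distrib_right)
    also have "\<dots> \<le> 1 * \<Gamma>" using K \<Gamma> by (intro mult_right_mono) auto
    finally show "(\<Sum>j\<in>J. \<bar>c j\<bar> / K * \<Gamma>) \<le> \<Gamma>" by simp
  qed (use K in auto)
  finally show ?thesis .
qed

lemma moment_bounded_lin_comb:
  assumes H: "moment_bounded H" and K: "K > 0"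
  shows "moment_bounded (lin_comb K H)"
  unfolding moment_bounded_def
proof (intro conjI allI impI ballI)
  fix n :: nat and f assume "n \<ge> 1" "f \<in> lin_comb K H n"
  then show "continuous_on UNIV f"
    using moment_bounded_cont[OF H]
    by (auto simp: lin_comb_def intro!: continuous_intros)
next
  fix N
  obtain k where k: "k \<ge> 0" "\<And>n h a. n \<ge> 1 \<Longrightarrow> h \<in> H n \<Longrightarrow> a \<in> cls n \<Longrightarrow>
      (\<integral>\<^sup>+w. ennreal (h (a w) ^ (2 * N)) \<partial>M n) \<le> ennreal k"
    using moment_boundedE[OF H] by metis
  show "\<exists>\<Gamma>. \<forall>n\<ge>1. \<forall>h\<in>lin_comb K H n. \<forall>a\<in>cls n. (\<integral>\<^sup>+w. ennreal (h (a w) ^ (2 * N)) \<partial>M n) \<le> ennreal \<Gamma>"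
  proof (intro exI[of _ "K ^ (2 * N) * (1 + k)"] allI impI ballI)
    fix n :: nat and f a assume n: "n \<ge> 1" and "f \<in> lin_comb K H n" and a: "a \<in> cls n"
    then obtain J :: "nat set" and c h where f: "f = (\<lambda>x. \<Sum>j\<in>J. c j * h j x)" and J: "finite J"
      and c: "(\<Sum>j\<in>J. \<bar>c j\<bar>) \<le> K" and h: "\<And>j. j \<in> J \<Longrightarrow> h j \<in> H n"
      unfolding lin_comb_def by blast
    show "(\<integral>\<^sup>+w. ennreal (f (a w) ^ (2 * N)) \<partial>M n) \<le> ennreal (K ^ (2 * N) * (1 + k))"
      by (rule nn_integral_lin_comb_le[OF n J c K, where h = "\<lambda>j w. h j (a w)"])
        (use h k(2)[OF n] a k(1) measurable_compose_cls[OF n a] moment_bounded_cont[OF H n] in \<open>auto simp: f\<close>)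
  qed
qed

lemma lin_comb_deriv:
  fixes J :: "nat set"
  assumes "coord_diff H" "n \<ge> 1" "\<And>j. j \<in> J \<Longrightarrow> h j \<in> H n" "e \<in> Ed"
  shows "((\<lambda>t. \<Sum>j\<in>J. c j * h j (x(e := t))) has_real_derivative (\<Sum>j\<in>J. c j * coord_deriv e (h j) x)) (at (x e))"
  using coord_diffD[OF assms(1,2,3,4), of _ x "x e"]
  by (intro DERIV_sum DERIV_cmult) auto

lemma coord_diff_lin_comb:
  assumes "coord_diff H" shows "coord_diff (lin_comb K H)"
  by (rule coord_diffI) (use lin_comb_deriv[OF assms] in \<open>fastforce simp: lin_comb_def\<close>)

lemma deriv_fam_lin_comb:
  assumes d: "coord_diff H" and n: "n \<ge> 1"
  shows "deriv_fam (lin_comb K H) n \<subseteq> lin_comb K (deriv_fam H) n"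
proof
  fix f assume "f \<in> deriv_fam (lin_comb K H) n"
  then obtain e g where f: "f = (\<lambda>x. sqrt (real n) * coord_deriv e g x)" and e: "e \<in> Ed" and "g \<in> lin_comb K H n"
    by (auto simp: deriv_fam_def)
  then obtain J :: "nat set" and c h where g: "g = (\<lambda>x. \<Sum>j\<in>J. c j * h j x)" and J: "finite J"
      and c: "(\<Sum>j\<in>J. \<bar>c j\<bar>) \<le> K" and h: "\<And>j. j \<in> J \<Longrightarrow> h j \<in> H n"
    unfolding lin_comb_def by blast
  have "f = (\<lambda>x. \<Sum>j\<in>J. c j * (sqrt (real n) * coord_deriv e (h j) x))"
  proof
    fix x
    have "coord_deriv e (\<lambda>x. \<Sum>j\<in>J. c j * h j x) x = (\<Sum>j\<in>J. c j * coord_deriv e (h j) x)"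
      by (rule coord_deriv_eqI, rule lin_comb_deriv[OF d n h e])
    then show "f x = (\<Sum>j\<in>J. c j * (sqrt (real n) * coord_deriv e (h j) x))"
      unfolding f g by (simp add: sum_distrib_left algebra_simps)
  qed
  moreover have "\<forall>j\<in>J. (\<lambda>x. sqrt (real n) * coord_deriv e (h j) x) \<in> deriv_fam H n"
    using h e by (auto simp: deriv_fam_def)
  ultimately show "f \<in> lin_comb K (deriv_fam H) n"
    unfolding lin_comb_def using J c by (intro CollectI exI[of _ J] exI[of _ c] exI[of _ "\<lambda>j x. sqrt (real n) * coord_deriv e (h j) x"]) auto
qed

lemma tame_lin_comb: "K > 0 \<Longrightarrow> tame m H \<Longrightarrow> tame m (lin_comb K H)"
proof (induction m arbitrary: H)
  case 0 then show ?case using moment_bounded_lin_comb by auto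
next
  case (Suc m)
  have "tame m (lin_comb K (deriv_fam H))" using Suc by auto
  then have "tame m (deriv_fam (lin_comb K H))"
    by (rule tame_mono) (use deriv_fam_lin_comb Suc.prems in auto)
  then show ?case using Suc.prems moment_bounded_lin_comb coord_diff_lin_comb by auto
qed

lemma prod_deriv:
  assumes "coord_diff G" "coord_diff H" "n \<ge> 1" "g \<in> G n" "h \<in> H n" "e \<in> Ed"
  shows "((\<lambda>t. g (x(e := t)) * h (x(e := t))) has_real_derivative
    (coord_deriv e g x * h x + g x * coord_deriv e h x)) (at (x e))"
  using DERIV_mult[OF coord_diffD[OF assms(1,3,4,6), of x "x e"] coord_diffD[OF assms(2,3,5,6), of x "x e"]]
  by (simp add: algebra_simps)

text \<open>By the Leibniz rule a normalised derivative of a product is a sum of two products in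
  which one factor comes from a derivative family; order m of these follows by induction, for which
  both families must vary.\<close>

lemma tame_prod: "tame m G \<Longrightarrow> tame m H \<Longrightarrow> tame m (prod_fam G H)"
proof (induction m arbitrary: G H)
  case 0 then show ?case using moment_bounded_prod by auto
next
  case (Suc m)
  let ?U = "\<lambda>n. prod_fam (deriv_fam G) H n \<union> prod_fam G (deriv_fam H) n"
  have d: "coord_diff G" "coord_diff H" using Suc.prems by auto
  have "tame m ?U"
    by (intro tame_Un Suc.IH) (use Suc.prems tame_Suc_imp in auto)
  then have "tame m (lin_comb 2 ?U)" by (intro tame_lin_comb) auto
  then have "tame m (deriv_fam (prod_fam G H))"
  proof (rule tame_mono)
    fix n :: nat assume n: "n \<ge> 1"
    show "deriv_fam (prod_fam G H) n \<subseteq> lin_comb 2 ?U n"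
    proof
      fix f assume "f \<in> deriv_fam (prod_fam G H) n"
      then obtain e g h where f: "f = (\<lambda>x. sqrt (real n) * coord_deriv e (\<lambda>x. g x * h x) x)"
        and e: "e \<in> Ed" and gh: "g \<in> G n" "h \<in> H n"
        by (auto simp: deriv_fam_def prod_fam_def)
      have "f = (\<lambda>x. (sqrt (real n) * coord_deriv e g x) * h x + g x * (sqrt (real n) * coord_deriv e h x))"
        unfolding f by (rule ext) (simp add: coord_deriv_eqI[OF prod_deriv[OF d n gh e]] algebra_simps)
      moreover have "(\<lambda>x. (sqrt (real n) * coord_deriv e g x) * h x) \<in> ?U n"
        "(\<lambda>x. g x * (sqrt (real n) * coord_deriv e h x)) \<in> ?U n"
        by (intro UnI1 prod_famI deriv_famI gh e) (intro UnI2 prod_famI deriv_famI gh e)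
      ultimately show "f \<in> lin_comb 2 ?U n" by (simp add: lin_comb_add)
    qed
  qed
  moreover have "coord_diff (prod_fam G H)"
    by (rule coord_diffI) (use prod_deriv[OF d] in \<open>fastforce simp: prod_fam_def\<close>)
  ultimately show ?case using Suc.prems moment_bounded_prod by auto
qed

end

section \<open>The chain rule and composition with smooth functions\<close>

text \<open>Free of any order between \<open>a\<close> and \<open>b\<close>. The estimate on the
  intermediate point makes it converge to \<open>a\<close> as \<open>b\<close> does, which the chain
  rule below uses.\<close>

lemma mean_value_between:
  fixes \<psi> :: "real \<Rightarrow> real"
  assumes "\<And>t. (\<psi> has_real_derivative \<psi>' t) (at t)"
  obtains \<xi> where "\<bar>\<xi> - a\<bar> \<le> \<bar>b - a\<bar>" "\<psi> b - \<psi> a = \<psi>' \<xi> * (b - a)"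
proof (cases a b rule: linorder_cases)
  case less
  from MVT2[OF this assms] obtain z where z: "z > a" "z < b" "\<psi> b - \<psi> a = (b - a) * \<psi>' z" by blast
  then show thesis using that[of z] by (auto simp: mult.commute)
next
  case equal then show thesis using that[of a] by auto
next
  case greater
  from MVT2[OF this assms] obtain z where z: "z > b" "z < a" "\<psi> a - \<psi> b = (a - b) * \<psi>' z" by blast
  then show thesis using that[of z] by (auto simp: algebra_simps)
qed

lemma tendsto_coordinatewise:
  fixes f :: "'b \<Rightarrow> 'i \<Rightarrow> 'c::topological_space"
  assumes "\<And>j. ((\<lambda>t. f t j) \<longlongrightarrow> l j) F"
  shows "(f \<longlongrightarrow> l) F"
proof -
  have "limitin (product_topology (\<lambda>i. euclidean) UNIV) f l F"
    using assms by (simp add: limitin_componentwise)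
  then show ?thesis by (simp add: euclidean_product_topology)
qed

lemma C_infinity_partial:
  assumes "C_infinity d f" "j < d"
  shows "C_infinity d (partial j f)"
proof -
  have eq: "partials js (partial j f) = partials (js @ [j]) f" for js
    by (induction js) auto
  have dep: "depends_on_first d f" using assms by (simp add: C_infinity_def)
  have "depends_on_first d (partial j f)"
    unfolding depends_on_first_def
  proof (intro allI impI)
    fix x y :: "nat \<Rightarrow> real" assume xy: "\<forall>j<d. x j = y j"
    have "f (x(j := t)) = f (y(j := t))" for t
      using dep xy unfolding depends_on_first_def by (metis fun_upd_apply)
    then show "partial j f x = partial j f y" using xy assms(2) by (simp add: partial_def)
  qed
  then show ?thesis
    using assms unfolding C_infinity_def eq by (metis Un_insert_right insert_subset lessThan_iff list.simps(15) set_append set_empty2 sup_bot_right empty_set)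
qed

lemma bounded_partials_partial:
  assumes "bounded_partials d f" "j < d"
  shows "bounded_partials d (partial j f)" "\<exists>B. \<forall>x. \<bar>partial j f x\<bar> \<le> B"
proof -
  have eq: "partials js (partial j f) = partials (js @ [j]) f" for js
    by (induction js) auto
  show "bounded_partials d (partial j f)"
    unfolding bounded_partials_def eq
  proof (intro allI impI)
    fix js assume js: "js \<noteq> [] \<and> set js \<subseteq> {..<d}"
    have "js @ [j] \<noteq> [] \<and> set (js @ [j]) \<subseteq> {..<d}" using js assms(2) by auto
    then show "\<exists>B. \<forall>x. \<bar>partials (js @ [j]) f x\<bar> \<le> B"
      using assms(1) unfolding bounded_partials_def by blast
  qed
  have "[j] \<noteq> [] \<and> set [j] \<subseteq> {..<d}" using assms(2) by auto
  then have "\<exists>B. \<forall>x. \<bar>partials [j] f x\<bar> \<le> B"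
    using assms(1) unfolding bounded_partials_def by blast
  then show "\<exists>B. \<forall>x. \<bar>partial j f x\<bar> \<le> B" by simp
qed

lemma C_infinity_has_partial:
  assumes "C_infinity d f" "j < d"
  shows "((\<lambda>t. f (x(j := t))) has_real_derivative partial j f (x(j := s))) (at s)"
proof -
  have "\<forall>j<d. \<forall>x. (\<lambda>t. partials [] f (x(j := t))) differentiable (at (x j))"
    using assms(1) unfolding C_infinity_def by (metis empty_set empty_subsetI)
  then have "(\<lambda>t. f ((x(j := s))(j := t))) differentiable (at ((x(j := s)) j))"
    using assms(2) by (metis partials.simps(1))
  then show ?thesis unfolding partial_def by (simp add: DERIV_deriv_iff_real_differentiable)
qed

lemma C_infinity_cont:
  assumes "C_infinity d f" shows "continuous_on UNIV f"
  using assms unfolding C_infinity_def by (metis empty_set empty_subsetI partials.simps(1))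

lemma C_infinity_cong:
  "C_infinity d f \<Longrightarrow> (\<And>j. j < d \<Longrightarrow> x j = y j) \<Longrightarrow> f x = f y"
  unfolding C_infinity_def depends_on_first_def by blast

text \<open>Telescoping over the coordinates: \<open>hy k t\<close> moves the first k coordinates
  along the curve and freezes the others at time t0. Each step changes one coordinate, where the
  mean value theorem and continuity of \<open>partial k f\<close> in the product topology give the
  derivative.\<close>

lemma C_infinity_chain:
  fixes \<gamma> :: "real \<Rightarrow> nat \<Rightarrow> real"
  assumes f: "C_infinity d f"
    and \<gamma>: "\<And>j. j < d \<Longrightarrow> ((\<lambda>t. \<gamma> t j) has_real_derivative \<gamma>' j) (at t0)"
  shows "((\<lambda>t. f (\<gamma> t)) has_real_derivative (\<Sum>j<d. partial j f (\<gamma> t0) * \<gamma>' j)) (at t0)"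
proof -
  define hy where "hy k t = (\<lambda>j. if j < k then \<gamma> t j else \<gamma> t0 j)" for k :: nat and t
  have hy0: "hy k t0 = \<gamma> t0" for k by (simp add: hy_def fun_eq_iff)
  have step: "((\<lambda>t. f (hy (Suc k) t) - f (hy k t)) has_real_derivative partial k f (\<gamma> t0) * \<gamma>' k) (at t0)"
    if k: "k < d" for k
  proof -
    have ex: "\<exists>\<xi>. \<bar>\<xi> - \<gamma> t0 k\<bar> \<le> \<bar>\<gamma> t k - \<gamma> t0 k\<bar> \<and>
       f ((hy k t)(k := \<gamma> t k)) - f ((hy k t)(k := \<gamma> t0 k)) = partial k f ((hy k t)(k := \<xi>)) * (\<gamma> t k - \<gamma> t0 k)" for t
      using mean_value_between[OF C_infinity_has_partial[OF f k], of "\<gamma> t0 k" "\<gamma> t k" "hy k t"] by metis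
    obtain \<xi> where \<xi>: "\<And>t. \<bar>\<xi> t - \<gamma> t0 k\<bar> \<le> \<bar>\<gamma> t k - \<gamma> t0 k\<bar>"
       "\<And>t. f ((hy k t)(k := \<gamma> t k)) - f ((hy k t)(k := \<gamma> t0 k)) = partial k f ((hy k t)(k := \<xi> t)) * (\<gamma> t k - \<gamma> t0 k)"
      using ex by metis
    have eq: "(hy k t)(k := \<gamma> t k) = hy (Suc k) t" "(hy k t)(k := \<gamma> t0 k) = hy k t" for t
      by (auto simp: hy_def fun_eq_iff)
    have lim: "(\<lambda>t. \<gamma> t j) \<midarrow>t0\<rightarrow> \<gamma> t0 j" if "j < d" for j
      using DERIV_isCont[OF \<gamma>[OF that]] by (simp add: isCont_def)
    have lk: "((\<lambda>t. \<bar>\<gamma> t k - \<gamma> t0 k\<bar>) \<longlongrightarrow> 0) (at t0)"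
      using tendsto_rabs[OF tendsto_diff[OF lim[OF k] tendsto_const[of "\<gamma> t0 k"]]] by simp
    have "((\<lambda>t. \<xi> t - \<gamma> t0 k) \<longlongrightarrow> 0) (at t0)"
      by (rule Lim_null_comparison[OF _ lk]) (use \<xi>(1) in \<open>auto\<close>)
    then have l\<xi>: "(\<xi> \<longlongrightarrow> \<gamma> t0 k) (at t0)" by (simp add: LIM_zero_iff)
    have "((\<lambda>t. (hy k t)(k := \<xi> t)) \<longlongrightarrow> \<gamma> t0) (at t0)"
    proof (rule tendsto_coordinatewise)
      fix j
      show "((\<lambda>t. ((hy k t)(k := \<xi> t)) j) \<longlongrightarrow> \<gamma> t0 j) (at t0)"
        using l\<xi> lim k by (cases "j < k"; cases "j = k") (auto simp: hy_def)
    qed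
    moreover have "isCont (partial k f) (\<gamma> t0)"
      using C_infinity_cont[OF C_infinity_partial[OF f k]] by (simp add: continuous_on_eq_continuous_at)
    ultimately have l1: "((\<lambda>t. partial k f ((hy k t)(k := \<xi> t))) \<longlongrightarrow> partial k f (\<gamma> t0)) (at t0)"
      by (metis isCont_tendsto_compose)
    have l2: "((\<lambda>t. (\<gamma> t k - \<gamma> t0 k) / (t - t0)) \<longlongrightarrow> \<gamma>' k) (at t0)"
      using \<gamma>[OF k] by (simp add: has_field_derivative_iff)
    have "((\<lambda>t. (f (hy (Suc k) t) - f (hy k t) - (f (hy (Suc k) t0) - f (hy k t0))) / (t - t0)) \<longlongrightarrow> partial k f (\<gamma> t0) * \<gamma>' k) (at t0)"
      using tendsto_mult[OF l1 l2] \<xi>(2) by (simp add: eq hy0)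
    then show ?thesis by (simp add: has_field_derivative_iff)
  qed
  have "((\<lambda>t. f (hy k t)) has_real_derivative (\<Sum>j<k. partial j f (\<gamma> t0) * \<gamma>' j)) (at t0)" if "k \<le> d" for k
    using that
  proof (induction k)
    case 0 then show ?case by (simp add: hy_def)
  next
    case (Suc k)
    then show ?case using DERIV_add[OF Suc.IH step[of k]] by simp
  qed
  \<comment> \<open>\<open>hy d t\<close> and \<open>\<gamma> t\<close> agree below d, and
    \<open>f\<close> sees no other coordinates.\<close>
  from this[of d] show ?thesis
    using C_infinity_cong[OF f, of "hy d _" "\<gamma> _"] by (simp add: hy_def)
qed

text \<open>Only derivatives of nonzero order are bounded, so \<open>f\<close> itself may grow, but
  at most linearly: walk from the origin to x one coordinate at a time and apply the mean value
  theorem to each step.\<close>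

lemma C_infinity_growth:
  assumes f: "C_infinity d f" and b: "bounded_partials d f"
  obtains B where "B \<ge> 0" "\<And>x. \<bar>f x\<bar> \<le> \<bar>f (\<lambda>_. 0)\<bar> + (\<Sum>j<d. B * \<bar>x j\<bar>)"
proof -
  have "\<exists>B. \<forall>j<d. \<exists>x. True \<and> (\<forall>x. \<bar>partial j f x\<bar> \<le> B j)"
    using bounded_partials_partial(2)[OF b] by metis
  then obtain Bj where Bj: "\<And>j x. j < d \<Longrightarrow> \<bar>partial j f x\<bar> \<le> Bj j" by metis
  define B where "B = (\<Sum>j<d. \<bar>Bj j\<bar>)"
  have B0: "B \<ge> 0" by (simp add: B_def sum_nonneg)
  have B: "\<bar>partial j f x\<bar> \<le> B" if "j < d" for j x
  proof -
    have "\<bar>Bj j\<bar> \<le> B" unfolding B_def using that by (intro member_le_sum) auto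
    then show ?thesis using Bj[OF that, of x] by linarith
  qed
  have "\<bar>f x\<bar> \<le> \<bar>f (\<lambda>_. 0)\<bar> + (\<Sum>j<d. B * \<bar>x j\<bar>)" for x
  proof -
    define hy where "hy k = (\<lambda>j. if j < k then x j else 0)" for k :: nat
    have "\<bar>f (hy k)\<bar> \<le> \<bar>f (\<lambda>_. 0)\<bar> + (\<Sum>j<k. B * \<bar>x j\<bar>)" if "k \<le> d" for k
      using that
    proof (induction k)
      case 0 then show ?case by (simp add: hy_def)
    next
      case (Suc k)
      then have k: "k < d" by simp
      obtain \<xi> where \<xi>: "f ((hy k)(k := x k)) - f ((hy k)(k := 0)) = partial k f ((hy k)(k := \<xi>)) * (x k - 0)"
        using mean_value_between[OF C_infinity_has_partial[OF f k], of 0 "x k" "hy k"] by metis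
      have eq: "(hy k)(k := x k) = hy (Suc k)" "(hy k)(k := 0) = hy k"
        by (auto simp: hy_def fun_eq_iff)
      have "\<bar>f (hy (Suc k)) - f (hy k)\<bar> \<le> B * \<bar>x k\<bar>"
        using \<xi> B[OF k] by (simp add: eq abs_mult mult_right_mono)
      then show ?case using Suc.IH k by simp
    qed
    from this[of d] show ?thesis
      using C_infinity_cong[OF f, of "hy d" x] by (simp add: hy_def)
  qed
  then show thesis using that B0 by blast
qed

text \<open>The zeros from position d on match those in \<open>amp\<close>, so that each iterate is
  literally a member of such a family.\<close>

definition comp_fam :: "nat \<Rightarrow> ((nat \<Rightarrow> real) \<Rightarrow> real) \<Rightarrow> 'i fam \<Rightarrow> 'i fam" where
  "comp_fam d f H n = {\<lambda>x. f (\<lambda>j. if j < d then h j x else 0) | h. \<forall>j<d. h j \<in> H n}"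

lemma comp_famI:
  "(\<And>j. j < d \<Longrightarrow> h j \<in> H n) \<Longrightarrow> (\<lambda>x. f (\<lambda>j. if j < d then h j x else 0)) \<in> comp_fam d f H n"
  unfolding comp_fam_def by blast

context moment_class
begin

lemma moment_bounded_comp:
  assumes f: "C_infinity d f" "bounded_partials d f" and H: "moment_bounded H"
  shows "moment_bounded (comp_fam d f H)"
  unfolding moment_bounded_def
proof (intro conjI allI impI ballI)
  fix n :: nat and g assume n: "n \<ge> 1" and "g \<in> comp_fam d f H n"
  then obtain h where g: "g = (\<lambda>x. f (\<lambda>j. if j < d then h j x else 0))" and h: "\<And>j. j < d \<Longrightarrow> h j \<in> H n"
    by (auto simp: comp_fam_def)
  have "continuous_on UNIV (\<lambda>x. (\<lambda>j. if j < d then h j x else 0))"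
    by (rule continuous_on_coordinatewise_then_product)
      (use moment_bounded_cont[OF H n h] in \<open>metis (mono_tags) continuous_on_const continuous_on_cong\<close>)
  then show "continuous_on UNIV g"
    unfolding g using continuous_on_compose2[OF C_infinity_cont[OF f(1)]] by blast
next
  fix N
  obtain k where k: "k \<ge> 0" "\<And>n h a. n \<ge> 1 \<Longrightarrow> h \<in> H n \<Longrightarrow> a \<in> cls n \<Longrightarrow>
      (\<integral>\<^sup>+w. ennreal (h (a w) ^ (2 * N)) \<partial>M n) \<le> ennreal k"
    using moment_boundedE[OF H] by metis
  obtain B where B: "B \<ge> 0" "\<And>x. \<bar>f x\<bar> \<le> \<bar>f (\<lambda>_. 0)\<bar> + (\<Sum>j<d. B * \<bar>x j\<bar>)"
    using C_infinity_growth[OF f] by blast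
  \<comment> \<open>The extra index d carries the constant |f(0)|; it is paired with the constant
    function 1 in \<open>y\<close>, whose moment accounts for the 1 in \<open>max 1 k\<close>. The 1
    added in \<open>K\<close> keeps \<open>K\<close> positive if all coefficients vanish.\<close>
  define c where "c j = (if j < d then B else \<bar>f (\<lambda>_. 0)\<bar>)" for j
  define K where "K = real d * B + \<bar>f (\<lambda>_. 0)\<bar> + 1"
  have K: "K > 0" using B(1) by (auto simp: K_def intro!: add_nonneg_pos)
  show "\<exists>\<Gamma>. \<forall>n\<ge>1. \<forall>h\<in>comp_fam d f H n. \<forall>a\<in>cls n. (\<integral>\<^sup>+w. ennreal (h (a w) ^ (2 * N)) \<partial>M n) \<le> ennreal \<Gamma>"
  proof (intro exI[of _ "K ^ (2 * N) * (1 + max 1 k)"] allI impI ballI)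
    fix n :: nat and g a assume n: "n \<ge> 1" and "g \<in> comp_fam d f H n" and a: "a \<in> cls n"
    then obtain h where g: "g = (\<lambda>x. f (\<lambda>j. if j < d then h j x else 0))" and h: "\<And>j. j < d \<Longrightarrow> h j \<in> H n"
      by (auto simp: comp_fam_def)
    define y where "y j w = (if j < d then \<bar>h j (a w)\<bar> else 1)" for j w
    show "(\<integral>\<^sup>+w. ennreal (g (a w) ^ (2 * N)) \<partial>M n) \<le> ennreal (K ^ (2 * N) * (1 + max 1 k))"
    proof (rule nn_integral_lin_comb_le[OF n, where J = "{..d}" and c = c and h = y])
      have "sum (\<lambda>j. \<bar>c j\<bar>) {..<d} = sum (\<lambda>j. B) {..<d}"
        using B by (intro sum.cong) (auto simp: c_def)
      then show "(\<Sum>j\<le>d. \<bar>c j\<bar>) \<le> K"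
        unfolding lessThan_Suc_atMost[symmetric] using B(1) by (simp add: K_def c_def)
      show "y j \<in> borel_measurable (M n)" if "j \<in> {..d}" for j
        using measurable_compose_cls[OF n a moment_bounded_cont[OF H n h]] by (cases "j < d") (auto simp: y_def[abs_def])
      show "(\<integral>\<^sup>+w. ennreal (y j w ^ (2 * N)) \<partial>M n) \<le> ennreal (max 1 k)" if "j \<in> {..d}" for j
      proof (cases "j < d")
        case True
        have "(\<integral>\<^sup>+w. ennreal (y j w ^ (2 * N)) \<partial>M n) \<le> ennreal k"
          using k(2)[OF n h[OF True] a] True by (simp add: y_def power_even_abs)
        then show ?thesis by (meson ennreal_leI max.cobounded2 order_trans)
      next
        case False
        then show ?thesis using prob_space.emeasure_space_1[OF prob[OF n]]
          by (simp add: y_def)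
      qed
      fix w
      have "\<bar>g (a w)\<bar> \<le> (\<Sum>j\<le>d. c j * y j w)"
      proof -
        have "(\<Sum>j<d. B * \<bar>if j < d then h j (a w) else 0\<bar>) = (\<Sum>j<d. c j * y j w)"
          by (intro sum.cong) (auto simp: c_def y_def)
        then show ?thesis
          using B(2)[of "\<lambda>j. if j < d then h j (a w) else 0"]
          unfolding lessThan_Suc_atMost[symmetric] by (simp add: g c_def y_def)
      qed
      then have "\<bar>g (a w)\<bar> ^ (2 * N) \<le> (\<Sum>j\<le>d. c j * y j w) ^ (2 * N)"
        by (rule power_mono) simp
      then show "g (a w) ^ (2 * N) \<le> (\<Sum>j\<le>d. c j * y j w) ^ (2 * N)" by (simp add: power_even_abs)
    qed (use K in auto)
  qed
qed

lemma comp_deriv: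
  assumes f: "C_infinity d f" and H: "coord_diff H" and n: "n \<ge> 1"
    and h: "\<And>j. j < d \<Longrightarrow> h j \<in> H n" and e: "e \<in> Ed"
  shows "((\<lambda>t. f (\<lambda>j. if j < d then h j (x(e := t)) else 0)) has_real_derivative
     (\<Sum>j<d. partial j f (\<lambda>j. if j < d then h j x else 0) * coord_deriv e (h j) x)) (at (x e))"
proof -
  have "((\<lambda>t. if j < d then h j (x(e := t)) else 0) has_real_derivative coord_deriv e (h j) x) (at (x e))"
    if "j < d" for j
    using coord_diffD[OF H n h[OF that] e, of x "x e"] that by simp
  then show ?thesis
    using C_infinity_chain[OF f, of "\<lambda>t j. if j < d then h j (x(e := t)) else 0" "\<lambda>j. coord_deriv e (h j) x" "x e"]
    unfolding fun_upd_triv by blast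
qed

text \<open>By the chain rule a normalised derivative is a sum of d products of
  \<open>partial j f\<close>, composed with members of \<open>H\<close>, and a member of
  \<open>deriv_fam H\<close>. The induction runs over all \<open>f\<close>, because
  \<open>partial j f\<close> takes its place and inherits smoothness and bounded
  derivatives.\<close>

lemma tame_comp:
  "C_infinity d f \<Longrightarrow> bounded_partials d f \<Longrightarrow> tame m H \<Longrightarrow> tame m (comp_fam d f H)"
proof (induction m arbitrary: f H)
  case 0 then show ?case using moment_bounded_comp by auto
next
  case (Suc m)
  let ?U = "\<lambda>n. \<Union>j<d. prod_fam (comp_fam d (partial j f) H) (deriv_fam H) n"
  have d: "coord_diff H" using Suc.prems by auto
  have "tame m ?U"
    by (intro tame_UN_lt tame_prod Suc.IH)
       (use Suc.prems tame_Suc_imp C_infinity_partial bounded_partials_partial in auto)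
  \<comment> \<open>The d summands have coefficient 1; the additional 1 keeps the constant positive
    for d = 0.\<close>
  then have "tame m (lin_comb (real d + 1) ?U)" by (intro tame_lin_comb) auto
  then have "tame m (deriv_fam (comp_fam d f H))"
  proof (rule tame_mono)
    fix n :: nat assume n: "n \<ge> 1"
    show "deriv_fam (comp_fam d f H) n \<subseteq> lin_comb (real d + 1) ?U n"
    proof
      fix g assume "g \<in> deriv_fam (comp_fam d f H) n"
      then obtain e h where g: "g = (\<lambda>x. sqrt (real n) * coord_deriv e (\<lambda>x. f (\<lambda>j. if j < d then h j x else 0)) x)"
        and e: "e \<in> Ed" and h: "\<And>j. j < d \<Longrightarrow> h j \<in> H n"
        by (auto simp: deriv_fam_def comp_fam_def)
      have "g = (\<lambda>x. \<Sum>j<d. partial j f (\<lambda>j. if j < d then h j x else 0) * (sqrt (real n) * coord_deriv e (h j) x))"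
        unfolding g by (rule ext)
          (simp add: coord_deriv_eqI[OF comp_deriv[OF Suc.prems(1) d n h e]] sum_distrib_left algebra_simps)
      moreover have "(\<lambda>x. partial j f (\<lambda>j. if j < d then h j x else 0) * (sqrt (real n) * coord_deriv e (h j) x)) \<in> ?U n"
        if "j < d" for j
        by (rule UN_I[of j]) (use that h e in \<open>auto intro!: prod_famI comp_famI deriv_famI\<close>)
      ultimately show "g \<in> lin_comb (real d + 1) ?U n" by (simp add: lin_comb_sum)
    qed
  qed
  moreover have "coord_diff (comp_fam d f H)"
    by (rule coord_diffI) (use comp_deriv[OF Suc.prems(1) d] in \<open>fastforce simp: comp_fam_def\<close>)
  ultimately show ?case using Suc.prems moment_bounded_comp by auto
qed

end

section \<open>Iterated differences and their moments\<close>

text \<open>Jensen on [0,1]: the increment is the mean m of the derivative, and t^(2N) lies above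
  its tangent at m. The right side is a nonnegative integral so that it can later be exchanged with
  the expectation.\<close>

lemma even_power_increment_le:
  fixes \<phi> :: "real \<Rightarrow> real"
  assumes d: "\<And>t. (\<phi> has_real_derivative \<phi>' t) (at t)" and c: "continuous_on UNIV \<phi>'"
  shows "ennreal ((\<phi> 1 - \<phi> 0) ^ (2 * N)) \<le> (\<integral>\<^sup>+t. ennreal (\<phi>' t ^ (2 * N)) * indicator {0..1} t \<partial>lborel)"
proof -
  define m where "m = \<phi> 1 - \<phi> 0"
  have I1: "(\<phi>' has_integral m) {0..1}"
    unfolding m_def
    by (rule fundamental_theorem_of_calculus)
       (use d in \<open>auto simp: has_real_derivative_iff_has_vector_derivative intro: has_vector_derivative_at_within\<close>)
  have "(\<lambda>t. \<phi>' t ^ (2 * N)) integrable_on {0..1}"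
    by (intro integrable_continuous_interval continuous_on_power continuous_on_subset[OF c]) auto
  then obtain J where J: "((\<lambda>t. \<phi>' t ^ (2 * N)) has_integral J) {0..1}" by blast
  have tan: "y ^ (2 * N) \<ge> m ^ (2 * N) + real (2 * N) * m ^ (2 * N - 1) * (y - m)" for y
  proof -
    have "y ^ (2 * N) - m ^ (2 * N) \<ge> real (2 * N) * m ^ (2 * N - 1) * (y - m)"
    proof (rule convex_on_imp_above_tangent[where A = UNIV])
      show "convex_on UNIV (\<lambda>x::real. x ^ (2 * N))" by (rule convex_power_even) simp
      show "((\<lambda>x. x ^ (2 * N)) has_real_derivative real (2 * N) * m ^ (2 * N - 1)) (at m within UNIV)"
        by (auto intro!: derivative_eq_intros)
    qed auto
    then show ?thesis by simp
  qed
  \<comment> \<open>Integrated tangent line: the linear term vanishes because m is the mean, and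
    m^(2N) remains.\<close>
  have "((\<lambda>t. m ^ (2 * N) + real (2 * N) * m ^ (2 * N - 1) * (\<phi>' t - m)) has_integral
      (m ^ (2 * N) * (1 - 0) + real (2 * N) * m ^ (2 * N - 1) * (m - m * (1 - 0)))) {0..1}"
    using has_integral_const_real[of "m ^ (2 * N)" 0 1] has_integral_const_real[of m 0 1]
    by (intro has_integral_add has_integral_mult_right has_integral_diff I1) (auto simp: mult.commute)
  then have "m ^ (2 * N) * (1 - 0) + real (2 * N) * m ^ (2 * N - 1) * (m - m * (1 - 0)) \<le> J"
    by (rule has_integral_le[OF _ J]) (use tan in auto)
  then have "m ^ (2 * N) \<le> J" by simp
  then have "ennreal (m ^ (2 * N)) \<le> ennreal J" by (rule ennreal_leI)
  also have "ennreal J = (\<integral>\<^sup>+t. ennreal (\<phi>' t ^ (2 * N)) * indicator {0..1} t \<partial>lborel)"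
    by (rule nn_integral_has_integral_lebesgue'[OF _ J, symmetric]) (auto simp: power_mult)
  finally show ?thesis by (simp add: m_def)
qed

text \<open>The composition, over the e in the list, of the operators "identity minus substitution
  of 0 for x e".\<close>

primrec diff_op :: "'i list \<Rightarrow> (('i \<Rightarrow> real) \<Rightarrow> real) \<Rightarrow> ('i \<Rightarrow> real) \<Rightarrow> real" where
  "diff_op [] h = h"
| "diff_op (e # S) h = (\<lambda>x. diff_op S h x - diff_op S h (x(e := 0)))"

lemma continuous_on_diff_op: "continuous_on UNIV h \<Longrightarrow> continuous_on UNIV (diff_op S h)"
proof (induction S)
  case (Cons e S)
  have "continuous_on UNIV (\<lambda>x :: 'a \<Rightarrow> real. x(e := 0))"
    by (intro continuous_on_fun_upd continuous_intros)
  then have "continuous_on UNIV (\<lambda>x. diff_op S h (x(e := 0)))"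
    using continuous_on_compose2[OF Cons.IH[OF Cons.prems]] by blast
  then show ?case using Cons by (auto intro!: continuous_intros)
qed auto

lemma diff_op_scaled: "diff_op S (\<lambda>x. c * h x) x = c * diff_op S h x"
  by (induction S arbitrary: x) (auto simp: algebra_simps)

lemma diff_op_has_deriv:
  assumes "\<And>x s. ((\<lambda>t. h (x(e := t))) has_real_derivative coord_deriv e h (x(e := s))) (at s)"
    and "e \<notin> set S"
  shows "((\<lambda>t. diff_op S h (x(e := t))) has_real_derivative diff_op S (coord_deriv e h) (x(e := s))) (at s)"
  using assms(2)
proof (induction S arbitrary: x s)
  case Nil then show ?case using assms(1) by (simp del: fun_upd_apply)
next
  case (Cons f S)
  have "f \<noteq> e" using Cons.prems by auto
  then have sw: "x(e := t, f := 0) = x(f := 0, e := t)" for x :: "'a \<Rightarrow> real" and t by auto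
  show ?case using Cons by (auto simp: sw simp del: fun_upd_apply intro!: DERIV_diff)
qed

definition monomial :: "'i list \<Rightarrow> ('i \<Rightarrow> real) \<Rightarrow> real" where
  "monomial L x = prod_list (map x L)"

primrec power_fam :: "nat \<Rightarrow> 'i fam \<Rightarrow> 'i fam" where
  "power_fam 0 H = (\<lambda>n. {\<lambda>x. 1})"
| "power_fam (Suc k) H = prod_fam H (power_fam k H)"

lemma power_famI:
  "set hs \<subseteq> H n \<Longrightarrow> (\<lambda>x. prod_list (map (\<lambda>h. h x) hs)) \<in> power_fam (length hs) H n"
  by (induction hs) (auto intro: prod_famI)

context moment_class
begin

lemma moment_bounded_power: "moment_bounded H \<Longrightarrow> moment_bounded (power_fam k H)"
  by (induction k) (use tame_const[of 0] in \<open>auto intro: moment_bounded_prod\<close>)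

lemma tame_power: "tame m H \<Longrightarrow> tame m (power_fam k H)"
  by (induction k) (auto intro: tame_prod tame_const)

lemma moment_bounded_monomial: "moment_bounded (\<lambda>n. {monomial L | L. length L = k})"
proof (rule moment_bounded_mono[OF moment_bounded_power[OF moment_bounded_coords]])
  fix n :: nat
  show "{monomial L | L :: 'i list. length L = k} \<subseteq> power_fam k (\<lambda>n. {\<lambda>x. x e | e. True}) n"
  proof (rule subsetI)
    fix f :: "('i \<Rightarrow> real) \<Rightarrow> real" assume "f \<in> {monomial L | L. length L = k}"
    then obtain L :: "'i list" where L: "f = monomial L" "length L = k" by blast
    have "(\<lambda>x. prod_list (map (\<lambda>h. h x) (map (\<lambda>e x. x e) L))) \<in> power_fam (length (map (\<lambda>e x. x e) L)) (\<lambda>n. {\<lambda>x. x e | e. True}) n"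
      using power_famI[of "map (\<lambda>e x. x e) L" "\<lambda>n. {\<lambda>x. x e | e. True}" n] by auto
    then show "f \<in> power_fam k (\<lambda>n. {\<lambda>x. x e | e. True}) n"
      using L by (simp add: monomial_def[abs_def] comp_def)
  qed
qed

text \<open>The substitution is moved from the function to the random point, which stays in the
  class by \<open>scale\<close> with t = 0.\<close>

lemma moment_bounded_shift:
  assumes H: "moment_bounded H"
  shows "moment_bounded (\<lambda>n. {\<lambda>x. h (x(e := 0)) | h e. h \<in> H n})"
  unfolding moment_bounded_def
proof (intro conjI allI impI ballI)
  fix n :: nat and g assume n: "n \<ge> 1" and "g \<in> {\<lambda>x. h (x(e := 0)) | h e. h \<in> H n}"
  then obtain h e where g: "g = (\<lambda>x. h (x(e := 0)))" and h: "h \<in> H n" by auto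
  have "continuous_on UNIV (\<lambda>x :: 'i \<Rightarrow> real. x(e := 0))"
    by (intro continuous_on_fun_upd continuous_intros)
  then show "continuous_on UNIV g"
    unfolding g using continuous_on_compose2[OF moment_bounded_cont[OF H n h]] by blast
next
  fix N
  obtain k where k: "k \<ge> 0" "\<And>n h a. n \<ge> 1 \<Longrightarrow> h \<in> H n \<Longrightarrow> a \<in> cls n \<Longrightarrow>
      (\<integral>\<^sup>+w. ennreal (h (a w) ^ (2 * N)) \<partial>M n) \<le> ennreal k"
    using moment_boundedE[OF H] by metis
  show "\<exists>\<Gamma>. \<forall>n\<ge>1. \<forall>g\<in>{\<lambda>x. h (x(e := 0)) | h e. h \<in> H n}. \<forall>a\<in>cls n. (\<integral>\<^sup>+w. ennreal (g (a w) ^ (2 * N)) \<partial>M n) \<le> ennreal \<Gamma>"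
  proof (intro exI[of _ k] allI impI ballI)
    fix n :: nat and g a assume n: "n \<ge> 1" and "g \<in> {\<lambda>x. h (x(e := 0)) | h e. h \<in> H n}" and a: "a \<in> cls n"
    then obtain h e where g: "g = (\<lambda>x. h (x(e := 0)))" and h: "h \<in> H n" by auto
    have "(\<lambda>w. (a w)(e := 0)) \<in> cls n" using scale[OF n a, of 0 e] by simp
    from k(2)[OF n h this] show "(\<integral>\<^sup>+w. ennreal (g (a w) ^ (2 * N)) \<partial>M n) \<le> ennreal k" by (simp add: g)
  qed
qed

text \<open>A crude bound without any gain in n, from writing each difference as a combination of
  two terms. It supplies continuity and integrability; the factor n^(-r/2) is the subject of
  \<open>diff_op_moment\<close>.\<close>

lemma moment_bounded_diff_op:
  assumes "moment_bounded H"
  shows "moment_bounded (\<lambda>n. {diff_op S h | S h. length S = r \<and> h \<in> H n})"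
proof (induction r)
  case 0 then show ?case using assms by simp
next
  case (Suc r)
  let ?D = "\<lambda>n. {diff_op S h | S h. length S = r \<and> h \<in> H n}"
  let ?E = "\<lambda>n. ?D n \<union> {\<lambda>x. h (x(e := 0)) | h e. h \<in> ?D n}"
  have "moment_bounded (lin_comb 2 ?E)"
    by (intro moment_bounded_lin_comb moment_bounded_Un moment_bounded_shift Suc.IH) auto
  then show ?case
  proof (rule moment_bounded_mono)
    fix n :: nat
    show "{diff_op S h | S h. length S = Suc r \<and> h \<in> H n} \<subseteq> lin_comb 2 ?E n"
    proof safe
      fix S :: "'i list" and h assume S: "length S = Suc r" and h: "h \<in> H n"
      then obtain e T where ST: "S = e # T" "length T = r" by (cases S) auto
      have 1: "diff_op T h \<in> ?E n" using ST h by blast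
      have 2: "(\<lambda>x. diff_op T h (x(e := 0))) \<in> ?E n" using ST h by blast
      show "diff_op S h \<in> lin_comb 2 ?E n"
        unfolding lin_comb_def
        by (rule CollectI, rule exI[of _ "{0, 1}"], rule exI[of _ "\<lambda>j. if j = 0 then 1 else - 1"],
            rule exI[of _ "\<lambda>j. if j = 0 then diff_op T h else (\<lambda>x. diff_op T h (x(e := 0)))"])
          (use 1 2 in \<open>auto simp: ST\<close>)
    qed
  qed
qed

lemma nn_integral_imp_integrable:
  assumes n: "n \<ge> 1" and f: "f \<in> borel_measurable (M n)" and fin: "(\<integral>\<^sup>+w. ennreal ((f w)\<^sup>2) \<partial>M n) \<le> ennreal c"
  shows "integrable (M n) f"
proof -
  have "(\<integral>\<^sup>+w. ennreal (norm (f w)) \<partial>M n) \<le> (\<integral>\<^sup>+w. ennreal 1 \<partial>M n) + (\<integral>\<^sup>+w. ennreal ((f w)\<^sup>2) \<partial>M n)"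
  proof (rule nn_integral_add_le[OF n])
    fix w
    have "0 \<le> (\<bar>f w\<bar> - 1)\<^sup>2" by simp
    then have "2 * \<bar>f w\<bar> \<le> 1 + (f w)\<^sup>2" by (simp add: power2_diff)
    then show "norm (f w) \<le> 1 + (f w)\<^sup>2" by (simp; smt (verit) zero_le_power2)
  qed (use f in auto)
  also have "\<dots> < \<infinity>"
    using fin prob_space.emeasure_space_1[OF prob[OF n]] by (auto simp: ennreal_add_less_top order_le_less_trans)
  finally show ?thesis using f by (intro integrableI_bounded) auto
qed

lemma moment_bounded_integrable:
  assumes H: "moment_bounded H" and n: "n \<ge> 1" and h: "h \<in> H n" and a: "a \<in> cls n"
  shows "integrable (M n) (\<lambda>w. h (a w))"
proof -
  obtain c where "\<And>n h a. n \<ge> 1 \<Longrightarrow> h \<in> H n \<Longrightarrow> a \<in> cls n \<Longrightarrow>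
      (\<integral>\<^sup>+w. ennreal (h (a w) ^ (2 * 1)) \<partial>M n) \<le> ennreal c"
    using moment_boundedE[OF H, of 1] by metis
  from this[OF n h a] show ?thesis
    by (intro nn_integral_imp_integrable[OF n] measurable_compose_cls[OF n a moment_bounded_cont[OF H n h]]) simp
qed

text \<open>Joint continuity in t and x yields the measurability on the product space under which
  the t-integral and the expectation are exchanged.\<close>

lemma continuous_on_joint_upd:
  fixes a :: "'b::topological_space \<Rightarrow> 'i \<Rightarrow> real"
  assumes "continuous_on UNIV (\<psi> :: ('i \<Rightarrow> real) \<Rightarrow> real)"
  shows "continuous_on UNIV (\<lambda>(t, x). \<psi> (x(e := t * x e)))"
proof -
  have "continuous_on UNIV (\<lambda>z :: real \<times> ('i \<Rightarrow> real). (snd z)(e := fst z * snd z e))"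
    by (intro continuous_on_fun_upd continuous_intros continuous_on_product_then_coordinatewise)
  from continuous_on_compose2[OF assms this] show ?thesis by (simp add: case_prod_beta)
qed

text \<open>
  Each difference is written as \<open>h(x) - h(x(e := 0)) = \<integral>\<^sub>0\<^sup>1 x e * \<partial>\<^sub>e h (x(e := t * x e)) dt\<close>, and the
  interpolated random point is again in the class; \<open>\<partial>\<^sub>e\<close> commutes with the remaining differences
  because their coordinates differ from \<open>e\<close>.
\<close>

lemma diff_op_moment:
  assumes "tame r H"
  shows "\<exists>\<Gamma>\<ge>0. \<forall>n\<ge>1. \<forall>h\<in>H n. \<forall>a\<in>cls n. \<forall>S. length S = r \<and> distinct S \<and> set S \<subseteq> Ed \<longrightarrow>
    (\<integral>\<^sup>+w. ennreal ((sqrt (real n) ^ r * diff_op S h (a w)) ^ (2 * N)) \<partial>M n) \<le> ennreal \<Gamma>"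
  using assms
proof (induction r arbitrary: H N)
  case 0
  then have "moment_bounded H" by simp
  then obtain k where "k \<ge> 0" "\<And>n h a. n \<ge> 1 \<Longrightarrow> h \<in> H n \<Longrightarrow> a \<in> cls n \<Longrightarrow>
      (\<integral>\<^sup>+w. ennreal (h (a w) ^ (2 * N)) \<partial>M n) \<le> ennreal k"
    using moment_boundedE[of H N] by metis
  then show ?case by (intro exI[of _ k]) auto
next
  case (Suc r)
  have H: "moment_bounded H" "coord_diff H" "tame r (deriv_fam H)" using Suc.prems by auto
  \<comment> \<open>The order is doubled because the integrand below is the product of
    \<open>x e\<close> with a difference of lower length, to be split by
    \<open>even_power_mult_le\<close>.\<close>
  obtain \<Gamma> where \<Gamma>: "\<Gamma> \<ge> 0" "\<And>n h a S. n \<ge> 1 \<Longrightarrow> h \<in> deriv_fam H n \<Longrightarrow> a \<in> cls n \<Longrightarrow> length S = r \<Longrightarrow> distinct S \<Longrightarrow> set S \<subseteq> Ed \<Longrightarrow>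
    (\<integral>\<^sup>+w. ennreal ((sqrt (real n) ^ r * diff_op S h (a w)) ^ (2 * (2 * N))) \<partial>M n) \<le> ennreal \<Gamma>"
    using Suc.IH[OF H(3), of "2 * N"] by metis
  obtain c where c: "\<And>n a e. n \<ge> 1 \<Longrightarrow> a \<in> cls n \<Longrightarrow> (\<integral>\<^sup>+w. ennreal ((a w e) ^ (2 * (2 * N))) \<partial>M n) \<le> ennreal c"
    using coord_moments[of "2 * N"] by metis
  show ?case
  proof (intro exI[of _ "max 0 c + \<Gamma>"] conjI allI impI ballI)
    show "0 \<le> max 0 c + \<Gamma>" using \<Gamma>(1) by simp
    fix n :: nat and h a and S :: "'i list"
    assume n: "n \<ge> 1" and h: "h \<in> H n" and a: "a \<in> cls n" and S: "length S = Suc r \<and> distinct S \<and> set S \<subseteq> Ed"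
    then obtain e T where ST: "S = e # T" "length T = r" "distinct T" "set T \<subseteq> Ed" "e \<in> Ed" "e \<notin> set T" by (cases S) auto
    interpret P: prob_space "M n" using prob[OF n] .
    define q where "q = sqrt (real n)"
    \<comment> \<open>Of the Suc r factors \<open>sqrt (real n)\<close>, one turns the derivative
      into a member of \<open>deriv_fam H\<close>; the other r are those in the induction hypothesis
      for \<open>T\<close>.\<close>
    define h' where "h' = (\<lambda>x. q * coord_deriv e h x)"
    have h': "h' \<in> deriv_fam H n" unfolding h'_def q_def by (intro deriv_famI ST(5) h)
    define \<psi> where "\<psi> = (\<lambda>x. q ^ r * diff_op T h' x)"
    have \<psi>c: "continuous_on UNIV \<psi>"
      unfolding \<psi>_def
      by (intro continuous_intros continuous_on_diff_op moment_bounded_cont[OF tame_imp_moment_bounded[OF H(3)] n h'])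
    define G where "G = (\<lambda>t x. x e * \<psi> (x(e := t * x e)))"
    have Gc: "continuous_on UNIV (\<lambda>z. G (fst z) (snd z))"
    proof -
      have "continuous_on UNIV (\<lambda>z :: real \<times> ('i \<Rightarrow> real). \<psi> ((snd z)(e := fst z * snd z e)))"
        using continuous_on_joint_upd[OF \<psi>c, of e] by (simp add: case_prod_beta)
      moreover have "continuous_on UNIV (\<lambda>z :: real \<times> ('i \<Rightarrow> real). snd z e)"
        by (rule continuous_on_product_then_coordinatewise[OF continuous_on_snd[OF continuous_on_id]])
      ultimately show ?thesis unfolding G_def by (intro continuous_on_mult)
    qed
    have inc: "ennreal ((q ^ Suc r * diff_op S h x) ^ (2 * N)) \<le> (\<integral>\<^sup>+t. ennreal (G t x ^ (2 * N)) * indicator {0..1} t \<partial>lborel)" for x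
    proof -
      define \<phi> where "\<phi> t = q ^ Suc r * diff_op T h (x(e := t * x e))" for t
      have d: "(\<phi> has_real_derivative G t x) (at t)" for t
      proof -
        have "((\<lambda>s. diff_op T h (x(e := s))) has_real_derivative diff_op T (coord_deriv e h) (x(e := t * x e))) (at (t * x e))"
          by (rule diff_op_has_deriv[OF coord_diffD[OF H(2) n h ST(5)] ST(6)])
        moreover have "((\<lambda>t. t * x e) has_real_derivative x e) (at t)"
          using DERIV_cmult_right[OF DERIV_ident, of "x e"] by simp
        ultimately have "((\<lambda>t. diff_op T h (x(e := t * x e))) has_real_derivative diff_op T (coord_deriv e h) (x(e := t * x e)) * x e) (at t)"
          by (rule DERIV_chain2)
        from DERIV_cmult[OF this, of "q ^ Suc r"] show ?thesis
          by (simp add: \<phi>_def[abs_def] G_def \<psi>_def h'_def diff_op_scaled algebra_simps)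
      qed
      have cG: "continuous_on UNIV (\<lambda>t. G t x)"
        using continuous_on_compose2[OF Gc, of UNIV "\<lambda>t. (t, x)"] by (simp add: continuous_on_Pair)
      have "\<phi> 1 - \<phi> 0 = q ^ Suc r * diff_op S h x"
        by (simp add: \<phi>_def ST algebra_simps)
      then show ?thesis using even_power_increment_le[OF d cG, of N] by simp
    qed
    have inner: "(\<integral>\<^sup>+w. ennreal (G t (a w) ^ (2 * N)) \<partial>M n) \<le> ennreal (max 0 c + \<Gamma>)" if t: "0 \<le> t" "t \<le> 1" for t
    proof -
      let ?a = "\<lambda>w. (a w)(e := t * a w e)"
      have ca: "?a \<in> cls n" by (rule scale[OF n a t])
      have "(\<integral>\<^sup>+w. ennreal (G t (a w) ^ (2 * N)) \<partial>M n) \<le>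
        (\<integral>\<^sup>+w. ennreal (a w e ^ (2 * (2 * N))) \<partial>M n) + (\<integral>\<^sup>+w. ennreal (\<psi> (?a w) ^ (2 * (2 * N))) \<partial>M n)"
      proof (rule nn_integral_add_le[OF n])
        show "(\<lambda>w. a w e ^ (2 * (2 * N))) \<in> borel_measurable (M n)"
          using measurable_compose_cls[OF n a, of "\<lambda>x. x e"] by simp
        show "(\<lambda>w. \<psi> (?a w) ^ (2 * (2 * N))) \<in> borel_measurable (M n)"
          using measurable_compose_cls[OF n ca \<psi>c] by simp
      qed (use even_power_mult_le in \<open>auto simp: power_mult G_def\<close>)
      also have "\<dots> \<le> ennreal (max 0 c) + ennreal \<Gamma>"
      proof (rule add_mono)
        show "(\<integral>\<^sup>+w. ennreal (a w e ^ (2 * (2 * N))) \<partial>M n) \<le> ennreal (max 0 c)"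
          using c[OF n a] by (meson ennreal_leI max.cobounded2 order_trans)
        show "(\<integral>\<^sup>+w. ennreal (\<psi> (?a w) ^ (2 * (2 * N))) \<partial>M n) \<le> ennreal \<Gamma>"
          unfolding \<psi>_def q_def by (rule \<Gamma>(2)[OF n h' ca ST(2-4)])
      qed
      finally show ?thesis using \<Gamma>(1) by simp
    qed
    interpret PP: pair_sigma_finite "lborel :: real measure" "M n" ..
    have jm: "(\<lambda>(t, w). ennreal (G t (a w) ^ (2 * N)) * indicator {0..1} t) \<in> borel_measurable (lborel \<Otimes>\<^sub>M M n)"
    proof -
      have "(\<lambda>z. (fst z, a (snd z))) \<in> borel_measurable (lborel \<Otimes>\<^sub>M M n)"
        using measurable_compose[OF measurable_snd meas[OF n a]]
        by (intro borel_measurable_Pair) auto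
      from measurable_compose[OF this borel_measurable_continuous_onI[OF Gc]]
      have G: "(\<lambda>z. G (fst z) (a (snd z))) \<in> borel_measurable (lborel \<Otimes>\<^sub>M M n)" by simp
      have "(\<lambda>z. ennreal (G (fst z) (a (snd z)) ^ (2 * N))) \<in> borel_measurable (lborel \<Otimes>\<^sub>M M n)"
        by (rule measurable_compose[OF borel_measurable_power[OF G] measurable_ennreal])
      moreover have "(\<lambda>z. indicator {0..1 :: real} (fst z) :: ennreal) \<in> borel_measurable (lborel \<Otimes>\<^sub>M M n)"
        by (rule measurable_compose[OF measurable_fst]) (simp add: borel_measurable_indicator)
      ultimately show ?thesis unfolding case_prod_beta by (rule borel_measurable_times_ennreal)
    qed
    have "(\<integral>\<^sup>+w. ennreal ((q ^ Suc r * diff_op S h (a w)) ^ (2 * N)) \<partial>M n)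
       \<le> (\<integral>\<^sup>+w. (\<integral>\<^sup>+t. ennreal (G t (a w) ^ (2 * N)) * indicator {0..1} t \<partial>lborel) \<partial>M n)"
      by (intro nn_integral_mono inc)
    also have "\<dots> = (\<integral>\<^sup>+t. (\<integral>\<^sup>+w. ennreal (G t (a w) ^ (2 * N)) * indicator {0..1} t \<partial>M n) \<partial>lborel)"
      using PP.Fubini'[OF jm] by simp
    also have "\<dots> \<le> (\<integral>\<^sup>+t. ennreal (max 0 c + \<Gamma>) * indicator {0..1} (t :: real) \<partial>lborel)"
      by (intro nn_integral_mono) (auto simp: inner indicator_def)
    also have "\<dots> = ennreal (max 0 c + \<Gamma>)"
      by (subst nn_integral_cmult_indicator) auto
    finally show "(\<integral>\<^sup>+w. ennreal ((sqrt (real n) ^ Suc r * diff_op S h (a w)) ^ (2 * N)) \<partial>M n) \<le> ennreal (max 0 c + \<Gamma>)"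
      by (simp add: q_def)
  qed
qed

end

section \<open>Monomials and the counting of index lists\<close>

lemma monomial_upd: "e \<notin> set L \<Longrightarrow> monomial L (x(e := t)) = monomial L x"
  unfolding monomial_def by (rule arg_cong[of _ _ prod_list]) auto

text \<open>Expanding over ordered lists instead of multi-indices avoids multinomial coefficients,
  and the multiplicity of an index can be read off the list.\<close>

lemma sum_list_power:
  fixes y :: "'b \<Rightarrow> real"
  assumes "finite I"
  shows "(\<Sum>j\<in>I. y j) ^ N = (\<Sum>xs | set xs \<subseteq> I \<and> length xs = N. prod_list (map y xs))"
proof (induction N)
  case 0
  have "{xs. set xs \<subseteq> I \<and> length xs = 0} = {[]}" by auto
  then show ?case by simp
next
  case (Suc N)
  let ?L = "\<lambda>N. {xs. set xs \<subseteq> I \<and> length xs = N}"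
  have "?L (Suc N) = (\<lambda>p. fst p # snd p) ` (I \<times> ?L N)"
    by (auto simp: length_Suc_conv image_iff)
  moreover have "inj_on (\<lambda>p. fst p # snd p) (I \<times> ?L N)" by (auto simp: inj_on_def)
  ultimately have "(\<Sum>xs\<in>?L (Suc N). prod_list (map y xs)) = (\<Sum>(x, xs)\<in>I \<times> ?L N. y x * prod_list (map y xs))"
    by (simp add: sum.reindex case_prod_beta)
  also have "\<dots> = (\<Sum>x\<in>I. y x) * (\<Sum>xs\<in>?L N. prod_list (map y xs))"
    by (simp add: sum.cartesian_product[symmetric] sum_product)
  finally show ?case using Suc by simp
qed

text \<open>A list rather than a set, because \<open>diff_op\<close> recurses over a list;
  \<open>remdups\<close> makes its distinctness immediate.\<close>

definition singles :: "'b list \<Rightarrow> 'b list" where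
  "singles xs = filter (\<lambda>x. count_list xs x = 1) (remdups xs)"

lemma singles_props: "distinct (singles xs)" "set (singles xs) = {x \<in> set xs. count_list xs x = 1}"
  by (auto simp: singles_def)

text \<open>Every element of \<open>xs\<close> that is not a single occurs at least twice.\<close>

lemma length_singles_ge: "2 * card (set xs) \<le> length xs + length (singles xs)"
proof -
  have "2 * card (set xs) = (\<Sum>x\<in>set xs. 2)" by simp
  also have "\<dots> \<le> (\<Sum>x\<in>set xs. count_list xs x + (if count_list xs x = 1 then 1 else 0))"
  proof (rule sum_mono)
    fix x assume "x \<in> set xs"
    then have "count_list xs x \<noteq> 0" by (simp add: count_list_0_iff)
    then show "2 \<le> count_list xs x + (if count_list xs x = 1 then 1 else 0)" by auto
  qed
  also have "\<dots> = length xs + card {x \<in> set xs. count_list xs x = 1}"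
    by (simp add: sum.distrib sum_count_set flip: sum.inter_filter)
  also have "card {x \<in> set xs. count_list xs x = 1} = length (singles xs)"
    using singles_props[of xs] distinct_card by metis
  finally show ?thesis .
qed

text \<open>Prepend one index to a list of length N: at most N choices repeat an old index and keep
  the weight, the at most \<open>card I\<close> others multiply it by 1 / \<open>card I\<close>. So
  each step costs a factor of at most N + 1, whatever \<open>I\<close> is.\<close>

lemma sum_inverse_power_card:
  assumes I: "finite I" "I \<noteq> {}"
  shows "(\<Sum>xs | set xs \<subseteq> I \<and> length xs = N. 1 / real (card I) ^ card (set xs)) \<le> fact N"
proof (induction N)
  case 0
  have "{xs. set xs \<subseteq> I \<and> length xs = 0} = {[]}" by auto
  then show ?case by simp
next
  case (Suc N)
  let ?L = "\<lambda>N. {xs. set xs \<subseteq> I \<and> length xs = N}"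
  let ?n = "real (card I)"
  have n: "?n > 0" using I by (simp add: card_gt_0_iff)
  have "?L (Suc N) = (\<lambda>p. snd p # fst p) ` (?L N \<times> I)"
    by (auto simp: length_Suc_conv image_iff)
  moreover have "inj_on (\<lambda>p. snd p # fst p) (?L N \<times> I)" by (auto simp: inj_on_def)
  ultimately have "(\<Sum>xs\<in>?L (Suc N). 1 / ?n ^ card (set xs)) = (\<Sum>(xs, x)\<in>?L N \<times> I. 1 / ?n ^ card (insert x (set xs)))"
    by (simp add: sum.reindex case_prod_beta)
  also have "\<dots> = (\<Sum>xs\<in>?L N. \<Sum>x\<in>I. 1 / ?n ^ card (insert x (set xs)))"
    by (simp add: sum.cartesian_product)
  also have "\<dots> \<le> (\<Sum>xs\<in>?L N. (real N + 1) * (1 / ?n ^ card (set xs)))"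
  proof (rule sum_mono)
    fix xs assume xs: "xs \<in> ?L N"
    let ?d = "card (set xs)"
    have "(\<Sum>x\<in>I. 1 / ?n ^ card (insert x (set xs)))
       \<le> (\<Sum>x\<in>I. (if x \<in> set xs then 1 / ?n ^ ?d else 0) + 1 / ?n ^ ?d / ?n)"
      by (rule sum_mono) (use n in \<open>auto simp: insert_absorb divide_simps\<close>)
    also have "\<dots> = real (card {x \<in> I. x \<in> set xs}) * (1 / ?n ^ ?d) + 1 / ?n ^ ?d"
      using n I by (simp add: sum.distrib flip: sum.inter_filter)
    also have "\<dots> \<le> real N * (1 / ?n ^ ?d) + 1 / ?n ^ ?d"
    proof (intro add_right_mono mult_right_mono)
      have "card {x \<in> I. x \<in> set xs} \<le> card (set xs)" by (intro card_mono) auto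
      also have "\<dots> \<le> N" using xs card_length[of xs] by simp
      finally show "real (card {x \<in> I. x \<in> set xs}) \<le> real N" by simp
    qed (use n in auto)
    finally show "(\<Sum>x\<in>I. 1 / ?n ^ card (insert x (set xs))) \<le> (real N + 1) * (1 / ?n ^ ?d)"
      by (simp only: distrib_right mult_1)
  qed
  also have "\<dots> = (real N + 1) * (\<Sum>xs\<in>?L N. 1 / ?n ^ card (set xs))" by (simp add: sum_distrib_left)
  also have "\<dots> \<le> (real N + 1) * fact N" using Suc by (intro mult_left_mono) auto
  also have "\<dots> = fact (Suc N)" by (simp add: algebra_simps)
  finally show ?case .
qed

text \<open>With d distinct indices and s singles, \<open>length_singles_ge\<close> gives n^(-s/2)
  <= n^(N/2) n^(-d), and the n^(-d) sum to at most N!. The remaining growth n^(N/2) will be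
  cancelled by the normalisation of the matrix sum.\<close>

lemma sum_singles_le:
  assumes n: "n \<ge> 1"
  shows "(\<Sum>xs | set xs \<subseteq> {1..n} \<and> length xs = N. 1 / sqrt (real n) ^ length (singles xs)) \<le> sqrt (real n) ^ N * fact N"
proof -
  let ?L = "{xs. set xs \<subseteq> {1..n} \<and> length xs = N}"
  have "(\<Sum>xs\<in>?L. 1 / sqrt (real n) ^ length (singles xs)) \<le> (\<Sum>xs\<in>?L. sqrt (real n) ^ N * (1 / real n ^ card (set xs)))"
  proof (rule sum_mono)
    fix xs assume "xs \<in> ?L"
    then have "2 * card (set xs) \<le> N + length (singles xs)" using length_singles_ge[of xs] by simp
    then have "sqrt (real n) ^ (2 * card (set xs)) \<le> sqrt (real n) ^ (N + length (singles xs))"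
      using n by (intro power_increasing) auto
    then show "1 / sqrt (real n) ^ length (singles xs) \<le> sqrt (real n) ^ N * (1 / real n ^ card (set xs))"
      using n by (simp add: power_mult power_add divide_simps)
  qed
  also have "\<dots> = sqrt (real n) ^ N * (\<Sum>xs\<in>?L. 1 / real n ^ card (set xs))" by (simp add: sum_distrib_left)
  also have "\<dots> \<le> sqrt (real n) ^ N * fact N"
    using sum_inverse_power_card[of "{1..n}" N] n by (intro mult_left_mono) auto
  finally show ?thesis .
qed

section \<open>Moments and derivatives of normalised matrix sums\<close>

context moment_class
begin

lemma monomial_integrable:
  assumes "n \<ge> 1" "a \<in> cls n" and H: "moment_bounded H" and h: "h \<in> H n"
  shows "integrable (M n) (\<lambda>w. monomial L (a w) * h (a w))"
proof -
  have "(\<lambda>x. monomial L x * h x) \<in> prod_fam (\<lambda>n. {monomial K | K. length K = length L}) H n"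
    by (rule prod_famI) (use h in auto)
  from moment_bounded_integrable[OF moment_bounded_prod[OF moment_bounded_monomial H] assms(1) this assms(2)]
  show ?thesis .
qed

text \<open>
  An entry that occurs only once in the monomial can be set to \<open>0\<close> in \<open>Q\<close> at no cost: the term with
  \<open>Q(x(e := 0))\<close> has mean zero.
\<close>

lemma expectation_monomial:
  assumes n: "n \<ge> 1" and a: "a \<in> cls n" and H: "moment_bounded H" and Q: "Q \<in> H n"
    and S: "distinct S" "set S \<subseteq> Ed" "\<And>e. e \<in> set S \<Longrightarrow> count_list L e = 1"
  shows "(\<integral>w. monomial L (a w) * Q (a w) \<partial>M n) = (\<integral>w. monomial L (a w) * diff_op S Q (a w) \<partial>M n)"
  using S
proof (induction S)
  case Nil then show ?case by simp
next
  case (Cons e S)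
  have "count_list L e = 1" "e \<in> Ed" using Cons.prems by auto
  then have "e \<in> set L" by (metis count_notin zero_neq_one)
  then obtain L1 L2 where L: "L = L1 @ e # L2" "e \<notin> set L1" by (meson split_list_first)
  then have e2: "e \<notin> set L2" using \<open>count_list L e = 1\<close> by (simp add: count_list_0_iff)
  \<comment> \<open>The monomial without its only factor \<open>x e\<close>. Neither this nor
    \<open>D (x(e := 0))\<close> involves the coordinate e, so their product is an admissible test
    function in \<open>centred\<close>.\<close>
  define K where "K = L1 @ L2"
  have eK: "e \<notin> set K" using L e2 by (simp add: K_def)
  have mon: "monomial L x = x e * monomial K x" for x
    by (simp add: L K_def monomial_def)
  define D where "D = diff_op S Q"
  let ?D = "\<lambda>n. {diff_op T h | T h. length T = length S \<and> h \<in> H n}"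
  let ?Sh = "\<lambda>n. {\<lambda>x. h (x(e := 0)) | h e. h \<in> ?D n}"
  let ?mon = "\<lambda>k n. {monomial L | L. length L = k}"
  have D: "D \<in> ?D n" using Q by (auto simp: D_def)
  have D0: "(\<lambda>x. D (x(e := 0))) \<in> ?Sh n" using D by blast
  have mb: "moment_bounded ?D" "moment_bounded ?Sh"
    using moment_bounded_diff_op[OF H] moment_bounded_shift by blast+
  have int1: "integrable (M n) (\<lambda>w. monomial L (a w) * D (a w))"
    by (rule monomial_integrable[OF n a mb(1)], rule D)
  have int2: "integrable (M n) (\<lambda>w. monomial L (a w) * D ((a w)(e := 0)))"
    by (rule monomial_integrable[OF n a mb(2)], rule D0)
  have int3: "integrable (M n) (\<lambda>w. monomial K (a w) * D ((a w)(e := 0)))"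
    by (rule monomial_integrable[OF n a mb(2)], rule D0)
  have "(\<integral>w. a w e * (monomial K (a w) * D ((a w)(e := 0))) \<partial>M n) = 0"
  proof (rule centred[OF n a \<open>e \<in> Ed\<close>, where \<phi> = "\<lambda>x. monomial K x * D (x(e := 0))"])
    have "continuous_on UNIV (monomial K)"
      by (rule moment_bounded_cont[OF moment_bounded_monomial[of "length K"] n]) auto
    then show "continuous_on UNIV (\<lambda>x. monomial K x * D (x(e := 0)))"
      using moment_bounded_cont[OF mb(2) n D0] by (intro continuous_on_mult)
    show "monomial K (x(e := t)) * D (x(e := t, e := 0)) = monomial K x * D (x(e := 0))" for x t
      using eK by (simp add: monomial_upd)
    show "integrable (M n) (\<lambda>w. a w e * (monomial K (a w) * D ((a w)(e := 0))))"
      using int2 by (simp add: mon mult.assoc)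
  qed (rule int3)
  then have "(\<integral>w. monomial L (a w) * D ((a w)(e := 0)) \<partial>M n) = 0"
    by (simp add: mon mult.assoc)
  then have "(\<integral>w. monomial L (a w) * D (a w) \<partial>M n) = (\<integral>w. monomial L (a w) * diff_op (e # S) Q (a w) \<partial>M n)"
    using int1 int2 by (simp add: D_def right_diff_distrib)
  then show ?case using Cons by (simp add: D_def)
qed

text \<open>After \<open>expectation_monomial\<close> the factor Q becomes a difference of size
  n^(-s/2), where s is the length of S. Its normalised second moment and that of the monomial bound
  the expectation by AM-GM. All orders of tameness are assumed since s ranges up to k.\<close>

lemma expectation_monomial_le:
  assumes H: "\<And>m. tame m H"
  obtains \<Gamma> where "\<Gamma> \<ge> 0" "\<And>n Q a L S. n \<ge> 1 \<Longrightarrow> Q \<in> H n \<Longrightarrow> a \<in> cls n \<Longrightarrow> length L = k \<Longrightarrow> distinct S \<Longrightarrow>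
     set S \<subseteq> Ed \<Longrightarrow> \<forall>e\<in>set S. count_list L e = 1 \<Longrightarrow>
     \<bar>\<integral>w. monomial L (a w) * Q (a w) \<partial>M n\<bar> \<le> \<Gamma> / sqrt (real n) ^ length S"
proof -
  have mb: "moment_bounded H" using H[of 0] by simp
  obtain c where c: "c \<ge> 0" and cm: "\<And>n h a. n \<ge> 1 \<Longrightarrow> h \<in> {monomial L | L. length L = k} \<Longrightarrow> a \<in> cls n \<Longrightarrow>
      (\<integral>\<^sup>+w. ennreal (h (a w) ^ (2 * 1)) \<partial>M n) \<le> ennreal c"
    by (rule moment_boundedE[OF moment_bounded_monomial[of k], of 1]) (assumption | rule that)+
  have c2: "(\<integral>\<^sup>+w. ennreal (monomial L (a w) ^ (2 * 1)) \<partial>M n) \<le> ennreal c"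
    if "n \<ge> 1" "length L = k" "a \<in> cls n" for n L a
    by (rule cm[OF that(1) _ that(3)]) (use that(2) in blast)
  let ?P = "\<lambda>r \<Gamma>. \<Gamma> \<ge> 0 \<and> (\<forall>n\<ge>1. \<forall>h\<in>H n. \<forall>a\<in>cls n. \<forall>S. length S = r \<and> distinct S \<and> set S \<subseteq> Ed \<longrightarrow>
    (\<integral>\<^sup>+w. ennreal ((sqrt (real n) ^ r * diff_op S h (a w)) ^ (2 * 1)) \<partial>M n) \<le> ennreal \<Gamma>)"
  have "\<exists>g. \<forall>r. ?P r (g r)"
  proof (rule choice, rule allI)
    fix r
    show "\<exists>\<Gamma>. ?P r \<Gamma>" by (rule diff_op_moment[OF H, of r 1])
  qed
  then obtain g where gP: "\<And>r. ?P r (g r)" by blast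
  have g1: "g r \<ge> (0 :: real)" for r using gP[of r] by (rule conjunct1)
  have g2: "(\<integral>\<^sup>+w. ennreal ((sqrt (real n) ^ length S * diff_op S h (a w)) ^ (2 * 1)) \<partial>M n) \<le> ennreal (g (length S))"
    if "n \<ge> 1" "h \<in> H n" "a \<in> cls n" "distinct S" "set S \<subseteq> Ed" for n h a S
    using conjunct2[OF gP[of "length S"]] that by blast
  \<comment> \<open>The members of S occur in L, so S has length at most k; adding the constants for
    all r up to k gives one that serves every S.\<close>
  define \<Gamma> where "\<Gamma> = c + (\<Sum>r\<le>k. g r)"
  show thesis
  proof (rule that[of \<Gamma>])
    show "\<Gamma> \<ge> 0" using c g1 by (simp add: \<Gamma>_def sum_nonneg)
    fix n :: nat and Q a and L S :: "'i list"
    assume n: "n \<ge> 1" and Q: "Q \<in> H n" and a: "a \<in> cls n" and L: "length L = k"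
      and S: "distinct S" "set S \<subseteq> Ed" "\<forall>e\<in>set S. count_list L e = 1"
    define q where "q = sqrt (real n) ^ length S"
    have q: "q > 0" using n by (simp add: q_def)
    have "set S \<subseteq> set L" using S(3) by (metis count_notin subsetI zero_neq_one)
    then have "card (set S) \<le> card (set L)" by (intro card_mono) auto
    then have lS: "length S \<le> k" using distinct_card[OF S(1)] card_length[of L] L by linarith
    have cL: "continuous_on UNIV (monomial L)"
      by (rule moment_bounded_cont[OF moment_bounded_monomial[of "length L"] n]) auto
    have cd: "continuous_on UNIV (\<lambda>x. q * diff_op S Q x)"
      by (intro continuous_intros continuous_on_diff_op moment_bounded_cont[OF mb n Q])
    let ?D = "\<lambda>n. {diff_op T h | T h. length T = length S \<and> h \<in> H n}"
    have int: "integrable (M n) (\<lambda>w. monomial L (a w) * diff_op S Q (a w))"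
      by (rule monomial_integrable[OF n a moment_bounded_diff_op[OF mb, of "length S"]]) (use Q in blast)
    have "ennreal \<bar>q * (\<integral>w. monomial L (a w) * diff_op S Q (a w) \<partial>M n)\<bar>
       = ennreal (norm (\<integral>w. q * (monomial L (a w) * diff_op S Q (a w)) \<partial>M n))" by simp
    also have "\<dots> \<le> (\<integral>\<^sup>+w. norm (q * (monomial L (a w) * diff_op S Q (a w))) \<partial>M n)"
      by (rule integral_norm_bound_ennreal) (use int in auto)
    also have "\<dots> \<le> (\<integral>\<^sup>+w. ennreal (monomial L (a w) ^ (2 * 1)) \<partial>M n) + (\<integral>\<^sup>+w. ennreal ((q * diff_op S Q (a w)) ^ (2 * 1)) \<partial>M n)"
    proof (rule nn_integral_add_le[OF n])
      fix w
      have "0 \<le> (\<bar>monomial L (a w)\<bar> - \<bar>q * diff_op S Q (a w)\<bar>)\<^sup>2" by simp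
      then have "2 * (\<bar>monomial L (a w)\<bar> * \<bar>q * diff_op S Q (a w)\<bar>) \<le> (monomial L (a w))\<^sup>2 + (q * diff_op S Q (a w))\<^sup>2"
        by (simp add: power2_diff)
      moreover have "norm (q * (monomial L (a w) * diff_op S Q (a w))) = \<bar>monomial L (a w)\<bar> * \<bar>q * diff_op S Q (a w)\<bar>"
        by (simp add: abs_mult)
      moreover have "0 \<le> \<bar>monomial L (a w)\<bar> * \<bar>q * diff_op S Q (a w)\<bar>" by simp
      ultimately show "norm (q * (monomial L (a w) * diff_op S Q (a w))) \<le> monomial L (a w) ^ (2 * 1) + (q * diff_op S Q (a w)) ^ (2 * 1)"
        unfolding mult_1_right by linarith
      show "(\<lambda>w. monomial L (a w) ^ (2 * 1)) \<in> borel_measurable (M n)"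
        by (intro borel_measurable_power measurable_compose_cls[OF n a cL])
      show "(\<lambda>w. (q * diff_op S Q (a w)) ^ (2 * 1)) \<in> borel_measurable (M n)"
        by (intro borel_measurable_power measurable_compose_cls[OF n a cd])
    qed auto
    also have "\<dots> \<le> ennreal c + ennreal (g (length S))"
      unfolding q_def by (intro add_mono c2[OF n L a] g2[OF n Q a S(1,2)])
    also have "\<dots> \<le> ennreal \<Gamma>"
    proof -
      have "g (length S) \<le> (\<Sum>r\<le>k. g r)" using lS g1 by (intro member_le_sum) auto
      then show ?thesis using c g1 by (simp add: \<Gamma>_def ennreal_leI flip: ennreal_plus)
    qed
    finally have "\<bar>q * (\<integral>w. monomial L (a w) * diff_op S Q (a w) \<partial>M n)\<bar> \<le> \<Gamma>"
      using \<open>\<Gamma> \<ge> 0\<close> by (simp add: ennreal_le_iff)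
    then have "\<bar>\<integral>w. monomial L (a w) * diff_op S Q (a w) \<partial>M n\<bar> \<le> \<Gamma> / q"
      using q by (simp add: abs_mult field_simps)
    then show "\<bar>\<integral>w. monomial L (a w) * Q (a w) \<partial>M n\<bar> \<le> \<Gamma> / sqrt (real n) ^ length S"
      using expectation_monomial[OF n a mb Q S(1,2)] S(3) by (simp add: q_def)
  qed
qed

text \<open>\<open>\<phi>\<close> lists the coordinates of one row of the matrix. Injectivity makes
  an index that occurs once into an entry that occurs once, and lets a derivative hit at most one of
  the factors \<open>x (\<phi> j)\<close>.\<close>

definition mat_fam :: "'i fam \<Rightarrow> 'i fam" where
  "mat_fam G n = {\<lambda>x. (\<Sum>j=1..n. x (\<phi> j) * g j x) / sqrt (real n) | \<phi> g.
     inj_on \<phi> {1..n} \<and> \<phi> ` {1..n} \<subseteq> Ed \<and> (\<forall>j\<in>{1..n}. g j \<in> G n)}"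

text \<open>Even for moments without derivatives all orders of tameness of G enter: the product of
  2N factors g is differenced once for every single of the list.\<close>

lemma moment_bounded_mat:
  assumes G: "\<And>m. tame m G"
  shows "moment_bounded (mat_fam G)"
  unfolding moment_bounded_def
proof (intro conjI allI impI ballI)
  fix n :: nat and f assume n: "n \<ge> 1" and "f \<in> mat_fam G n"
  then obtain \<phi> g where f: "f = (\<lambda>x. (\<Sum>j=1..n. x (\<phi> j) * g j x) / sqrt (real n))"
    and g: "\<And>j. j \<in> {1..n} \<Longrightarrow> g j \<in> G n"
    unfolding mat_fam_def by blast
  have cx: "continuous_on UNIV (\<lambda>x :: 'i \<Rightarrow> real. x i)" for i by (rule continuous_on_product_coordinates)
  show "continuous_on UNIV f"
    unfolding f using n
    by (intro continuous_on_divide continuous_on_sum continuous_on_mult cx continuous_on_const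
        moment_bounded_cont[OF tame_imp_moment_bounded[OF G] n g]) auto
next
  fix N
  let ?P = "power_fam (2 * N) G"
  have P: "\<And>m. tame m ?P" using tame_power[OF G] .
  obtain \<Gamma> where \<Gamma>: "\<Gamma> \<ge> 0" "\<And>n Q a L S. n \<ge> 1 \<Longrightarrow> Q \<in> ?P n \<Longrightarrow> a \<in> cls n \<Longrightarrow> length L = 2 * N \<Longrightarrow> distinct S \<Longrightarrow>
     set S \<subseteq> Ed \<Longrightarrow> \<forall>e\<in>set S. count_list L e = 1 \<Longrightarrow>
     \<bar>\<integral>w. monomial L (a w) * Q (a w) \<partial>M n\<bar> \<le> \<Gamma> / sqrt (real n) ^ length S"
    by (rule expectation_monomial_le[OF P, of "2 * N"]) (assumption | rule that)+
  show "\<exists>\<Gamma>. \<forall>n\<ge>1. \<forall>h\<in>mat_fam G n. \<forall>a\<in>cls n. (\<integral>\<^sup>+w. ennreal (h (a w) ^ (2 * N)) \<partial>M n) \<le> ennreal \<Gamma>"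
  proof (intro exI[of _ "\<Gamma> * fact (2 * N)"] allI impI ballI)
    fix n :: nat and f a assume n: "n \<ge> 1" and "f \<in> mat_fam G n" and a: "a \<in> cls n"
    then obtain \<phi> g where f: "f = (\<lambda>x. (\<Sum>j=1..n. x (\<phi> j) * g j x) / sqrt (real n))"
      and \<phi>: "inj_on \<phi> {1..n}" "\<phi> ` {1..n} \<subseteq> Ed"
      and g: "\<And>j. j \<in> {1..n} \<Longrightarrow> g j \<in> G n"
      unfolding mat_fam_def by blast
    let ?q = "sqrt (real n)"
    let ?L = "{xs. set xs \<subseteq> {1..n} \<and> length xs = 2 * N}"
    have finL: "finite ?L" by (rule finite_lists_length_eq) simp
    define Q where "Q xs x = prod_list (map (\<lambda>h. h x) (map g xs))" for xs x
    have Q: "Q xs \<in> ?P n" if "xs \<in> ?L" for xs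
    proof -
      have "set (map g xs) \<subseteq> G n" using that g by auto
      then have "(\<lambda>x. prod_list (map (\<lambda>h. h x) (map g xs))) \<in> power_fam (length (map g xs)) G n"
        by (rule power_famI)
      then show ?thesis using that by (simp add: Q_def[abs_def])
    qed
    have ex: "f x ^ (2 * N) = (\<Sum>xs\<in>?L. monomial (map \<phi> xs) x * Q xs x) / ?q ^ (2 * N)" for x
    proof -
      have "prod_list (map (\<lambda>j. x (\<phi> j) * g j x) xs) = monomial (map \<phi> xs) x * Q xs x" for xs
        by (induction xs) (auto simp: monomial_def Q_def)
      then show ?thesis unfolding f power_divide sum_list_power[OF finite_atLeastAtMost] by simp
    qed
    have int: "integrable (M n) (\<lambda>w. monomial (map \<phi> xs) (a w) * Q xs (a w))" if "xs \<in> ?L" for xs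
      by (rule monomial_integrable[OF n a tame_imp_moment_bounded[OF P] Q[OF that]])
    have bd: "(\<integral>w. monomial (map \<phi> xs) (a w) * Q xs (a w) \<partial>M n) \<le> \<Gamma> / ?q ^ length (singles xs)" if xs: "xs \<in> ?L" for xs
    proof -
      let ?S = "map \<phi> (singles xs)"
      have sub: "set (singles xs) \<subseteq> {1..n}" using singles_props(2)[of xs] xs by auto
      have "\<bar>\<integral>w. monomial (map \<phi> xs) (a w) * Q xs (a w) \<partial>M n\<bar> \<le> \<Gamma> / ?q ^ length ?S"
      proof (rule \<Gamma>(2)[OF n Q[OF xs] a])
        show "length (map \<phi> xs) = 2 * N" using xs by simp
        show "distinct ?S" using singles_props(1) inj_on_subset[OF \<phi>(1) sub] by (simp add: distinct_map)
        show "set ?S \<subseteq> Ed" using sub \<phi>(2) by auto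
        show "\<forall>e\<in>set ?S. count_list (map \<phi> xs) e = 1"
        proof
        fix e assume "e \<in> set ?S"
        then obtain j where j: "e = \<phi> j" "j \<in> set xs" "count_list xs j = 1"
          using singles_props(2)[of xs] by auto
        have "inj_on \<phi> (set xs)" using inj_on_subset[OF \<phi>(1)] xs by auto
        then have "count_list (map \<phi> xs) (\<phi> j) = count_list xs j"
          using j(2) by (rule count_list_inj_map)
        then show "count_list (map \<phi> xs) e = 1" using j by simp
        qed
      qed
      then show ?thesis by simp
    qed
    have intf: "integrable (M n) (\<lambda>w. f (a w) ^ (2 * N))"
      unfolding ex using int by (intro integrable_divide_zero integrable_sum) auto
    have "(\<integral>w. f (a w) ^ (2 * N) \<partial>M n) = (\<Sum>xs\<in>?L. \<integral>w. monomial (map \<phi> xs) (a w) * Q xs (a w) \<partial>M n) / ?q ^ (2 * N)"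
      unfolding ex using int by (simp add: Bochner_Integration.integral_sum)
    also have "\<dots> \<le> (\<Sum>xs\<in>?L. \<Gamma> / ?q ^ length (singles xs)) / ?q ^ (2 * N)"
      by (intro divide_right_mono sum_mono bd) auto
    also have "\<dots> = \<Gamma> * (\<Sum>xs\<in>?L. 1 / ?q ^ length (singles xs)) / ?q ^ (2 * N)"
      by (simp add: sum_distrib_left)
    \<comment> \<open>The sum over lists grows at most like n^N, exactly what the 2N factors 1 /
      sqrt n compensate.\<close>
    also have "\<dots> \<le> \<Gamma> * (?q ^ (2 * N) * fact (2 * N)) / ?q ^ (2 * N)"
      by (intro divide_right_mono mult_left_mono sum_singles_le n \<Gamma>(1)) auto
    also have "\<dots> = \<Gamma> * fact (2 * N)" using n by simp
    finally have "(\<integral>w. f (a w) ^ (2 * N) \<partial>M n) \<le> \<Gamma> * fact (2 * N)" .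
    moreover have "(\<integral>\<^sup>+w. ennreal (f (a w) ^ (2 * N)) \<partial>M n) = ennreal (\<integral>w. f (a w) ^ (2 * N) \<partial>M n)"
      by (rule nn_integral_eq_integral[OF intf]) (auto simp: power_mult)
    ultimately show "(\<integral>\<^sup>+w. ennreal (f (a w) ^ (2 * N)) \<partial>M n) \<le> ennreal (\<Gamma> * fact (2 * N))"
      by (simp add: ennreal_leI)
  qed
qed

lemma mat_deriv:
  assumes G: "coord_diff G" and n: "n \<ge> 1" and g: "\<And>j. j \<in> {1..n} \<Longrightarrow> g j \<in> G n" and e: "e \<in> Ed"
  shows "((\<lambda>t. (\<Sum>j=1..n. (x(e := t)) (\<phi> j) * g j (x(e := t))) / sqrt (real n)) has_real_derivative
     (\<Sum>j=1..n. (if \<phi> j = e then g j x else 0) + x (\<phi> j) * coord_deriv e (g j) x) / sqrt (real n)) (at (x e))"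
proof (intro DERIV_cdivide DERIV_sum)
  fix j assume j: "j \<in> {1..n}"
  have "((\<lambda>t. (x(e := t)) (\<phi> j)) has_real_derivative (if \<phi> j = e then 1 else 0)) (at (x e))"
    by (cases "\<phi> j = e") auto
  from DERIV_mult[OF this coord_diffD[OF G n g[OF j] e, of x "x e"]]
  show "((\<lambda>t. (x(e := t)) (\<phi> j) * g j (x(e := t))) has_real_derivative
     (if \<phi> j = e then g j x else 0) + x (\<phi> j) * coord_deriv e (g j) x) (at (x e))"
    by (simp add: mult.commute split: if_splits)
qed

lemma tame_mat: "(\<And>m. tame m G) \<Longrightarrow> tame m (mat_fam G)"
proof (induction m arbitrary: G)
  case 0 then show ?case using moment_bounded_mat by auto
next
  case (Suc m)
  have d: "coord_diff G" using Suc.prems[of 1] by simp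
  have dG: "tame m (deriv_fam G)" for m using Suc.prems[of "Suc m"] by simp
  \<comment> \<open>The zero function stands for the case that the entry e is none of the
    \<open>\<phi> j\<close>.\<close>
  let ?U = "\<lambda>n. mat_fam (deriv_fam G) n \<union> (G n \<union> {\<lambda>x. 0})"
  have "tame m (lin_comb 2 ?U)"
    using tame_lin_comb[OF _ tame_Un[OF Suc.IH[OF dG] tame_Un[OF Suc.prems tame_const]]] by simp
  then have "tame m (deriv_fam (mat_fam G))"
  proof (rule tame_mono)
    fix n :: nat assume n: "n \<ge> 1"
    show "deriv_fam (mat_fam G) n \<subseteq> lin_comb 2 ?U n"
    proof
      fix f assume "f \<in> deriv_fam (mat_fam G) n"
      then obtain e h where f: "f = (\<lambda>x. sqrt (real n) * coord_deriv e h x)" and e: "e \<in> Ed" and "h \<in> mat_fam G n"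
        unfolding deriv_fam_def by blast
      then obtain \<phi> g where h: "h = (\<lambda>x. (\<Sum>j=1..n. x (\<phi> j) * g j x) / sqrt (real n))"
        and \<phi>: "inj_on \<phi> {1..n}" "\<phi> ` {1..n} \<subseteq> Ed"
        and g: "\<And>j. j \<in> {1..n} \<Longrightarrow> g j \<in> G n"
        unfolding mat_fam_def by blast
      \<comment> \<open>In \<open>f1\<close> the derivative falls on the g j and its factor sqrt n
        is absorbed into \<open>deriv_fam G\<close>. In \<open>f2\<close> it falls on
        \<open>x (\<phi> j)\<close>; there sqrt n cancels the normalisation of the sum.\<close>
      define f1 where "f1 = (\<lambda>x. (\<Sum>j=1..n. x (\<phi> j) * (sqrt (real n) * coord_deriv e (g j) x)) / sqrt (real n))"
      define f2 where "f2 = (\<lambda>x. \<Sum>j=1..n. if \<phi> j = e then g j x else 0)"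
      have "(\<lambda>x. sqrt (real n) * coord_deriv e (g j) x) \<in> deriv_fam G n" if "j \<in> {1..n}" for j
        using e g[OF that] by (rule deriv_famI)
      then have "f1 \<in> mat_fam (deriv_fam G) n"
        unfolding f1_def mat_fam_def using \<phi>
        by (intro CollectI exI[of _ \<phi>] exI[of _ "\<lambda>j x. sqrt (real n) * coord_deriv e (g j) x"]) auto
      moreover have "f2 \<in> G n \<union> {\<lambda>x. 0}"
      proof (cases "\<exists>j\<in>{1..n}. \<phi> j = e")
        case True
        then obtain i where i: "i \<in> {1..n}" "\<phi> i = e" by blast
        have "(\<phi> j = e) = (j = i)" if "j \<in> {1..n}" for j
          using inj_on_eq_iff[OF \<phi>(1) that i(1)] i(2) by simp
        then have "f2 = (\<lambda>x. \<Sum>j=1..n. if j = i then g j x else 0)"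
          unfolding f2_def by (intro ext sum.cong[OF refl]) simp
        also have "\<dots> = g i" using i(1) by (simp add: sum.delta)
        finally show ?thesis using g[OF i(1)] by simp
      next
        case False
        then have "f2 = (\<lambda>x. 0)" unfolding f2_def by (intro ext sum.neutral ballI if_not_P) blast
        then show ?thesis by simp
      qed
      moreover have "f = (\<lambda>x. f1 x + f2 x)"
      proof
        fix x
        have "coord_deriv e h x = (\<Sum>j=1..n. (if \<phi> j = e then g j x else 0) + x (\<phi> j) * coord_deriv e (g j) x) / sqrt (real n)"
          unfolding h by (rule coord_deriv_eqI, rule mat_deriv[OF d n g e])
        moreover have "f1 x = (\<Sum>j=1..n. x (\<phi> j) * coord_deriv e (g j) x)"
          unfolding f1_def using n by (simp add: sum_divide_distrib)
        ultimately show "f x = f1 x + f2 x" unfolding f f2_def using n by (simp add: sum.distrib)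
      qed
      moreover have "(\<lambda>x. f1 x + f2 x) \<in> lin_comb 2 ?U n" if "f1 \<in> mat_fam (deriv_fam G) n" "f2 \<in> G n \<union> {\<lambda>x. 0}"
        by (rule lin_comb_add) (use that in auto)
      ultimately show "f \<in> lin_comb 2 ?U n" by simp
    qed
  qed
  moreover have "coord_diff (mat_fam G)"
  proof (rule coord_diffI)
    fix n :: nat and h e x assume n: "n \<ge> 1" and "h \<in> mat_fam G n" and e: "e \<in> Ed"
    then obtain \<phi> g where h: "h = (\<lambda>x. (\<Sum>j=1..n. x (\<phi> j) * g j x) / sqrt (real n))"
      and g: "\<And>j. j \<in> {1..n} \<Longrightarrow> g j \<in> G n"
      unfolding mat_fam_def by blast
    show "\<exists>D. ((\<lambda>t. h (x(e := t))) has_real_derivative D) (at (x e))"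
      unfolding h by (rule exI, rule mat_deriv[OF d n g e])
  qed
  ultimately show ?case using Suc.prems moment_bounded_mat by auto
qed

end

section \<open>The AMP orbit as a tame family\<close>

text \<open>
  All data are packed into one point \<open>z\<close>: \<open>z (0, i, 0)\<close> is the entry \<open>i\<close> of the initial vector,
  \<open>z (1, i, j)\<close> an entry of \<open>Z\<close>, and \<open>z (2, i, j)\<close> with \<open>i \<le> j\<close> an upper triangular entry of \<open>X\<close>.
  In these coordinates the entry derivatives are ordinary partial derivatives.
\<close>

abbreviation entry_coords :: "(nat \<times> nat \<times> nat) set" where
  "entry_coords \<equiv> {c. fst c = 2}"

definition amp_point ::
    "(nat \<Rightarrow> (nat \<Rightarrow> real) \<Rightarrow> real) \<Rightarrow> nat \<Rightarrow> nat \<Rightarrow> nat \<Rightarrow> (nat \<times> nat \<times> nat \<Rightarrow> real) \<Rightarrow> real" where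
  "amp_point F n k i z =
     amp F n (\<lambda>i. z (0, i, 0)) (\<lambda>i j. z (1, i, j)) k (\<lambda>a b. z (2, min a b, max a b)) i"

definition hat_point ::
    "(nat \<Rightarrow> (nat \<Rightarrow> real) \<Rightarrow> real) \<Rightarrow> nat \<Rightarrow> nat \<Rightarrow> nat \<Rightarrow> (nat \<times> nat \<times> nat \<Rightarrow> real) \<Rightarrow> real" where
  "hat_point F n k i z =
     mat_vec n (hat_mat n (\<lambda>i j. z (1, i, j)) (\<lambda>a b. z (2, min a b, max a b)))
       (amp F n (\<lambda>i. z (0, i, 0)) (\<lambda>i j. z (1, i, j)) k (\<lambda>a b. z (2, min a b, max a b))) i"

definition amp_fam :: "(nat \<Rightarrow> (nat \<Rightarrow> real) \<Rightarrow> real) \<Rightarrow> nat \<Rightarrow> (nat \<times> nat \<times> nat) fam" where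
  "amp_fam F k n = {amp_point F n k i | i. i \<in> {1..n}}"

definition hat_fam :: "(nat \<Rightarrow> (nat \<Rightarrow> real) \<Rightarrow> real) \<Rightarrow> nat \<Rightarrow> (nat \<times> nat \<times> nat) fam" where
  "hat_fam F k n = {hat_point F n k i | i. i \<in> {1..n}}"

context moment_class
begin

text \<open>Unfolds \<open>tame\<close> into plain iterated derivatives. The factor c collects the
  powers of sqrt n that \<open>deriv_fam\<close> inserts between successive derivatives; without it
  the induction would not apply to the derivative of h. Continuity is recorded for
  measurability.\<close>

lemma tame_imp_fold_deriv_moment:
  assumes "tame m H"
  shows "\<exists>\<Gamma>\<ge>0. \<forall>n\<ge>1. \<forall>h c es. (\<lambda>x. c * h x) \<in> H n \<and> c \<noteq> 0 \<and> length es = m \<and> set es \<subseteq> Ed \<longrightarrow>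
    continuous_on UNIV (fold coord_deriv es h) \<and> (\<forall>a\<in>cls n. (\<integral>\<^sup>+w. ennreal ((sqrt (real n) ^ m * c * fold coord_deriv es h (a w)) ^ (2 * N)) \<partial>M n) \<le> ennreal \<Gamma>)"
  using assms
proof (induction m arbitrary: H)
  case 0
  then have mb: "moment_bounded H" by simp
  obtain k where k: "k \<ge> 0" "\<And>n h a. n \<ge> 1 \<Longrightarrow> h \<in> H n \<Longrightarrow> a \<in> cls n \<Longrightarrow>
      (\<integral>\<^sup>+w. ennreal (h (a w) ^ (2 * N)) \<partial>M n) \<le> ennreal k"
    using moment_boundedE[OF mb, of N] by metis
  show ?case
  proof (intro exI[of _ k] conjI k(1) allI impI ballI)
    fix n :: nat and h c and es :: "'i list"
    assume n: "1 \<le> n" and A: "(\<lambda>x. c * h x) \<in> H n \<and> c \<noteq> 0 \<and> length es = 0 \<and> set es \<subseteq> Ed"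
    have es: "es = []" using A by simp
    have "continuous_on UNIV (\<lambda>x. inverse c * (c * h x))"
      by (rule continuous_on_mult[OF continuous_on_const moment_bounded_cont[OF mb n conjunct1[OF A]]])
    moreover have "(\<lambda>x. inverse c * (c * h x)) = h" using A by (simp add: fun_eq_iff)
    ultimately show "continuous_on UNIV (fold coord_deriv es h)" by (simp only: es fold_simps)
    fix a assume a: "a \<in> cls n"
    show "(\<integral>\<^sup>+w. ennreal ((sqrt (real n) ^ 0 * c * fold coord_deriv es h (a w)) ^ (2 * N)) \<partial>M n) \<le> ennreal k"
      using k(2)[OF n conjunct1[OF A] a] es by simp
  qed
next
  case (Suc m)
  have d: "coord_diff H" and t: "tame m (deriv_fam H)" using Suc.prems by auto
  obtain \<Gamma> where \<Gamma>: "\<Gamma> \<ge> 0" and le: "\<forall>n\<ge>1. \<forall>h c es. (\<lambda>x. c * h x) \<in> deriv_fam H n \<and> c \<noteq> 0 \<and> length es = m \<and> set es \<subseteq> Ed \<longrightarrow>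
    continuous_on UNIV (fold coord_deriv es h) \<and> (\<forall>a\<in>cls n. (\<integral>\<^sup>+w. ennreal ((sqrt (real n) ^ m * c * fold coord_deriv es h (a w)) ^ (2 * N)) \<partial>M n) \<le> ennreal \<Gamma>)"
    using Suc.IH[OF t] by blast
  show ?case
  proof (intro exI[of _ \<Gamma>] conjI \<Gamma> allI impI ballI)
    fix n :: nat and h c and es :: "'i list"
    assume n: "1 \<le> n" and A: "(\<lambda>x. c * h x) \<in> H n \<and> c \<noteq> 0 \<and> length es = Suc m \<and> set es \<subseteq> Ed"
    then obtain e fs where es: "es = e # fs" "length fs = m" "e \<in> Ed" "set fs \<subseteq> Ed" by (cases es) auto
    have ch: "(\<lambda>x. c * h x) \<in> H n" and c: "c \<noteq> 0" using A by auto
    \<comment> \<open>Differentiability is known only for the scaled function, which lies in the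
      family; dividing by c transfers it to h.\<close>
    have "coord_deriv e (\<lambda>x. c * h x) x = c * coord_deriv e h x" for x
    proof -
      have D: "((\<lambda>t. c * h (x(e := t))) has_real_derivative coord_deriv e (\<lambda>x. c * h x) x) (at (x e))"
        using coord_diffD[OF d n ch es(3), of x "x e"] by simp
      from DERIV_cmult[OF D, of "inverse c"] c
      have "((\<lambda>t. h (x(e := t))) has_real_derivative inverse c * coord_deriv e (\<lambda>x. c * h x) x) (at (x e))"
        by (simp add: mult.assoc[symmetric])
      from coord_deriv_eqI[OF this] show ?thesis using c by simp
    qed
    then have "(\<lambda>x. (sqrt (real n) * c) * coord_deriv e h x) \<in> deriv_fam H n"
      using deriv_famI[of e "\<lambda>x. c * h x" H n] es(3) ch by (simp add: mult.assoc)
    moreover have "sqrt (real n) * c \<noteq> 0" using n c by simp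
    ultimately have IH: "continuous_on UNIV (fold coord_deriv fs (coord_deriv e h)) \<and> (\<forall>a\<in>cls n. (\<integral>\<^sup>+w. ennreal ((sqrt (real n) ^ m * (sqrt (real n) * c) * fold coord_deriv fs (coord_deriv e h) (a w)) ^ (2 * N)) \<partial>M n) \<le> ennreal \<Gamma>)"
      using le n es by blast
    then show "continuous_on UNIV (fold coord_deriv es h)" by (simp add: es)
    fix a assume "a \<in> cls n"
    then show "(\<integral>\<^sup>+w. ennreal ((sqrt (real n) ^ Suc m * c * fold coord_deriv es h (a w)) ^ (2 * N)) \<partial>M n) \<le> ennreal \<Gamma>"
      using IH by (simp add: es ac_simps)
  qed
qed

end

locale amp_class = moment_class M entry_coords cls
  for M :: "nat \<Rightarrow> 'a measure" and cls +
  fixes F :: "nat \<Rightarrow> (nat \<Rightarrow> real) \<Rightarrow> real"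
  assumes smooth: "C_infinity (k + 1) (F k)" and bounded: "bounded_partials (k + 1) (F k)"
begin

lemma hat_point_eq:
  "hat_point F n k i z = (\<Sum>j=1..n. z (2, min i j, max i j) * amp_point F n k j z) / sqrt (real n)
     + (\<Sum>j\<in>{1..n}. 1 / real n * (z (1, i, j) * amp_point F n k j z))"
  by (simp add: hat_point_def mat_vec_def hat_mat_def amp_point_def sum.distrib[symmetric]
      sum_divide_distrib distrib_right)

text \<open>The two parts of the matrix are treated differently: X / sqrt n relies on cancellation
  and falls under \<open>mat_fam\<close>, while Z / n gives an average with weights 1/n, controlled
  by convexity and the moments of Z alone.\<close>

lemma tame_hat:
  assumes "\<And>m. tame m (amp_fam F k)"
  shows "tame m (hat_fam F k)"
proof -
  let ?P = "prod_fam (\<lambda>n. {\<lambda>x. x e | e. e \<notin> entry_coords}) (amp_fam F k)"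
  let ?U = "\<lambda>n. mat_fam (amp_fam F k) n \<union> lin_comb 1 ?P n"
  have "tame m (lin_comb 2 ?U)"
    using tame_lin_comb[OF _ tame_Un[OF tame_mat[OF assms] tame_lin_comb[OF _ tame_prod[OF tame_fixed_coords assms]]]]
    by simp
  then show ?thesis
  proof (rule tame_mono)
    fix n :: nat assume n: "n \<ge> 1"
    show "hat_fam F k n \<subseteq> lin_comb 2 ?U n"
    proof
      fix f assume "f \<in> hat_fam F k n"
      then obtain i where i: "i \<in> {1..n}" and f: "f = hat_point F n k i" by (auto simp: hat_fam_def)
      define f1 where "f1 z = (\<Sum>j=1..n. z (2, min i j, max i j) * amp_point F n k j z) / sqrt (real n)" for z
      define f2 where "f2 z = (\<Sum>j\<in>{1..n}. 1 / real n * (z (1, i, j) * amp_point F n k j z))" for z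
      have am: "amp_point F n k j \<in> amp_fam F k n" if "j \<in> {1..n}" for j
        using that by (auto simp: amp_fam_def)
      have "inj_on (\<lambda>j. (2 :: nat, min i j, max i j)) {1..n}"
        by (rule inj_onI) (auto simp: min_def max_def split: if_splits)
      then have "f1 \<in> mat_fam (amp_fam F k) n"
        unfolding f1_def[abs_def] mat_fam_def using am
        by (intro CollectI exI[of _ "\<lambda>j. (2, min i j, max i j)"] exI[of _ "amp_point F n k"]) auto
      moreover have "f2 \<in> lin_comb 1 ?P n"
      proof -
        have "(\<lambda>z. z (1, i, j) * amp_point F n k j z) \<in> ?P n" if "j \<in> {1..n}" for j
          by (rule prod_famI[where G = "\<lambda>n. {\<lambda>x. x e | e. e \<notin> entry_coords}"])
            (rule CollectI, rule exI[of _ "(1, i, j)"], use am[OF that] in auto)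
        then show ?thesis
          unfolding f2_def[abs_def] lin_comb_def using n
          by (intro CollectI exI[of _ "{1..n}"] exI[of _ "\<lambda>_. 1 / real n"] exI[of _ "\<lambda>j z. z (1, i, j) * amp_point F n k j z"]) auto
      qed
      moreover have "f = (\<lambda>z. f1 z + f2 z)"
        by (simp add: f f1_def f2_def hat_point_eq fun_eq_iff)
      moreover have "(\<lambda>z. f1 z + f2 z) \<in> lin_comb 2 ?U n" if "f1 \<in> mat_fam (amp_fam F k) n" "f2 \<in> lin_comb 1 ?P n"
        by (rule lin_comb_add) (use that in auto)
      ultimately show "f \<in> lin_comb 2 ?U n" by simp
    qed
  qed
qed

text \<open>Strong induction, because F_l also receives the older iterates; m stays arbitrary,
  because \<open>tame_hat\<close> uses all orders for the preceding iterate.\<close>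

lemma tame_amp: "tame m (amp_fam F k)"
proof (induction k arbitrary: m rule: less_induct)
  case (less k)
  show ?case
  proof (cases k)
    case 0
    have "amp_fam F 0 n \<subseteq> {\<lambda>x. x e | e. e \<notin> entry_coords}" for n
      by (force simp: amp_fam_def amp_point_def)
    then show ?thesis unfolding 0 by (intro tame_mono[OF tame_fixed_coords])
  next
    case (Suc l)
    let ?H = "\<lambda>n. hat_fam F l n \<union> (\<Union>j<Suc l. amp_fam F j n)"
    have "tame m ?H"
    proof (rule tame_Un)
      show "tame m (hat_fam F l)" by (rule tame_hat, rule less.IH) (simp add: Suc)
      show "tame m (\<lambda>n. \<Union>j<Suc l. amp_fam F j n)"
        by (rule tame_UN_lt, rule less.IH) (simp add: Suc)
    qed
    then have "tame m (comp_fam (l + 1) (F l) ?H)" by (rule tame_comp[OF smooth bounded])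
    then show ?thesis
    proof (rule tame_mono)
      fix n :: nat
      show "amp_fam F k n \<subseteq> comp_fam (l + 1) (F l) ?H n"
      proof
        fix f assume "f \<in> amp_fam F k n"
        then obtain i where i: "i \<in> {1..n}" and f: "f = amp_point F n k i" by (auto simp: amp_fam_def)
        define h where "h j = (if j = 0 then hat_point F n l i else amp_point F n (l - j) i)" for j :: nat
        have "h j \<in> ?H n" if j: "j < l + 1" for j
        proof (cases "j = 0")
          case True
          then have "h j \<in> hat_fam F l n" using i by (auto simp: h_def hat_fam_def)
          then show ?thesis by simp
        next
          case False
          then have "h j \<in> amp_fam F (l - j) n" using i by (auto simp: h_def amp_fam_def)
          then show ?thesis by (intro UnI2 UN_I[of "l - j"]) auto
        qed
        then have "(\<lambda>z. F l (\<lambda>j. if j < l + 1 then h j z else 0)) \<in> comp_fam (l + 1) (F l) ?H n"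
          by (rule comp_famI)
        moreover have "f = (\<lambda>z. F l (\<lambda>j. if j < l + 1 then h j z else 0))"
        proof
          fix z
          have "(\<lambda>j. if j = 0 then hat_point F n l i z else if j \<le> l then amp_point F n (l - j) i z else 0)
             = (\<lambda>j. if j < l + 1 then h j z else 0)"
            by (auto simp: h_def fun_eq_iff)
          then show "f z = F l (\<lambda>j. if j < l + 1 then h j z else 0)"
            by (simp only: f Suc amp_point_def hat_point_def amp.simps)
        qed
        ultimately show "f \<in> comp_fam (l + 1) (F l) ?H n" by simp
      qed
    qed
  qed
qed

end

section \<open>Random points with bounded moments and centred entries\<close>

text \<open>The axioms of \<open>moment_class\<close> other than \<open>scale\<close>, turned into a
  set with the moment constants fixed in advance. The constants depend on neither n nor the
  coordinate, which gives uniformity in n and in the law.\<close>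

definition centred_class ::
    "(nat \<Rightarrow> 'a measure) \<Rightarrow> 'i set \<Rightarrow> (nat \<Rightarrow> real) \<Rightarrow> nat \<Rightarrow> ('a \<Rightarrow> 'i::countable \<Rightarrow> real) set" where
  "centred_class M Ed c n = {a \<in> borel_measurable (M n).
     (\<forall>N e. (\<integral>\<^sup>+w. ennreal ((a w e) ^ (2 * N)) \<partial>M n) \<le> ennreal (c N)) \<and>
     (\<forall>e\<in>Ed. \<forall>\<phi>. continuous_on UNIV \<phi> \<and> (\<forall>x t. \<phi> (x(e := t)) = \<phi> x) \<and>
        integrable (M n) (\<lambda>w. \<phi> (a w)) \<and> integrable (M n) (\<lambda>w. a w e * \<phi> (a w)) \<longrightarrow>
        (\<integral>w. a w e * \<phi> (a w) \<partial>M n) = (0 :: real))}"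

text \<open>The point is closure under scaling the coordinate e. To test centring at f = e, the test
  function ignores e and the factor t comes out of the integral. For another f, the test function
  composed with the scaling still ignores f, so the centring of the original point applies to
  it.\<close>

lemma moment_class_centred_class:
  fixes Ed :: "'i::countable set"
  assumes pr: "\<And>n. n \<ge> 1 \<Longrightarrow> prob_space (M n)"
  shows "moment_class M Ed (centred_class M Ed c)"
proof (rule moment_class.intro)
  show "prob_space (M n)" if "1 \<le> n" for n using that by (rule pr)
  show "a \<in> borel_measurable (M n)" if "1 \<le> n" "a \<in> centred_class M Ed c n" for n a
    using that by (simp add: centred_class_def)
  show "\<exists>d. \<forall>n\<ge>1. \<forall>a\<in>centred_class M Ed c n. \<forall>e. (\<integral>\<^sup>+w. ennreal (a w e ^ (2 * N)) \<partial>M n) \<le> ennreal d" for N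
    by (intro exI[of _ "c N"]) (simp add: centred_class_def)
  show "(\<integral>w. a w e * \<phi> (a w) \<partial>M n) = 0"
    if "1 \<le> n" "a \<in> centred_class M Ed c n" "e \<in> Ed" "continuous_on UNIV \<phi>" "\<And>x t. \<phi> (x(e := t)) = \<phi> x"
      "integrable (M n) (\<lambda>w. \<phi> (a w))" "integrable (M n) (\<lambda>w. a w e * \<phi> (a w))" for n a e \<phi>
    using that unfolding centred_class_def by blast
next
  fix n :: nat and a t and e :: 'i
  assume n: "1 \<le> n" and a: "a \<in> centred_class M Ed c n" and t: "0 \<le> t" "(t :: real) \<le> 1"
  have am: "a \<in> borel_measurable (M n)" and mo: "\<And>N e. (\<integral>\<^sup>+w. ennreal ((a w e) ^ (2 * N)) \<partial>M n) \<le> ennreal (c N)"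
    and ce: "\<And>e \<phi>. e \<in> Ed \<Longrightarrow> continuous_on UNIV \<phi> \<Longrightarrow> (\<And>x t. \<phi> (x(e := t)) = \<phi> x) \<Longrightarrow>
        integrable (M n) (\<lambda>w. \<phi> (a w)) \<Longrightarrow> integrable (M n) (\<lambda>w. a w e * \<phi> (a w)) \<Longrightarrow>
        (\<integral>w. a w e * \<phi> (a w) \<partial>M n) = 0"
    using a unfolding centred_class_def by blast+
  define s where "s = (\<lambda>x :: 'i \<Rightarrow> real. x(e := t * x e))"
  have sc: "continuous_on UNIV s"
    unfolding s_def
    by (intro continuous_on_fun_upd continuous_on_id continuous_on_mult continuous_on_const continuous_on_product_coordinates)
  have "(\<lambda>w. s (a w)) \<in> centred_class M Ed c n"
    unfolding centred_class_def
  proof (intro CollectI conjI allI ballI impI)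
    show "(\<lambda>w. s (a w)) \<in> borel_measurable (M n)"
      using measurable_compose[OF am borel_measurable_continuous_onI[OF sc]] .
    fix N f
    have "(\<integral>\<^sup>+w. ennreal (s (a w) f ^ (2 * N)) \<partial>M n) \<le> (\<integral>\<^sup>+w. ennreal ((a w f) ^ (2 * N)) \<partial>M n)"
    proof (intro nn_integral_mono ennreal_leI)
      fix w
      have "t ^ (2 * N) * (a w e) ^ (2 * N) \<le> 1 * (a w e) ^ (2 * N)"
        using t by (intro mult_right_mono power_le_one) (auto simp: power_mult)
      then show "s (a w) f ^ (2 * N) \<le> a w f ^ (2 * N)" by (simp add: s_def power_mult_distrib)
    qed
    also have "\<dots> \<le> ennreal (c N)" by (rule mo)
    finally show "(\<integral>\<^sup>+w. ennreal (s (a w) f ^ (2 * N)) \<partial>M n) \<le> ennreal (c N)" .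
  next
    fix f and \<phi> :: "('i \<Rightarrow> real) \<Rightarrow> real"
    assume f: "f \<in> Ed" and "continuous_on UNIV \<phi> \<and> (\<forall>x t. \<phi> (x(f := t)) = \<phi> x) \<and>
        integrable (M n) (\<lambda>w. \<phi> (s (a w))) \<and> integrable (M n) (\<lambda>w. s (a w) f * \<phi> (s (a w)))"
    then have \<phi>: "continuous_on UNIV \<phi>" "\<And>x t. \<phi> (x(f := t)) = \<phi> x"
      "integrable (M n) (\<lambda>w. \<phi> (s (a w)))" "integrable (M n) (\<lambda>w. s (a w) f * \<phi> (s (a w)))" by auto
    show "(\<integral>w. s (a w) f * \<phi> (s (a w)) \<partial>M n) = 0"
    proof (cases "f = e")
      case True
      have se: "s x e = t * x e" for x by (simp add: s_def)
      have ps: "\<phi> (s x) = \<phi> x" for x using \<phi>(2)[of x] by (simp add: s_def True)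
      show ?thesis
      proof (cases "t = 0")
        case False
        have "integrable (M n) (\<lambda>w. inverse t * (s (a w) f * \<phi> (s (a w))))"
          using \<phi>(4) by (rule integrable_mult_right)
        then have "integrable (M n) (\<lambda>w. a w e * \<phi> (a w))"
          using False by (simp add: se True ps mult.assoc[symmetric])
        then have "(\<integral>w. a w e * \<phi> (a w) \<partial>M n) = 0"
          using ce[of e \<phi>] f \<phi> True by (simp add: ps)
        then show ?thesis by (simp add: ps se True mult.assoc)
      qed (simp add: se True)
    next
      case False
      have c2: "continuous_on UNIV (\<lambda>x. \<phi> (s x))"
        using continuous_on_compose2[OF \<phi>(1) sc] by blast
      have up: "\<phi> (s (x(f := u))) = \<phi> (s x)" for x u
      proof -
        have "s (x(f := u)) = (s x)(f := u)" using False by (auto simp: s_def)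
        then show ?thesis using \<phi>(2) by simp
      qed
      have sf: "s x f = x f" for x using False by (simp add: s_def)
      show ?thesis using ce[OF f c2 up \<phi>(3)] \<phi>(4) by (simp add: sf)
    qed
  qed
  then show "(\<lambda>w. (a w)(e := t * a w e)) \<in> centred_class M Ed c n" by (simp add: s_def)
qed

lemma (in prob_space) indep_set_commute: "indep_set A B \<Longrightarrow> indep_set B A"
  unfolding indep_sets2_eq by (metis Int_commute mult.commute)

text \<open>
  Fubini over the law of \<open>W\<close>: for a fixed value \<open>y\<close> of \<open>W\<close> the two factors are independent and
  the first one is centred.
\<close>

lemma (in prob_space) integral_centred_eq_0:
  fixes X W :: "'a \<Rightarrow> 't::second_countable_topology" and v :: "'t \<Rightarrow> real"
  assumes ind: "indep_var borel W borel X"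
    and v: "v \<in> borel_measurable borel" and \<psi>: "(\<lambda>z. \<psi> (snd z) (fst z)) \<in> borel_measurable borel"
    and ind2: "\<And>y. indep_var borel (\<lambda>w. v (X w)) borel (\<lambda>w. \<psi> (X w) y)"
    and vi: "integrable M (\<lambda>w. v (X w))" "(\<integral>w. v (X w) \<partial>M) = 0"
    and \<psi>i: "integrable M (\<lambda>w. \<psi> (X w) (W w))"
    and int: "integrable M (\<lambda>w. v (X w) * \<psi> (X w) (W w))"
  shows "(\<integral>w. v (X w) * \<psi> (X w) (W w) \<partial>M) = 0"
proof -
  have X: "X \<in> borel_measurable M" and W: "W \<in> borel_measurable M"
    and D: "distr M borel W \<Otimes>\<^sub>M distr M borel X = distr M (borel \<Otimes>\<^sub>M borel) (\<lambda>w. (W w, X w))"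
    using ind unfolding indep_var_distribution_eq by auto
  interpret DX: prob_space "distr M borel X" by (rule prob_space_distr[OF X])
  interpret DW: prob_space "distr M borel W" by (rule prob_space_distr[OF W])
  interpret PP: pair_sigma_finite "distr M borel W" "distr M borel X" ..
  have pm: "(\<lambda>w. (W w, X w)) \<in> M \<rightarrow>\<^sub>M borel \<Otimes>\<^sub>M borel" using X W by auto
  have \<psi>m: "(\<lambda>z. \<psi> (snd z) (fst z)) \<in> borel_measurable (borel \<Otimes>\<^sub>M borel)" using \<psi> by (simp add: borel_prod)
  have vm: "(\<lambda>z. v (snd z)) \<in> borel_measurable (borel \<Otimes>\<^sub>M borel)"
    by (rule measurable_compose[OF measurable_snd v])
  define f where "f = (\<lambda>z. v (snd z) * \<psi> (snd z) (fst z))"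
  have fm: "f \<in> borel_measurable (borel \<Otimes>\<^sub>M borel)" unfolding f_def by (intro borel_measurable_times vm \<psi>m)
  have fi: "integrable (distr M borel W \<Otimes>\<^sub>M distr M borel X) f"
    unfolding D using integrable_distr_eq[OF pm fm] int by (simp add: f_def)
  have pi: "integrable (distr M borel W \<Otimes>\<^sub>M distr M borel X) (\<lambda>z. \<psi> (snd z) (fst z))"
    unfolding D using integrable_distr_eq[OF pm \<psi>m] \<psi>i by simp
  \<comment> \<open>Only for almost every y does Fubini provide integrability of the section of
    \<open>\<psi>\<close>, which the product rule for independent variables requires.\<close>
  have "AE y in distr M borel W. (\<integral>x. f (y, x) \<partial>distr M borel X) = 0"
    using PP.AE_integrable_fst'[OF pi]
  proof eventually_elim
    case (elim y)
    have m1: "(\<lambda>x. \<psi> x y) \<in> borel_measurable borel"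
      using measurable_compose[OF measurable_Pair1'[of y borel borel] \<psi>m] by simp
    have "integrable M (\<lambda>w. \<psi> (X w) y)" using elim integrable_distr_eq[OF X m1] by simp
    from indep_var_lebesgue_integral[OF ind2 vi(1) this] vi(2)
    have "(\<integral>w. v (X w) * \<psi> (X w) y \<partial>M) = 0" by simp
    moreover have "(\<integral>x. f (y, x) \<partial>distr M borel X) = (\<integral>w. v (X w) * \<psi> (X w) y \<partial>M)"
      unfolding f_def using integral_distr[OF X borel_measurable_times[OF v m1]] by simp
    ultimately show ?case by simp
  qed
  then have "(\<integral>y. (\<integral>x. f (y, x) \<partial>distr M borel X) \<partial>distr M borel W) = 0"
    by (rule integral_eq_zero_AE)
  then have "integral\<^sup>L (distr M borel W \<Otimes>\<^sub>M distr M borel X) f = 0"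
    using PP.integral_fst'[OF fi] by simp
  then show ?thesis unfolding D using integral_distr[OF pm fm] by (simp add: f_def)
qed

lemma power_le_fact_exp:
  fixes x :: real
  assumes "x \<ge> 0"
  shows "x ^ k \<le> fact k * exp x"
proof -
  have "(\<Sum>i\<in>{k}. x ^ i /\<^sub>R fact i) \<le> (\<Sum>i. x ^ i /\<^sub>R fact i)"
    by (rule sum_le_suminf[OF summable_exp_generic]) (use assms in auto)
  then have "x ^ k / fact k \<le> exp x" by (simp add: exp_def divide_inverse mult.commute)
  then show ?thesis by (simp add: field_simps)
qed

text \<open>From |x|^p <= 1 + x^(2N) at x = q f. Since p and 1 + \<Gamma> are at least 1, the root
  (1 + \<Gamma>)^(1/p) is at most 1 + \<Gamma>. In the application q is sqrt(n)^m, the normalisation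
  of m derivatives.\<close>

lemma Lp_norm_le:
  assumes "prob_space M" and f: "f \<in> borel_measurable M" and p: "1 \<le> p" "p \<le> real (2 * N)"
    and q: "q > 0" and \<Gamma>: "\<Gamma> \<ge> 0"
    and le: "(\<integral>\<^sup>+w. ennreal ((q * f w) ^ (2 * N)) \<partial>M) \<le> ennreal \<Gamma>"
  shows "Lp_norm M p f \<le> ennreal ((1 + \<Gamma>) / q)"
proof -
  interpret prob_space M by fact
  have pw: "\<bar>f w\<bar> powr p \<le> q powr (- p) * (1 + (q * f w) ^ (2 * N))" for w
  proof -
    have nn: "0 \<le> (q * f w) ^ (2 * N)" by (simp add: power_mult)
    have "\<bar>q * f w\<bar> powr p \<le> 1 + (q * f w) ^ (2 * N)"
    proof (cases "\<bar>q * f w\<bar> \<le> 1")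
      case True
      then have "\<bar>q * f w\<bar> powr p \<le> 1" using p by (intro powr_le1) auto
      then show ?thesis using nn by linarith
    next
      case False
      then have "\<bar>q * f w\<bar> powr p \<le> \<bar>q * f w\<bar> powr real (2 * N)" using p by (intro powr_mono) auto
      also have "\<dots> = \<bar>q * f w\<bar> ^ (2 * N)" using False by (intro powr_realpow) auto
      also have "\<dots> = (q * f w) ^ (2 * N)" by (simp add: power_even_abs)
      finally show ?thesis by simp
    qed
    moreover have "\<bar>f w\<bar> powr p = q powr (- p) * \<bar>q * f w\<bar> powr p"
      using q by (simp add: abs_mult powr_mult powr_minus)
    ultimately show ?thesis by (simp add: mult_left_mono)
  qed
  define I where "I = (\<integral>\<^sup>+w. ennreal (\<bar>f w\<bar> powr p) \<partial>M)"
  have "I \<le> (\<integral>\<^sup>+w. ennreal (q powr (- p)) * (ennreal 1 + ennreal ((q * f w) ^ (2 * N))) \<partial>M)"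
    unfolding I_def
  proof (rule nn_integral_mono)
    fix w
    have "ennreal (\<bar>f w\<bar> powr p) \<le> ennreal (q powr (- p) * (1 + (q * f w) ^ (2 * N)))"
      using pw by (rule ennreal_leI)
    also have "\<dots> = ennreal (q powr (- p)) * (ennreal 1 + ennreal ((q * f w) ^ (2 * N)))"
      by (subst ennreal_mult) (auto simp: power_mult)
    finally show "ennreal (\<bar>f w\<bar> powr p) \<le> \<dots>" .
  qed
  also have "\<dots> = ennreal (q powr (- p)) * (1 + (\<integral>\<^sup>+w. ennreal ((q * f w) ^ (2 * N)) \<partial>M))"
    using f by (simp add: nn_integral_cmult nn_integral_add emeasure_space_1)
  also have "\<dots> \<le> ennreal (q powr (- p)) * (1 + ennreal \<Gamma>)"
    by (intro mult_left_mono add_left_mono le) auto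
  also have "\<dots> = ennreal (q powr (- p) * (1 + \<Gamma>))"
    using \<Gamma> by (simp add: ennreal_mult)
  finally have I: "I \<le> ennreal (q powr (- p) * (1 + \<Gamma>))" .
  then have fin: "I \<noteq> \<infinity>" by (auto simp: top_unique)
  have "enn2real I powr (1 / p) \<le> (q powr (- p) * (1 + \<Gamma>)) powr (1 / p)"
    using p \<Gamma> enn2real_leI[OF _ I] by (intro powr_mono2) auto
  also have "\<dots> = (1 + \<Gamma>) powr (1 / p) / q"
  proof -
    have "(q powr (- p)) powr (1 / p) = q powr (- 1)" using p by (simp add: powr_powr)
    then show ?thesis using q \<Gamma> by (simp add: powr_mult powr_minus divide_inverse)
  qed
  also have "\<dots> \<le> (1 + \<Gamma>) powr 1 / q"
    using q p \<Gamma> by (intro divide_right_mono powr_mono) auto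
  also have "\<dots> = (1 + \<Gamma>) / q" using \<Gamma> by simp
  finally show ?thesis using fin by (simp add: Lp_norm_def I_def[symmetric] Let_def ennreal_leI)
qed

section \<open>Packing the data and transferring the derivatives\<close>

text \<open>Coordinates that do not belong to the data are 0: the given functions are unrestricted
  outside the index range, whereas every coordinate must be measurable with bounded moments.\<close>

definition data_point ::
    "nat \<Rightarrow> (nat \<Rightarrow> real) \<Rightarrow> (nat \<Rightarrow> nat \<Rightarrow> real) \<Rightarrow> (nat \<Rightarrow> nat \<Rightarrow> real) \<Rightarrow> nat \<times> nat \<times> nat \<Rightarrow> real" where
  "data_point n u Z X = (\<lambda>(c, i, j).
     if c = 0 \<and> i \<in> {1..n} \<and> j = 0 then u i
     else if c = 1 \<and> i \<in> {1..n} \<and> j \<in> {1..n} then Z i j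
     else if c = 2 \<and> (i, j) \<in> upper_idx n then X i j
     else 0)"

text \<open>A relation, because the matrix X is arbitrary outside the index range. The point
  \<open>z\<close> fixes the initial vector and Z, so only entries of the matrix vary along the
  derivatives.\<close>

definition represents ::
    "nat \<Rightarrow> (nat \<times> nat \<times> nat \<Rightarrow> real) \<Rightarrow> (nat \<Rightarrow> nat \<Rightarrow> real) \<Rightarrow> (nat \<times> nat \<times> nat \<Rightarrow> real) \<Rightarrow> bool" where
  "represents n z X y \<longleftrightarrow> (\<forall>c. c \<notin> entry_coords \<longrightarrow> y c = z c) \<and>
     (\<forall>a\<in>{1..n}. \<forall>b\<in>{1..n}. X a b = y (2, min a b, max a b))"

text \<open>An ordered pair e is its own pair of minimum and maximum, so the simultaneous update of
  both mirror entries is the update of one coordinate.\<close>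

lemma represents_set_entry:
  assumes "represents n z X y" "fst e < snd e"
  shows "represents n z (set_entry e t X) (y((2, e) := t))"
proof -
  have "((a, b) = e \<or> (b, a) = e) = ((2 :: nat, min a b, max a b) = (2, e))" for a b
    using assms(2) by (cases e) (auto simp: min_def max_def)
  then show ?thesis using assms(1) unfolding represents_def set_entry_def by auto
qed

text \<open>The hypothesis covers all related pairs X, y, not only the base point: this makes it
  pass to the first derivatives, so that the induction can continue.\<close>

lemma fold_entry_deriv_eq:
  assumes "\<And>X y. represents n z X y \<Longrightarrow> h X = g y"
    and "\<And>r. r \<in> set rs \<Longrightarrow> fst (e r) \<in> {1..n} \<and> snd (e r) \<in> {1..n} \<and> fst (e r) < snd (e r)"
    and "represents n z X y"
  shows "fold (\<lambda>r. entry_deriv (e r)) rs h X = fold coord_deriv (map (\<lambda>r. (2, e r)) rs) g y"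
  using assms
proof (induction rs arbitrary: h g)
  case (Cons r rs)
  have e: "fst (e r) \<in> {1..n}" "snd (e r) \<in> {1..n}" "fst (e r) < snd (e r)" using Cons.prems(2)[of r] by auto
  have "entry_deriv (e r) h X = coord_deriv (2, e r) g y" if R: "represents n z X y" for X y
  proof -
    have "X (fst (e r)) (snd (e r)) = y (2, min (fst (e r)) (snd (e r)), max (fst (e r)) (snd (e r)))"
      using R e unfolding represents_def by blast
    also have "\<dots> = y (2, e r)" using e(3) by (simp add: min_def max_def)
    finally have 1: "X (fst (e r)) (snd (e r)) = y (2, e r)" .
    have "h (set_entry (e r) t X) = g (y((2, e r) := t))" for t
      by (rule Cons.prems(1)[OF represents_set_entry[OF R e(3)]])
    then show ?thesis unfolding entry_deriv_def coord_deriv_def 1 by simp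
  qed
  then have "fold (\<lambda>r. entry_deriv (e r)) rs (entry_deriv (e r) h) X
      = fold coord_deriv (map (\<lambda>r. (2, e r)) rs) (coord_deriv (2, e r) g) y"
    by (rule Cons.IH) (use Cons.prems in auto)
  then show ?case by simp
qed simp

lemma mat_vec_cong:
  assumes "\<And>j. j \<in> {1..n} \<Longrightarrow> X i j = Y i j" "\<And>j. j \<in> {1..n} \<Longrightarrow> v j = w j"
  shows "mat_vec n X v i = mat_vec n Y w i"
  unfolding mat_vec_def by (rule sum.cong) (use assms in auto)

lemma amp_cong:
  assumes u: "\<And>i. i \<in> {1..n} \<Longrightarrow> u i = u' i"
    and Z: "\<And>i j. i \<in> {1..n} \<Longrightarrow> j \<in> {1..n} \<Longrightarrow> Z i j = Z' i j"
    and X: "\<And>i j. i \<in> {1..n} \<Longrightarrow> j \<in> {1..n} \<Longrightarrow> X i j = X' i j"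
    and i: "i \<in> {1..n}"
  shows "amp F n u Z k X i = amp F n u' Z' k X' i"
  using i
proof (induction k arbitrary: i rule: less_induct)
  case (less k)
  show ?case
  proof (cases k)
    case 0 then show ?thesis using u less.prems by simp
  next
    case (Suc l)
    have "mat_vec n (hat_mat n Z X) (amp F n u Z l X) i = mat_vec n (hat_mat n Z' X') (amp F n u' Z' l X') i"
      by (rule mat_vec_cong) (use less Z X Suc in \<open>auto simp: hat_mat_def\<close>)
    moreover have "amp F n u Z (l - j) X i = amp F n u' Z' (l - j) X' i" for j
      using less Suc by simp
    ultimately show ?thesis by (simp only: Suc amp.simps)
  qed
qed

lemma data_point_cong:
  assumes "represents n (data_point n u Z A) X y"
  shows "\<And>i. i \<in> {1..n} \<Longrightarrow> u i = y (0, i, 0)"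
    "\<And>i j. i \<in> {1..n} \<Longrightarrow> j \<in> {1..n} \<Longrightarrow> Z i j = y (1, i, j)"
    "\<And>i j. i \<in> {1..n} \<Longrightarrow> j \<in> {1..n} \<Longrightarrow> X i j = y (2, min i j, max i j)"
  using assms by (auto simp: represents_def data_point_def)

lemma amp_eq_amp_point:
  assumes "represents n (data_point n u Z A) X y" "i \<in> {1..n}"
  shows "amp F n u Z k X i = amp_point F n k i y"
  unfolding amp_point_def by (rule amp_cong) (use data_point_cong[OF assms(1)] assms(2) in auto)

lemma hat_eq_hat_point:
  assumes "represents n (data_point n u Z A) X y" "i \<in> {1..n}"
  shows "mat_vec n (hat_mat n Z X) (amp F n u Z k X) i = hat_point F n k i y"
  unfolding hat_point_def
proof (rule mat_vec_cong)
  fix j assume j: "j \<in> {1..n}"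
  show "hat_mat n Z X i j = hat_mat n (\<lambda>i j. y (1, i, j)) (\<lambda>a b. y (2, min a b, max a b)) i j"
    using data_point_cong(2,3)[OF assms(1,2) j] by (simp add: hat_mat_def)
  show "amp F n u Z k X j = amp F n (\<lambda>i. y (0, i, 0)) (\<lambda>i j. y (1, i, j)) k (\<lambda>a b. y (2, min a b, max a b)) j"
    using amp_eq_amp_point[OF assms(1) j] by (simp add: amp_point_def)
qed

lemma represents_data_point:
  assumes "sym_on n A"
  shows "represents n (data_point n u Z A) A (data_point n u Z A)"
  using assms by (auto simp: represents_def data_point_def upper_idx_def sym_on_def min_def max_def)

text \<open>A variable that factors measurably through \<open>r\<close> generates a smaller
  sigma-algebra; independence of the raw data thereby passes to the packed points.\<close>

lemma gen_sigma_subset: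
  assumes "r \<in> space M \<rightarrow> space N" "f \<in> measurable N K" "\<And>w. w \<in> space M \<Longrightarrow> X w = f (r w)"
  shows "gen_sigma M X K \<subseteq> gen_sigma M r N"
  unfolding gen_sigma_def
proof (rule sigma_sets_mono')
  show "{X -` S \<inter> space M | S. S \<in> sets K} \<subseteq> {r -` S \<inter> space M | S. S \<in> sets N}"
  proof
    fix B assume "B \<in> {X -` S \<inter> space M | S. S \<in> sets K}"
    then obtain S where S: "S \<in> sets K" "B = X -` S \<inter> space M" by blast
    have "B = r -` (f -` S \<inter> space N) \<inter> space M" using S(2) assms(1,3) by auto
    moreover have "f -` S \<inter> space N \<in> sets N" using measurable_sets[OF assms(2) S(1)] .
    ultimately show "B \<in> {r -` S \<inter> space M | S. S \<in> sets N}" by blast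
  qed
qed

section \<open>Moments and centring of the packed data\<close>

text \<open>One term of the exponential series gives x^(2N) <= (2N)! exp |x| <= (2N)! (exp x + exp
  (-x)); the subgaussian bound is then used at l = 1 and l = -1 only.\<close>

lemma subgaussian_moment:
  assumes f: "f \<in> borel_measurable M" and s: "0 \<le> s" "s \<le> \<sigma>" "subgaussian M s f"
  shows "(\<integral>\<^sup>+w. ennreal (f w ^ (2 * N)) \<partial>M) \<le> ennreal (fact (2 * N) * (2 * exp (\<sigma>\<^sup>2 / 2)))"
proof -
  have b: "(\<integral>\<^sup>+w. ennreal (exp (l * f w)) \<partial>M) \<le> ennreal (exp (\<sigma>\<^sup>2 / 2))" if "l\<^sup>2 = 1" for l
  proof -
    have "(\<integral>\<^sup>+w. ennreal (exp (l * f w)) \<partial>M) \<le> ennreal (exp (l\<^sup>2 * s\<^sup>2 / 2))"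
      using s(3) by (simp add: subgaussian_def)
    also have "\<dots> \<le> ennreal (exp (\<sigma>\<^sup>2 / 2))"
      using that s by (intro ennreal_leI) (simp add: power_mono)
    finally show ?thesis .
  qed
  have "(\<integral>\<^sup>+w. ennreal (f w ^ (2 * N)) \<partial>M) \<le> (\<integral>\<^sup>+w. ennreal (fact (2 * N)) * (ennreal (exp (1 * f w)) + ennreal (exp ((- 1) * f w))) \<partial>M)"
  proof (rule nn_integral_mono)
    fix w
    have "f w ^ (2 * N) = \<bar>f w\<bar> ^ (2 * N)" by (simp add: power_even_abs)
    also have "\<dots> \<le> fact (2 * N) * exp \<bar>f w\<bar>" by (rule power_le_fact_exp) simp
    also have "\<dots> \<le> fact (2 * N) * (exp (1 * f w) + exp ((- 1) * f w))"
      by (intro mult_left_mono) (auto simp: abs_if)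
    finally have "ennreal (f w ^ (2 * N)) \<le> ennreal (fact (2 * N) * (exp (1 * f w) + exp ((- 1) * f w)))"
      by (rule ennreal_leI)
    then show "ennreal (f w ^ (2 * N)) \<le> ennreal (fact (2 * N)) * (ennreal (exp (1 * f w)) + ennreal (exp ((- 1) * f w)))"
      by (simp add: ennreal_mult)
  qed
  also have "\<dots> = ennreal (fact (2 * N)) * ((\<integral>\<^sup>+w. ennreal (exp (1 * f w)) \<partial>M) + (\<integral>\<^sup>+w. ennreal (exp ((- 1) * f w)) \<partial>M))"
    using f by (subst nn_integral_cmult, simp, subst nn_integral_add) auto
  also have "\<dots> \<le> ennreal (fact (2 * N)) * (ennreal (exp (\<sigma>\<^sup>2 / 2)) + ennreal (exp (\<sigma>\<^sup>2 / 2)))"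
    by (intro mult_left_mono add_mono b) auto
  also have "\<dots> = ennreal (fact (2 * N) * (2 * exp (\<sigma>\<^sup>2 / 2)))"
    by (subst ennreal_mult) (auto simp flip: ennreal_plus)
  finally show ?thesis .
qed

text \<open>The same term of the exponential series, taken at |f| / \<sigma>.\<close>

lemma exponential_moment:
  assumes "\<sigma> > 0" and f: "f \<in> borel_measurable M"
    and b: "(\<integral>\<^sup>+w. ennreal (exp (\<bar>f w\<bar> / \<sigma>)) \<partial>M) \<le> ennreal C"
  shows "(\<integral>\<^sup>+w. ennreal (f w ^ (2 * N)) \<partial>M) \<le> ennreal (fact (2 * N) * \<sigma> ^ (2 * N) * \<bar>C\<bar>)"
proof -
  have "(\<integral>\<^sup>+w. ennreal (f w ^ (2 * N)) \<partial>M) \<le> (\<integral>\<^sup>+w. ennreal (fact (2 * N) * \<sigma> ^ (2 * N)) * ennreal (exp (\<bar>f w\<bar> / \<sigma>)) \<partial>M)"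
  proof (rule nn_integral_mono)
    fix w
    have "f w ^ (2 * N) = \<sigma> ^ (2 * N) * (\<bar>f w\<bar> / \<sigma>) ^ (2 * N)"
      using assms(1) by (simp add: power_divide power_even_abs)
    also have "\<dots> \<le> \<sigma> ^ (2 * N) * (fact (2 * N) * exp (\<bar>f w\<bar> / \<sigma>))"
      using assms(1) by (intro mult_left_mono power_le_fact_exp) auto
    finally have "ennreal (f w ^ (2 * N)) \<le> ennreal ((fact (2 * N) * \<sigma> ^ (2 * N)) * exp (\<bar>f w\<bar> / \<sigma>))"
      by (intro ennreal_leI) (simp add: ac_simps)
    then show "ennreal (f w ^ (2 * N)) \<le> ennreal (fact (2 * N) * \<sigma> ^ (2 * N)) * ennreal (exp (\<bar>f w\<bar> / \<sigma>))"
      using assms(1) by (simp add: ennreal_mult)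
  qed
  also have "\<dots> = ennreal (fact (2 * N) * \<sigma> ^ (2 * N)) * (\<integral>\<^sup>+w. ennreal (exp (\<bar>f w\<bar> / \<sigma>)) \<partial>M)"
    using f by (intro nn_integral_cmult) auto
  also have "\<dots> \<le> ennreal (fact (2 * N) * \<sigma> ^ (2 * N)) * ennreal \<bar>C\<bar>"
    by (intro mult_left_mono order_trans[OF b] ennreal_leI) auto
  also have "\<dots> = ennreal (fact (2 * N) * \<sigma> ^ (2 * N) * \<bar>C\<bar>)"
    using assms(1) by (simp add: ennreal_mult)
  finally show ?thesis .
qed

text \<open>The first summand serves the entries of A, the second u and Z; the final 1 covers the
  coordinates that vanish identically, including 0^0 = 1 for N = 0.\<close>

definition moment_const :: "real \<Rightarrow> real \<Rightarrow> nat \<Rightarrow> real" where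
  "moment_const \<sigma> C N = fact (2 * N) * (2 * exp (\<sigma>\<^sup>2 / 2)) + fact (2 * N) * \<sigma> ^ (2 * N) * \<bar>C\<bar> + 1"

text \<open>Moments come from the exponential bounds. For centring, the law of the data (u, Z) is
  integrated last: with the data fixed, what remains besides the entry e is a function of the other
  upper triangular entries, which are independent of it.\<close>

lemma data_point_in_centred_class:
  fixes M :: "nat \<Rightarrow> 'a measure"
  assumes \<sigma>: "\<sigma> > 0" and P: "prob_space (M n)"
    and adm: "admissible_data \<sigma> C n (M n) u Z" and A: "A \<in> rand_mats \<sigma> n (M n) u Z"
  shows "(\<lambda>w. data_point n (u w) (Z w) (A w)) \<in> centred_class M entry_coords (moment_const \<sigma> C) n"
proof -
  interpret P: prob_space "M n" by (rule P)
  let ?M = "M n" and ?U = "upper_idx n" and ?S = "{1..n} \<times> {1..n}"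
  define a where "a = (\<lambda>w. data_point n (u w) (Z w) (A w))"
  have um: "(\<lambda>w. u w i) \<in> borel_measurable ?M" if "i \<in> {1..n}" for i
    using adm that unfolding admissible_data_def by blast
  have Zm: "(\<lambda>w. Z w i j) \<in> borel_measurable ?M" if "i \<in> {1..n}" "j \<in> {1..n}" for i j
    using adm that unfolding admissible_data_def by blast
  have iv: "P.indep_vars (\<lambda>_. borel) (\<lambda>(i, j) w. A w i j) ?U" using A unfolding rand_mats_def by blast
  have Am: "(\<lambda>w. A w i j) \<in> borel_measurable ?M" if "(i, j) \<in> ?U" for i j
    using iv that unfolding P.indep_vars_def by fastforce
  have A1: "integrable ?M (\<lambda>w. A w i j)" "(\<integral>w. A w i j \<partial>?M) = 0"
      "\<exists>s. 0 \<le> s \<and> s \<le> \<sigma> \<and> subgaussian ?M s (\<lambda>w. A w i j)" if "(i, j) \<in> ?U" for i j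
    using A that unfolding rand_mats_def by blast+
  have U: "(i, j) \<in> ?S" if "(i, j) \<in> ?U" for i j using that by (auto simp: upper_idx_def)
  have coord_m: "(\<lambda>w. a w e) \<in> borel_measurable ?M" for e
  proof -
    obtain c i j where e: "e = (c, i, j)" by (cases e) auto
    consider "c = 0 \<and> i \<in> {1..n} \<and> j = 0" | "c = 1 \<and> i \<in> {1..n} \<and> j \<in> {1..n}" | "c = 2 \<and> (i, j) \<in> ?U"
      | "\<not> (c = 0 \<and> i \<in> {1..n} \<and> j = 0) \<and> \<not> (c = 1 \<and> i \<in> {1..n} \<and> j \<in> {1..n}) \<and> \<not> (c = 2 \<and> (i, j) \<in> ?U)" by blast
    then show ?thesis
    proof cases
      case 1 then show ?thesis using um by (simp add: a_def e data_point_def)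
    next
      case 2 then show ?thesis using Zm by (simp add: a_def e data_point_def)
    next
      case 3 then show ?thesis using Am by (simp add: a_def e data_point_def)
    next
      case 4
      then have "(\<lambda>w. a w e) = (\<lambda>w. 0)" by (intro ext) (auto simp: a_def e data_point_def)
      then show ?thesis by simp
    qed
  qed
  then have am: "a \<in> borel_measurable ?M" by (rule measurable_coordinatewise_then_product)
  have mom: "(\<integral>\<^sup>+w. ennreal ((a w e) ^ (2 * N)) \<partial>?M) \<le> ennreal (moment_const \<sigma> C N)" for e N
  proof -
    have m0: "0 \<le> fact (2 * N) * (2 * exp (\<sigma>\<^sup>2 / 2))" "0 \<le> fact (2 * N) * \<sigma> ^ (2 * N) * \<bar>C\<bar>" using \<sigma> by auto
    have m1: "ennreal (fact (2 * N) * (2 * exp (\<sigma>\<^sup>2 / 2))) \<le> ennreal (moment_const \<sigma> C N)"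
      and m2: "ennreal (fact (2 * N) * \<sigma> ^ (2 * N) * \<bar>C\<bar>) \<le> ennreal (moment_const \<sigma> C N)"
      and m3: "1 \<le> ennreal (moment_const \<sigma> C N)"
      using m0 unfolding moment_const_def by (auto intro!: ennreal_leI simp flip: ennreal_1)
    obtain c i j where e: "e = (c, i, j)" by (cases e) auto
    consider "c = 0 \<and> i \<in> {1..n} \<and> j = 0" | "c = 1 \<and> i \<in> {1..n} \<and> j \<in> {1..n}" | "c = 2 \<and> (i, j) \<in> ?U"
      | "\<not> (c = 0 \<and> i \<in> {1..n} \<and> j = 0) \<and> \<not> (c = 1 \<and> i \<in> {1..n} \<and> j \<in> {1..n}) \<and> \<not> (c = 2 \<and> (i, j) \<in> ?U)" by blast
    then show ?thesis
    proof cases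
      case 1
      then have "(\<integral>\<^sup>+w. ennreal (exp (\<bar>u w i\<bar> / \<sigma>)) \<partial>?M) \<le> ennreal C" using adm unfolding admissible_data_def by blast
      from order_trans[OF exponential_moment[OF \<sigma> um this] m2]
      show ?thesis using 1 by (simp add: a_def e data_point_def)
    next
      case 2
      then have "(\<integral>\<^sup>+w. ennreal (exp (\<bar>Z w i j\<bar> / \<sigma>)) \<partial>?M) \<le> ennreal C" using adm unfolding admissible_data_def by blast
      from order_trans[OF exponential_moment[OF \<sigma> Zm this] m2]
      show ?thesis using 2 by (simp add: a_def e data_point_def)
    next
      case 3
      then obtain s where s: "0 \<le> s" "s \<le> \<sigma>" "subgaussian ?M s (\<lambda>w. A w i j)" using A1(3) by blast
      from order_trans[OF subgaussian_moment[OF Am s] m1]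
      show ?thesis using 3 by (simp add: a_def e data_point_def)
    next
      case 4
      then have "(\<lambda>w. a w e) = (\<lambda>w. 0)" by (intro ext) (auto simp: a_def e data_point_def)
      then have z: "a w e = 0" for w by metis
      have "(\<integral>\<^sup>+w. ennreal ((a w e) ^ (2 * N)) \<partial>?M) \<le> (\<integral>\<^sup>+w. 1 \<partial>?M)"
        by (intro nn_integral_mono) (simp add: z power_0_left)
      also have "\<dots> = 1" by (simp add: P.emeasure_space_1)
      finally show ?thesis using m3 by (rule order_trans)
    qed
  qed
  \<comment> \<open>The matrix part and the data part have disjoint supports; with both as functions
    on the same index type, \<open>indep_var\<close> becomes applicable.\<close>
  define pX where "pX = (\<lambda>w (c, i, j). if c = (2 :: nat) \<and> (i, j) \<in> ?U then A w i j else 0)"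
  define pW where "pW = (\<lambda>w (c, i, j). if c = (2 :: nat) then 0 else a w (c, i, j))"
  have split: "a w e = pX w e + pW w e" for w e
    by (cases e) (auto simp: a_def pX_def pW_def data_point_def)
  have ind: "P.indep_var borel pW borel pX"
  proof -
    let ?rA = "\<lambda>w. \<lambda>(i, j)\<in>?S. A w i j" and ?NA = "PiM ?S (\<lambda>_. borel) :: (nat \<times> nat \<Rightarrow> real) measure"
    let ?rW = "\<lambda>w. (\<lambda>i\<in>{1..n}. u w i, \<lambda>(i, j)\<in>?S. Z w i j)"
    let ?NW = "PiM {1..n} (\<lambda>_. borel) \<Otimes>\<^sub>M PiM ?S (\<lambda>_. borel) :: ((nat \<Rightarrow> real) \<times> (nat \<times> nat \<Rightarrow> real)) measure"
    have iset: "P.indep_set (gen_sigma ?M ?rA ?NA) (gen_sigma ?M ?rW ?NW)"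
      using A unfolding rand_mats_def indep_of_data_def by blast
    \<comment> \<open>\<open>fA\<close> and \<open>fW\<close> recover the packed parts from the
      restricted variables in \<open>indep_of_data\<close>.\<close>
    define fA where "fA = (\<lambda>y :: nat \<times> nat \<Rightarrow> real. \<lambda>(c, i, j). if c = (2 :: nat) \<and> (i, j) \<in> ?U then y (i, j) else 0)"
    define fW where "fW = (\<lambda>y :: (nat \<Rightarrow> real) \<times> (nat \<times> nat \<Rightarrow> real). \<lambda>(c, i, j).
        if c = (0 :: nat) \<and> i \<in> {1..n} \<and> j = (0 :: nat) then fst y i
        else if c = 1 \<and> i \<in> {1..n} \<and> j \<in> {1..n} then snd y (i, j) else 0)"
    have fA: "fA \<in> measurable ?NA borel"
    proof (rule measurable_coordinatewise_then_product)
      fix e :: "nat \<times> nat \<times> nat"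
      obtain c i j where e: "e = (c, i, j)" by (cases e) auto
      have "(\<lambda>y. y (i, j)) \<in> borel_measurable ?NA" if "(i, j) \<in> ?U"
        using U[OF that] by (rule measurable_component_singleton)
      then show "(\<lambda>y. fA y e) \<in> borel_measurable ?NA"
        by (cases "c = 2 \<and> (i, j) \<in> ?U") (auto simp: fA_def e)
    qed
    have fW: "fW \<in> measurable ?NW borel"
    proof (rule measurable_coordinatewise_then_product)
      fix e :: "nat \<times> nat \<times> nat"
      obtain c i j where e: "e = (c, i, j)" by (cases e) auto
      have m1: "(\<lambda>y. fst y i) \<in> borel_measurable ?NW" if "i \<in> {1..n}"
        by (rule measurable_compose[OF measurable_fst measurable_component_singleton[OF that]])
      have m2: "(\<lambda>y. snd y (i, j)) \<in> borel_measurable ?NW" if "(i, j) \<in> ?S"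
        by (rule measurable_compose[OF measurable_snd measurable_component_singleton[OF that]])
      consider "c = 0 \<and> i \<in> {1..n} \<and> j = 0" | "c = 1 \<and> i \<in> {1..n} \<and> j \<in> {1..n}"
        | "\<not> (c = 0 \<and> i \<in> {1..n} \<and> j = 0) \<and> \<not> (c = 1 \<and> i \<in> {1..n} \<and> j \<in> {1..n})" by blast
      then show "(\<lambda>y. fW y e) \<in> borel_measurable ?NW"
      proof cases
        case 1 then show ?thesis using m1 by (simp add: fW_def e)
      next
        case 2 then show ?thesis using m2 by (simp add: fW_def e)
      next
        case 3
        then have "(\<lambda>y. fW y e) = (\<lambda>y. 0)" by (auto simp add: fW_def e fun_eq_iff)
        then show ?thesis by simp
      qed
    qed
    have sA: "gen_sigma ?M pX borel \<subseteq> gen_sigma ?M ?rA ?NA"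
    proof (rule gen_sigma_subset[OF _ fA])
      show "?rA \<in> space ?M \<rightarrow> space ?NA" by (auto simp: space_PiM)
      show "pX w = fA (?rA w)" for w using U by (auto simp: pX_def fA_def fun_eq_iff)
    qed
    have sW: "gen_sigma ?M pW borel \<subseteq> gen_sigma ?M ?rW ?NW"
    proof (rule gen_sigma_subset[OF _ fW])
      show "?rW \<in> space ?M \<rightarrow> space ?NW" by (auto simp: space_PiM space_pair_measure)
      show "pW w = fW (?rW w)" for w by (auto simp: pW_def fW_def a_def data_point_def fun_eq_iff)
    qed
    have "P.indep_set (gen_sigma ?M pX borel) (gen_sigma ?M pW borel)"
      using iset sA sW unfolding P.indep_sets2_eq by blast
    from P.indep_set_commute[OF this]
    have "P.indep_set (gen_sigma ?M pW borel) (gen_sigma ?M pX borel)" .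
    moreover have "pX \<in> borel_measurable ?M"
    proof (rule measurable_coordinatewise_then_product)
      fix e :: "nat \<times> nat \<times> nat"
      obtain c i j where e: "e = (c, i, j)" by (cases e) auto
      show "(\<lambda>w. pX w e) \<in> borel_measurable ?M"
        using Am by (cases "c = 2 \<and> (i, j) \<in> ?U") (auto simp: pX_def e)
    qed
    moreover have "pW \<in> borel_measurable ?M"
    proof (rule measurable_coordinatewise_then_product)
      fix e :: "nat \<times> nat \<times> nat"
      obtain c i j where e: "e = (c, i, j)" by (cases e) auto
      show "(\<lambda>w. pW w e) \<in> borel_measurable ?M"
        using coord_m[of e] by (cases "c = 2") (auto simp: pW_def e)
    qed
    ultimately show ?thesis unfolding P.indep_var_eq gen_sigma_def by auto
  qed
  have cen: "(\<integral>w. a w e * \<phi> (a w) \<partial>?M) = 0"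
    if e: "e \<in> entry_coords" and \<phi>: "continuous_on UNIV \<phi>" "\<And>x t. \<phi> (x(e := t)) = \<phi> x"
      "integrable ?M (\<lambda>w. \<phi> (a w))" "integrable ?M (\<lambda>w. a w e * \<phi> (a w))" for e and \<phi> :: "(nat \<times> nat \<times> nat \<Rightarrow> real) \<Rightarrow> real"
  proof -
    obtain i j where eij: "e = (2, i, j)" using e by (cases e) auto
    show ?thesis
    proof (cases "(i, j) \<in> ?U")
      case False
      then have "a w e = 0" for w by (simp add: a_def data_point_def eij)
      then show ?thesis by simp
    next
      case True
      \<comment> \<open>The test function ignores the coordinate e, so e may be set to 0 in its
        first argument. This removes the entry at e from the matrix part and prepares independence
        of the two factors.\<close>
      define \<psi> where "\<psi> = (\<lambda>x y :: nat \<times> nat \<times> nat \<Rightarrow> real. \<phi> (\<lambda>f. (x(e := 0)) f + y f))"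
      have \<psi>a: "\<phi> (a w) = \<psi> (pX w) (pW w)" for w
      proof -
        have "(\<lambda>f. ((pX w)(e := 0)) f + pW w f) = (a w)(e := 0)"
          by (rule ext) (auto simp: split, simp add: pW_def eij)
        then show ?thesis unfolding \<psi>_def using \<phi>(2) by simp
      qed
      have ae: "a w e = pX w e" for w by (simp add: split pW_def eij)
      have cx: "continuous_on UNIV (\<lambda>x :: nat \<times> nat \<times> nat \<Rightarrow> real. x f)" for f
        by (rule continuous_on_product_coordinates)
      have "continuous_on UNIV (\<lambda>z. \<lambda>f. ((snd z)(e := 0)) f + fst z f :: real)"
      proof (rule continuous_on_coordinatewise_then_product)
        fix f :: "nat \<times> nat \<times> nat"
        have c1: "continuous_on UNIV (\<lambda>z :: (nat \<times> nat \<times> nat \<Rightarrow> real) \<times> (nat \<times> nat \<times> nat \<Rightarrow> real). fst z f)"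
          by (rule continuous_on_product_then_coordinatewise[OF continuous_on_fst[OF continuous_on_id]])
        have c2: "continuous_on UNIV (\<lambda>z :: (nat \<times> nat \<times> nat \<Rightarrow> real) \<times> (nat \<times> nat \<times> nat \<Rightarrow> real). ((snd z)(e := 0)) f)"
          by (rule continuous_on_product_then_coordinatewise[OF continuous_on_fun_upd[OF continuous_on_snd[OF continuous_on_id] continuous_on_const]])
        show "continuous_on UNIV (\<lambda>z. ((snd z)(e := 0)) f + fst z f :: real)"
          by (rule continuous_on_add[OF c2 c1])
      qed
      from continuous_on_compose2[OF \<phi>(1) this]
      have \<psi>c: "continuous_on UNIV (\<lambda>z. \<psi> (snd z) (fst z))" unfolding \<psi>_def by blast
      have ind2: "P.indep_var borel (\<lambda>w. pX w e) borel (\<lambda>w. \<psi> (pX w) y)" for y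
      proof -
        let ?B = "?U - {(i, j)}"
        \<comment> \<open>The same function written in terms of the upper triangular entries other
          than (i, j), so that independence of disjoint groups of entries applies.\<close>
        define Y2 where "Y2 = (\<lambda>g :: nat \<times> nat \<Rightarrow> real. \<phi> (\<lambda>f. (if fst f = 2 \<and> snd f \<in> ?B then g (snd f) else 0) + y f))"
        have "P.indep_var (PiM {(i, j)} (\<lambda>_. borel)) (\<lambda>w. restrict (\<lambda>k. (\<lambda>(i, j) w. A w i j) k w) {(i, j)})
           (PiM ?B (\<lambda>_. borel)) (\<lambda>w. restrict (\<lambda>k. (\<lambda>(i, j) w. A w i j) k w) ?B)"
          by (rule P.indep_var_restrict[OF iv]) (use True in auto)
        then have "P.indep_var borel ((\<lambda>g. g (i, j)) \<circ> (\<lambda>w. restrict (\<lambda>k. (\<lambda>(i, j) w. A w i j) k w) {(i, j)}))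
            borel (Y2 \<circ> (\<lambda>w. restrict (\<lambda>k. (\<lambda>(i, j) w. A w i j) k w) ?B))"
        proof (rule P.indep_var_compose)
          show "(\<lambda>g. g (i, j)) \<in> borel_measurable (PiM {(i, j)} (\<lambda>_. borel :: real measure))"
            by (rule measurable_component_singleton) simp
          have "(\<lambda>g f. (if fst f = 2 \<and> snd f \<in> ?B then g (snd f) else 0) + y f) \<in> borel_measurable (PiM ?B (\<lambda>_. borel :: real measure))"
          proof (rule measurable_coordinatewise_then_product)
            fix f :: "nat \<times> nat \<times> nat"
            have "(\<lambda>g. g (snd f)) \<in> borel_measurable (PiM ?B (\<lambda>_. borel :: real measure))" if "snd f \<in> ?B"
              using that by (rule measurable_component_singleton)
            then show "(\<lambda>g. (if fst f = 2 \<and> snd f \<in> ?B then g (snd f) else 0) + y f) \<in> borel_measurable (PiM ?B (\<lambda>_. borel :: real measure))"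
              by (cases "fst f = 2 \<and> snd f \<in> ?B") auto
          qed
          from measurable_compose[OF this borel_measurable_continuous_onI[OF \<phi>(1)]]
          show "Y2 \<in> borel_measurable (PiM ?B (\<lambda>_. borel))" by (simp add: Y2_def)
        qed
        moreover have "(\<lambda>g. g (i, j)) \<circ> (\<lambda>w. restrict (\<lambda>k. (\<lambda>(i, j) w. A w i j) k w) {(i, j)}) = (\<lambda>w. pX w e)"
          using True by (auto simp: pX_def eij fun_eq_iff)
        moreover have "Y2 \<circ> (\<lambda>w. restrict (\<lambda>k. (\<lambda>(i, j) w. A w i j) k w) ?B) = (\<lambda>w. \<psi> (pX w) y)"
        proof
          fix w
          have "(\<lambda>f. (if fst f = 2 \<and> snd f \<in> ?B then restrict (\<lambda>k. (\<lambda>(i, j) w. A w i j) k w) ?B (snd f) else 0) + y f)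
             = (\<lambda>f. ((pX w)(e := 0)) f + y f)"
            by (rule ext) (auto simp: pX_def eij split: prod.splits)
          then show "(Y2 \<circ> (\<lambda>w. restrict (\<lambda>k. (\<lambda>(i, j) w. A w i j) k w) ?B)) w = \<psi> (pX w) y"
            by (simp only: comp_def Y2_def \<psi>_def)
        qed
        ultimately show ?thesis by simp
      qed
      have "(\<integral>w. pX w e * \<psi> (pX w) (pW w) \<partial>?M) = 0"
      proof (rule P.integral_centred_eq_0[OF ind, where v = "\<lambda>x. x e"])
        show "(\<lambda>x :: nat \<times> nat \<times> nat \<Rightarrow> real. x e) \<in> borel_measurable borel"
          by (rule borel_measurable_continuous_onI[OF cx])
        show "(\<lambda>z. \<psi> (snd z) (fst z)) \<in> borel_measurable borel"
          by (rule borel_measurable_continuous_onI[OF \<psi>c])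
        show "P.indep_var borel (\<lambda>w. pX w e) borel (\<lambda>w. \<psi> (pX w) y)" for y by (rule ind2)
        show "integrable ?M (\<lambda>w. pX w e)" "(\<integral>w. pX w e \<partial>?M) = 0"
          using A1(1,2)[OF True] True by (simp_all add: pX_def eij)
        show "integrable ?M (\<lambda>w. \<psi> (pX w) (pW w))" using \<phi>(3) by (simp add: \<psi>a)
        show "integrable ?M (\<lambda>w. pX w e * \<psi> (pX w) (pW w))" using \<phi>(4) by (simp add: \<psi>a ae)
      qed
      then show ?thesis by (simp add: \<psi>a ae)
    qed
  qed
  have "a \<in> centred_class M entry_coords (moment_const \<sigma> C) n"
    unfolding centred_class_def using am mom cen by auto
  then show ?thesis by (simp only: a_def)
qed

section \<open>From even moments of coordinate derivatives to suprema of L^p norms\<close>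

theorem proposition5p2:
  fixes \<sigma> C :: real
    and M :: "nat \<Rightarrow> 'a measure"
    and u0 :: "nat \<Rightarrow> 'a \<Rightarrow> nat \<Rightarrow> real"
    and Z :: "nat \<Rightarrow> 'a \<Rightarrow> nat \<Rightarrow> nat \<Rightarrow> real"
    and F :: "nat \<Rightarrow> (nat \<Rightarrow> real) \<Rightarrow> real"
  assumes sigma_pos: "\<sigma> > 0"
    and prob: "\<And>n. n \<ge> 1 \<Longrightarrow> prob_space (M n)"
    and data: "\<And>n. n \<ge> 1 \<Longrightarrow> admissible_data \<sigma> C n (M n) (u0 n) (Z n)"
    and smooth: "\<And>k. C_infinity (k + 1) (F k)"
    and bounded: "\<And>k. bounded_partials (k + 1) (F k)"
  shows "\<forall>(k::nat) (p::real) (m::nat). p \<ge> 1 \<longrightarrow>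
    (\<exists>\<Gamma> \<Gamma>' :: real. \<forall>n\<ge>2.
      (SUP (P, e, A, i) \<in> index_coll \<sigma> n (M n) (u0 n) (Z n) m.
         Lp_norm (M n) p
           (\<lambda>w. multi_deriv e P (\<lambda>X. amp F n (u0 n w) (Z n w) k X i) (A w)))
        \<le> ennreal (\<Gamma> / real n powr (real m / 2)) \<and>
      (SUP (P, e, A, i) \<in> index_coll \<sigma> n (M n) (u0 n) (Z n) m.
         Lp_norm (M n) p
           (\<lambda>w. multi_deriv e P
                  (\<lambda>X. mat_vec n (hat_mat n (Z n w) X) (amp F n (u0 n w) (Z n w) k X) i) (A w)))
        \<le> ennreal (\<Gamma>' / real n powr (real m / 2)))"
proof (intro allI impI)
  fix k m :: nat and p :: real
  assume p: "1 \<le> p"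
  interpret amp_class M "centred_class M entry_coords (moment_const \<sigma> C)" F
    by (intro amp_class.intro moment_class_centred_class prob amp_class_axioms.intro smooth bounded)
  obtain N where "p \<le> real N" using real_arch_simple by blast
  then have N: "p \<le> real (2 * N)" by simp
  \<comment> \<open>Both estimates at once: \<open>G\<close> will be \<open>amp_point\<close> and
    then \<open>hat_point\<close>, and \<open>h w\<close> is the corresponding matrix function with
    the data of the sample w frozen.\<close>
  have bound: "\<exists>\<Gamma>\<ge>0. \<forall>n\<ge>1. \<forall>P e A i h. (P, e, A, i) \<in> index_coll \<sigma> n (M n) (u0 n) (Z n) m \<longrightarrow>
      (\<forall>w\<in>space (M n). \<forall>X y. represents n (data_point n (u0 n w) (Z n w) (A w)) X y \<longrightarrow> h w X = G n i y) \<longrightarrow>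
      Lp_norm (M n) p (\<lambda>w. multi_deriv e P (h w) (A w)) \<le> ennreal ((1 + \<Gamma>) / real n powr (real m / 2))"
    if tG: "tame m (\<lambda>n. {G n i | i. i \<in> {1..n}})" for G
  proof -
    obtain \<Gamma> where \<Gamma>: "\<Gamma> \<ge> 0" and le: "\<forall>n\<ge>1. \<forall>h c es. (\<lambda>x. c * h x) \<in> {G n i | i. i \<in> {1..n}} \<and> c \<noteq> 0 \<and>
        length es = m \<and> set es \<subseteq> entry_coords \<longrightarrow> continuous_on UNIV (fold coord_deriv es h) \<and>
        (\<forall>a\<in>centred_class M entry_coords (moment_const \<sigma> C) n.
          (\<integral>\<^sup>+w. ennreal ((sqrt (real n) ^ m * c * fold coord_deriv es h (a w)) ^ (2 * N)) \<partial>M n) \<le> ennreal \<Gamma>)"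
      using tame_imp_fold_deriv_moment[OF tG, of N] by blast
    show ?thesis
    proof (intro exI[of _ \<Gamma>] conjI \<Gamma> allI impI)
      fix n :: nat and P e A i h
      assume n: "1 \<le> n" and mem: "(P, e, A, i) \<in> index_coll \<sigma> n (M n) (u0 n) (Z n) m"
        and h: "\<forall>w\<in>space (M n). \<forall>X y. represents n (data_point n (u0 n w) (Z n w) (A w)) X y \<longrightarrow> h w X = G n i y"
      have P: "P \<subseteq> {1..}" "finite P" "card P = m" and e: "e \<in> entry_seqs n"
        and A: "A \<in> rand_mats \<sigma> n (M n) (u0 n) (Z n)" and i: "i \<in> {1..n}"
        using mem by (auto simp: index_coll_def)
      define es where "es = map (\<lambda>r. (2 :: nat, e r)) (sorted_list_of_set P)"
      define a where "a = (\<lambda>w. data_point n (u0 n w) (Z n w) (A w))"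
      have a: "a \<in> centred_class M entry_coords (moment_const \<sigma> C) n"
        unfolding a_def by (rule data_point_in_centred_class, rule sigma_pos, rule prob[OF n], rule data[OF n], rule A)
      have es: "length es = m" "set es \<subseteq> entry_coords" using P by (auto simp: es_def)
      \<comment> \<open>The induction over derivatives starts with the accumulated factor c =
        1.\<close>
      have "(\<lambda>x. 1 * G n i x) \<in> {G n i | i. i \<in> {1..n}} \<and> (1 :: real) \<noteq> 0 \<and> length es = m \<and> set es \<subseteq> entry_coords"
        using i es by auto
      from mp[OF spec[OF spec[OF spec[OF mp[OF spec[OF le] n], of "G n i"], of 1], of es] this]
      have cont: "continuous_on UNIV (fold coord_deriv es (G n i))"
        and "\<forall>a\<in>centred_class M entry_coords (moment_const \<sigma> C) n.
          (\<integral>\<^sup>+w. ennreal ((sqrt (real n) ^ m * 1 * fold coord_deriv es (G n i) (a w)) ^ (2 * N)) \<partial>M n) \<le> ennreal \<Gamma>"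
        by (rule conjunct1, rule conjunct2)
      from bspec[OF this(2) a]
      have mom: "(\<integral>\<^sup>+w. ennreal ((sqrt (real n) ^ m * 1 * fold coord_deriv es (G n i) (a w)) ^ (2 * N)) \<partial>M n) \<le> ennreal \<Gamma>" .
      \<comment> \<open>Valid on the sample space only, since symmetry of A is known just there;
        hence the congruence rules for measurability and integrals below.\<close>
      have eq: "multi_deriv e P (h w) (A w) = fold coord_deriv es (G n i) (a w)" if w: "w \<in> space (M n)" for w
        unfolding multi_deriv_def es_def
      proof (rule fold_entry_deriv_eq[where n = n and z = "a w"])
        show "h w X = G n i y" if "represents n (a w) X y" for X y
          using h w that unfolding a_def by blast
        show "fst (e r) \<in> {1..n} \<and> snd (e r) \<in> {1..n} \<and> fst (e r) < snd (e r)" if "r \<in> set (sorted_list_of_set P)" for r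
          using that P e by (auto simp: entry_seqs_def)
        have "sym_on n (A w)" using A w by (auto simp: rand_mats_def)
        then show "represents n (a w) (A w) (a w)" unfolding a_def by (rule represents_data_point)
      qed
      have fm: "(\<lambda>w. fold coord_deriv es (G n i) (a w)) \<in> borel_measurable (M n)"
        by (rule measurable_compose_cls[OF n a cont])
      have "Lp_norm (M n) p (\<lambda>w. multi_deriv e P (h w) (A w)) \<le> ennreal ((1 + \<Gamma>) / sqrt (real n) ^ m)"
      proof (rule Lp_norm_le[OF prob[OF n] _ p N _ \<Gamma>])
        show "(\<lambda>w. multi_deriv e P (h w) (A w)) \<in> borel_measurable (M n)"
          using fm by (subst measurable_cong[OF eq])
        show "0 < sqrt (real n) ^ m" using n by simp
        have "(\<integral>\<^sup>+w. ennreal ((sqrt (real n) ^ m * multi_deriv e P (h w) (A w)) ^ (2 * N)) \<partial>M n)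
           = (\<integral>\<^sup>+w. ennreal ((sqrt (real n) ^ m * 1 * fold coord_deriv es (G n i) (a w)) ^ (2 * N)) \<partial>M n)"
          by (rule nn_integral_cong) (simp add: eq)
        then show "(\<integral>\<^sup>+w. ennreal ((sqrt (real n) ^ m * multi_deriv e P (h w) (A w)) ^ (2 * N)) \<partial>M n) \<le> ennreal \<Gamma>"
          using mom by simp
      qed
      moreover have "sqrt (real n) ^ m = real n powr (real m / 2)"
        using n by (simp add: powr_half_sqrt[symmetric] powr_realpow[symmetric] powr_powr)
      ultimately show "Lp_norm (M n) p (\<lambda>w. multi_deriv e P (h w) (A w)) \<le> ennreal ((1 + \<Gamma>) / real n powr (real m / 2))"
        by simp
    qed
  qed
  have "tame m (\<lambda>n. {amp_point F n k i | i. i \<in> {1..n}})"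
    using tame_amp[of m k] by (simp add: amp_fam_def[abs_def])
  from bound[OF this] obtain \<Gamma> where \<Gamma>: "\<forall>n\<ge>1. \<forall>P e A i h. (P, e, A, i) \<in> index_coll \<sigma> n (M n) (u0 n) (Z n) m \<longrightarrow>
      (\<forall>w\<in>space (M n). \<forall>X y. represents n (data_point n (u0 n w) (Z n w) (A w)) X y \<longrightarrow> h w X = amp_point F n k i y) \<longrightarrow>
      Lp_norm (M n) p (\<lambda>w. multi_deriv e P (h w) (A w)) \<le> ennreal ((1 + \<Gamma>) / real n powr (real m / 2))" by blast
  have "tame m (\<lambda>n. {hat_point F n k i | i. i \<in> {1..n}})"
    using tame_hat[OF tame_amp, of m k] by (simp add: hat_fam_def[abs_def])
  from bound[OF this] obtain \<Gamma>' where \<Gamma>': "\<forall>n\<ge>1. \<forall>P e A i h. (P, e, A, i) \<in> index_coll \<sigma> n (M n) (u0 n) (Z n) m \<longrightarrow>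
      (\<forall>w\<in>space (M n). \<forall>X y. represents n (data_point n (u0 n w) (Z n w) (A w)) X y \<longrightarrow> h w X = hat_point F n k i y) \<longrightarrow>
      Lp_norm (M n) p (\<lambda>w. multi_deriv e P (h w) (A w)) \<le> ennreal ((1 + \<Gamma>') / real n powr (real m / 2))" by blast
  have amp_le: "Lp_norm (M n) p (\<lambda>w. multi_deriv e P (\<lambda>X. amp F n (u0 n w) (Z n w) k X i) (A w))
        \<le> ennreal ((1 + \<Gamma>) / real n powr (real m / 2))"
    and hat_le: "Lp_norm (M n) p (\<lambda>w. multi_deriv e P (\<lambda>X. mat_vec n (hat_mat n (Z n w) X) (amp F n (u0 n w) (Z n w) k X) i) (A w))
        \<le> ennreal ((1 + \<Gamma>') / real n powr (real m / 2))"
    if n: "2 \<le> n" and mem: "(P, e, A, i) \<in> index_coll \<sigma> n (M n) (u0 n) (Z n) m" for n P e A i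
  proof -
    have i: "i \<in> {1..n}" and n1: "1 \<le> n" using mem n by (auto simp: index_coll_def)
    show "Lp_norm (M n) p (\<lambda>w. multi_deriv e P (\<lambda>X. amp F n (u0 n w) (Z n w) k X i) (A w))
        \<le> ennreal ((1 + \<Gamma>) / real n powr (real m / 2))"
      by (rule \<Gamma>[rule_format, OF n1 mem]) (rule amp_eq_amp_point[OF _ i])
    show "Lp_norm (M n) p (\<lambda>w. multi_deriv e P (\<lambda>X. mat_vec n (hat_mat n (Z n w) X) (amp F n (u0 n w) (Z n w) k X) i) (A w))
        \<le> ennreal ((1 + \<Gamma>') / real n powr (real m / 2))"
      by (rule \<Gamma>'[rule_format, OF n1 mem]) (rule hat_eq_hat_point[OF _ i])
  qed
  show "\<exists>\<Gamma> \<Gamma>' :: real. \<forall>n\<ge>2.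
      (SUP (P, e, A, i) \<in> index_coll \<sigma> n (M n) (u0 n) (Z n) m.
         Lp_norm (M n) p
           (\<lambda>w. multi_deriv e P (\<lambda>X. amp F n (u0 n w) (Z n w) k X i) (A w)))
        \<le> ennreal (\<Gamma> / real n powr (real m / 2)) \<and>
      (SUP (P, e, A, i) \<in> index_coll \<sigma> n (M n) (u0 n) (Z n) m.
         Lp_norm (M n) p
           (\<lambda>w. multi_deriv e P
                  (\<lambda>X. mat_vec n (hat_mat n (Z n w) X) (amp F n (u0 n w) (Z n w) k X) i) (A w)))
        \<le> ennreal (\<Gamma>' / real n powr (real m / 2))"
    by (rule exI[of _ "1 + \<Gamma>"], rule exI[of _ "1 + \<Gamma>'"], intro allI impI conjI;
        rule SUP_least, clarsimp simp: amp_le hat_le)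
qed

end
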